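(* Let $\Delta\ge 3$, $c\in[0,\Delta-2]$, $\kappa=\Delta+c$. In the incremental model for general (unrooted) forests of maximum degree at most $\Delta$, {\textsc{DistMaint}} has expected amortized recourse $\Theta(1/\Delta)$: for every insertion sequence (fixed in advance) its expected amortized recourse is $O(1/\Delta)$, and there are insertion sequences for which it is $\Omega(1/\Delta)$.
   Context: A dynamic forest on a fixed vertex set starts empty; each update inserts an edge joining two distinct trees; maximum degree stays at most $\Delta$. The palette is $[\kappa]$; $A(x)$ denotes the colors not used on edges incident to $x$. Recourse of an update = number of previously colored edges whose color changes; expected amortized recourse = expectation of total recourse divided by number of updates; the adversary is oblivious (sequence fixed in advance). {\textsc{DistMaint}} keeps a designated root in every tree (initially every vertex is a root; rerooting changes only the designation, not colors). Insertion of $(u,v)$ with $T_u,T_v$ the trees of $u,v$: if both $T_u$ and $T_v$ have at most $\Delta$ edges, name the endpoints so that $\deg(v)\le\deg(u)$; otherwise so that $|E(T_v)|\le|E(T_u)|$. Reroot $T_v$ at $v$, make $v$ a child of $u$, choose the color $\beta$ of $(u,v)$ uniformly at random from $A(u)$, and call RootToChild$(v,\beta)$. RootToChild$(r,\beta)$: if no child edge of $r$ has color $\beta$, stop; else let $(r,w)$ be that edge, choose $\alpha$ uniformly from $A(r)$, recolor $(r,w)$ to $\alpha$, call FixForbidden$(w,\beta,\alpha)$. FixForbidden$(v,\alpha,\beta)$: if no child edge of $v$ has color $\beta$, stop; else recolor that child edge $(v,w)$ to $\alpha$ and call FixForbidden$(w,\beta,\alpha)$. Random choices are independent. *)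

theory Defs
  imports "HOL-Probability.Probability"
begin

section \<open>Dynamic forests under edge insertions\<close>

text \<open>Vertices are natural numbers, edges are two-element sets of vertices.\<close>

definition linked :: "nat set set \<Rightarrow> nat \<Rightarrow> nat \<Rightarrow> bool" where
  "linked E = (\<lambda>a b. {a, b} \<in> E)\<^sup>*\<^sup>*"

definition tree :: "nat set set \<Rightarrow> nat \<Rightarrow> nat set" where
  "tree E x = {y. linked E x y}"

definition tree_edges :: "nat set set \<Rightarrow> nat \<Rightarrow> nat set set" where
  "tree_edges E x = {e \<in> E. e \<subseteq> tree E x}"

definition degree :: "nat set set \<Rightarrow> nat \<Rightarrow> nat" where
  "degree E x = card {e \<in> E. x \<in> e}"

definition edges_of :: "(nat \<times> nat) list \<Rightarrow> nat set set" where
  "edges_of us = (\<lambda>(x, y). {x, y}) ` set us"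

definition insertion_sequence :: "nat set \<Rightarrow> nat \<Rightarrow> (nat \<times> nat) list \<Rightarrow> bool" where
  "insertion_sequence V \<Delta> us \<longleftrightarrow>
     (\<forall>i<length us. case us ! i of (x, y) \<Rightarrow>
        x \<in> V \<and> y \<in> V \<and> \<not> linked (edges_of (take i us)) x y) \<and>
     (\<forall>i\<le>length us. \<forall>x\<in>V. degree (edges_of (take i us)) x \<le> \<Delta>)"

definition simple_path :: "nat set set \<Rightarrow> nat list \<Rightarrow> bool" where
  "simple_path E p \<longleftrightarrow> distinct p \<and> successively (\<lambda>a b. {a, b} \<in> E) p"

text \<open>For a set \<open>R\<close> of designated roots, \<open>w\<close> is a child of \<open>v\<close> iff \<open>v\<close> is the
  last vertex before \<open>w\<close> on the path from the root of the tree to \<open>w\<close>.\<close>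

definition child :: "nat set set \<Rightarrow> nat set \<Rightarrow> nat \<Rightarrow> nat \<Rightarrow> bool" where
  "child E R v w \<longleftrightarrow> (\<exists>p. simple_path E (p @ [v, w]) \<and> hd (p @ [v, w]) \<in> R)"

definition reroot :: "nat set set \<Rightarrow> nat \<Rightarrow> nat set \<Rightarrow> nat set" where
  "reroot E v R = insert v (R - tree E v)"

section \<open>The algorithm DistMaint\<close>

text \<open>A coloring is a partial map from edges to colors whose domain is the current
  edge set.  A state consists of the set of designated roots and the coloring.\<close>

type_synonym coloring = "nat set \<Rightarrow> nat option"
type_synonym state = "nat set \<times> coloring"

definition available :: "nat \<Rightarrow> coloring \<Rightarrow> nat \<Rightarrow> nat set" where
  "available \<kappa> col x = {1..\<kappa>} - {k. \<exists>e. x \<in> e \<and> col e = Some k}"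

definition colored_child :: "nat set \<Rightarrow> coloring \<Rightarrow> nat \<Rightarrow> nat \<Rightarrow> nat \<Rightarrow> bool" where
  "colored_child R col v k w \<longleftrightarrow> child (dom col) R v w \<and> col {v, w} = Some k"

partial_function (tailrec) fix_forbidden ::
  "nat set \<Rightarrow> coloring \<Rightarrow> nat \<Rightarrow> nat \<Rightarrow> nat \<Rightarrow> coloring" where
  "fix_forbidden R col v \<alpha> \<beta> =
     (if \<exists>w. colored_child R col v \<beta> w
      then let w = (THE w. colored_child R col v \<beta> w)
           in fix_forbidden R (col({v, w} \<mapsto> \<alpha>)) w \<beta> \<alpha>
      else col)"

definition root_to_child ::
  "nat \<Rightarrow> nat set \<Rightarrow> coloring \<Rightarrow> nat \<Rightarrow> nat \<Rightarrow> coloring pmf" where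
  "root_to_child \<kappa> R col r \<beta> =
     (if \<exists>w. colored_child R col r \<beta> w
      then let w = (THE w. colored_child R col r \<beta> w)
           in do {
             \<alpha> \<leftarrow> pmf_of_set (available \<kappa> col r);
             return_pmf (fix_forbidden R (col({r, w} \<mapsto> \<alpha>)) w \<beta> \<alpha>)
           }
      else return_pmf col)"

text \<open>\<open>may_attach \<Delta> E u v\<close>: in the forest \<open>E\<close> before the insertion, the endpoints
  may be named such that \<open>v\<close> becomes a child of \<open>u\<close>.\<close>

definition may_attach :: "nat \<Rightarrow> nat set set \<Rightarrow> nat \<Rightarrow> nat \<Rightarrow> bool" where
  "may_attach \<Delta> E u v \<longleftrightarrow>
     (if card (tree_edges E u) \<le> \<Delta> \<and> card (tree_edges E v) \<le> \<Delta>
      then degree E v \<le> degree E u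
      else card (tree_edges E v) \<le> card (tree_edges E u))"

text \<open>If both namings are allowed, the flag \<open>b\<close> decides whether \<open>u = x\<close>.\<close>

definition name_endpoints ::
  "nat \<Rightarrow> nat set set \<Rightarrow> bool \<Rightarrow> nat \<times> nat \<Rightarrow> nat \<times> nat" where
  "name_endpoints \<Delta> E b = (\<lambda>(x, y).
     if may_attach \<Delta> E x y \<and> (may_attach \<Delta> E y x \<longrightarrow> b) then (x, y) else (y, x))"

text \<open>Once \<open>v\<close> has become a child of \<open>u\<close>, it is no longer a designated root.\<close>

definition insert_edge ::
  "nat \<Rightarrow> nat \<Rightarrow> bool \<Rightarrow> state \<Rightarrow> nat \<times> nat \<Rightarrow> state pmf" where
  "insert_edge \<Delta> \<kappa> b = (\<lambda>(R, col) xy.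
     let (u, v) = name_endpoints \<Delta> (dom col) b xy;
         R' = reroot (dom col) v R - {v}
     in do {
       \<beta> \<leftarrow> pmf_of_set (available \<kappa> col u);
       col' \<leftarrow> root_to_child \<kappa> R' (col({u, v} \<mapsto> \<beta>)) v \<beta>;
       return_pmf (R', col')
     })"

definition recourse :: "coloring \<Rightarrow> coloring \<Rightarrow> nat" where
  "recourse col col' = card {e \<in> dom col. col' e \<noteq> col e}"

text \<open>The algorithm leaves open how ties in the naming of the endpoints are broken.
  A tie-breaking rule sees the earlier insertions (latest first) and the current one,
  but not the random choices made so far.\<close>

type_synonym tie_rule = "(nat \<times> nat) list \<Rightarrow> nat \<times> nat \<Rightarrow> bool"

text \<open>Joint distribution of the state and the total recourse after a sequence of
  insertions, listed latest first.\<close>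

fun dist_maint_rev ::
  "nat \<Rightarrow> nat \<Rightarrow> tie_rule \<Rightarrow> nat set \<Rightarrow> (nat \<times> nat) list \<Rightarrow> (state \<times> nat) pmf" where
  "dist_maint_rev \<Delta> \<kappa> tie V [] = return_pmf ((V, Map.empty), 0)"
| "dist_maint_rev \<Delta> \<kappa> tie V (xy # us) = do {
     (s, n) \<leftarrow> dist_maint_rev \<Delta> \<kappa> tie V us;
     s' \<leftarrow> insert_edge \<Delta> \<kappa> (tie us xy) s xy;
     return_pmf (s', n + recourse (snd s) (snd s'))
   }"

definition dist_maint ::
  "nat \<Rightarrow> nat \<Rightarrow> tie_rule \<Rightarrow> nat set \<Rightarrow> (nat \<times> nat) list \<Rightarrow> (state \<times> nat) pmf" where
  "dist_maint \<Delta> \<kappa> tie V us = dist_maint_rev \<Delta> \<kappa> tie V (rev us)"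

definition expected_amortized_recourse ::
  "nat \<Rightarrow> nat \<Rightarrow> tie_rule \<Rightarrow> nat set \<Rightarrow> (nat \<times> nat) list \<Rightarrow> real" where
  "expected_amortized_recourse \<Delta> \<kappa> tie V us =
     measure_pmf.expectation (dist_maint \<Delta> \<kappa> tie V us) (\<lambda>(s, n). real n) / real (length us)"

end

theory Submission
  imports Defs
begin

text \<open>
  At all times the coloring is uniformly distributed over the proper edge colorings of the forest,
  while the roots do not depend on the random choices.  Indeed, when \<open>v\<close> is attached to \<open>u\<close>, the
  algorithm swaps two colors on the Kempe chain of \<open>v\<close>; this is an involution, so every coloring of
  the new forest arises from one coloring without a swap and from \<open>deg v\<close> colorings with a swap.

  Kempe swaps also show that a path with \<open>k \<ge> 2\<close> edges is bichromatic with probability at most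
  \<open>(\<kappa> - 1)\<^bsup>2 - k\<^esup>\<close>.  Hence an insertion has expected recourse at least \<open>deg v / \<kappa>\<close> and at most
  \<open>1 / \<kappa>\<close> times the sum of \<open>(\<kappa> - 1)\<^bsup>1 - dist(v, x)\<^esup>\<close> over the vertices \<open>x \<noteq> v\<close> of the tree of \<open>v\<close>.  If this
  tree has \<open>m\<close> edges, the upper bound is at most \<open>m / \<kappa>\<close>, at most \<open>(deg v + m / (\<kappa> - 1)) / \<kappa>\<close>, and
  \<open>O(\<surd>(m / \<Delta>))\<close>.  Merges of two small trees are paid for by the sum of \<open>min (deg x) (deg y)\<close> over
  the edges \<open>{x, y}\<close>, which is at most twice the number of edges; the other merges are paid for by a
  potential of the vertices which increases with the size of their trees and is \<open>O(1 / \<Delta>)\<close>.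
\<close>

section \<open>Paths in forests\<close>

text \<open>The bound m / \<kappa> alone is too weak for large trees: charging 1 / \<Delta> to each
  vertex whenever its tree doubles would leave a logarithmic factor. With the cost sqrt(m /
  \<Delta>) each of the m vertices pays 1 / sqrt(m \<Delta>), a geometric series over the doublings
  that is dominated by its first term. That term is O(1 / \<Delta>) only if the series starts at m
  of order \<Delta>, which is why small trees are compared by degree and need a second potential. An
  insertion is analysed backwards: sums over the old coloring and the random choices are regrouped
  by the resulting coloring. The recolored chain together with {u, v} is then a bichromatic path of
  a uniformly random coloring of the new forest, so the recourse is bounded by an expected number of
  bichromatic paths. The recourse so far and the coloring may be dependent. Only the marginal law of
  the coloring is shown to be uniform, and linearity of expectation makes this sufficient.\<close>

lemma linked_refl [simp]: "linked E x x"
  by (simp add: linked_def)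

lemma linked_edge: "{x, y} \<in> E \<Longrightarrow> linked E x y"
  by (auto simp: linked_def)

lemma linked_trans: "linked E x y \<Longrightarrow> linked E y z \<Longrightarrow> linked E x z"
  by (auto simp: linked_def)

lemma linked_sym: "linked E x y \<Longrightarrow> linked E y x"
  unfolding linked_def
proof (induction rule: rtranclp_induct)
  case (step y z)
  have "{z, y} \<in> E" using step.hyps by (simp add: insert_commute)
  then show ?case using step.IH by (intro converse_rtranclp_into_rtranclp[of _ z y])
qed simp

lemma linked_induct [consumes 1, case_names refl step]:
  assumes "linked E x y" and "P x"
    and "\<And>y z. linked E x y \<Longrightarrow> {y, z} \<in> E \<Longrightarrow> P y \<Longrightarrow> P z"
  shows "P y"
  using assms(1) unfolding linked_def
  by (induction rule: rtranclp_induct) (use assms(2,3) in \<open>auto simp: linked_def\<close>)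

lemma linked_mono: "linked E x y \<Longrightarrow> E \<subseteq> F \<Longrightarrow> linked F x y"
  by (induction rule: linked_induct) (auto intro: linked_trans linked_edge)

lemma linked_insertD:
  assumes "linked (insert {u, v} E) x y"
  shows "linked E x y \<or> linked E x u \<and> linked E v y \<or> linked E x v \<and> linked E u y"
  using assms
proof (induction rule: linked_induct)
  case (step y z)
  show ?case
  proof (cases "{y, z} \<in> E")
    case True
    then show ?thesis using step.IH by (meson linked_edge linked_trans)
  next
    case False
    then have "y = u \<and> z = v \<or> y = v \<and> z = u" using step.hyps by (auto simp: doubleton_eq_iff)
    then show ?thesis using step.IH by auto
  qed
qed simp

lemma tree_self [simp]: "x \<in> tree E x"
  by (simp add: tree_def)

lemma tree_eq: "linked E x y \<Longrightarrow> tree E x = tree E y"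
  unfolding tree_def by (rule Collect_cong) (meson linked_sym linked_trans)

lemma tree_insert_joined:
  assumes "linked E x u \<or> linked E x v"
  shows "tree (insert {u, v} E) x = tree E u \<union> tree E v"
proof -
  let ?E' = "insert {u, v} E"
  have mono: "linked ?E' a b" if "linked E a b" for a b
    using that by (rule linked_mono) auto
  have uv: "linked ?E' u v" by (rule linked_edge) simp
  have xu: "linked ?E' x u" using assms mono uv by (meson linked_sym linked_trans)
  show ?thesis
  proof (intro equalityI subsetI)
    fix y assume "y \<in> tree ?E' x"
    then have "linked ?E' x y" by (simp add: tree_def)
    then have "linked ?E' u y" using linked_trans[OF linked_sym[OF xu]] by blast
    then show "y \<in> tree E u \<union> tree E v" unfolding tree_def using linked_insertD[of u v E u y] by blast
  next
    fix y assume "y \<in> tree E u \<union> tree E v"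
    then have "linked E u y \<or> linked E v y" by (simp add: tree_def)
    then have "linked ?E' u y" using mono linked_trans[OF uv] by blast
    then show "y \<in> tree ?E' x" using linked_trans[OF xu] by (simp add: tree_def)
  qed
qed

text \<open>Acyclicity is stated as every edge being a bridge, a property that passes to subsets and
  speaks about \<open>linked\<close> only. Loops are excluded as well, since \<open>linked\<close>
  is reflexive.\<close>

definition forest :: "nat set set \<Rightarrow> bool" where
  "forest E \<longleftrightarrow> (\<forall>e\<in>E. \<exists>x y. e = {x, y}) \<and> (\<forall>x y. {x, y} \<in> E \<longrightarrow> \<not> linked (E - {{x, y}}) x y)"

lemma forest_pair: "forest E \<Longrightarrow> e \<in> E \<Longrightarrow> \<exists>x y. e = {x, y}"
  by (simp add: forest_def)

lemma forest_bridge: "forest E \<Longrightarrow> {x, y} \<in> E \<Longrightarrow> \<not> linked (E - {{x, y}}) x y"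
  by (simp add: forest_def)

lemma forest_edge_neq:
  assumes "forest E" "{x, y} \<in> E"
  shows "x \<noteq> y"
proof
  assume "x = y"
  then have "linked (E - {{x, y}}) x y" by simp
  then show False using forest_bridge[OF assms] by simp
qed

lemma forest_edgeE:
  assumes "forest E" "e \<in> E"
  obtains x y where "e = {x, y}" "x \<noteq> y"
proof -
  obtain x y where "e = {x, y}" using forest_pair[OF assms] by blast
  then show ?thesis using that[of x y] forest_edge_neq[of E x y] assms by simp
qed

lemma forest_subset:
  assumes E: "forest E" and F: "F \<subseteq> E"
  shows "forest F"
  unfolding forest_def
proof (intro conjI ballI allI impI)
  fix e assume "e \<in> F"
  then show "\<exists>x y. e = {x, y}" using F forest_pair[OF E] by blast
next
  fix x y assume "{x, y} \<in> F"
  then have "\<not> linked (E - {{x, y}}) x y" using F forest_bridge[OF E] by blast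
  moreover have "F - {{x, y}} \<subseteq> E - {{x, y}}" using F by blast
  ultimately show "\<not> linked (F - {{x, y}}) x y" using linked_mono by blast
qed

text \<open>If an old edge {x, y} ceased to be a bridge, the detour would cross {u, v}; its two
  halves together with {x, y} would link \<open>u\<close> to \<open>v\<close> in
  \<open>E\<close>.\<close>

lemma forest_insert:
  assumes E: "forest E" and uv: "\<not> linked E u v"
  shows "forest (insert {u, v} E)"
proof -
  have "\<not> linked (insert {u, v} E - {{x, y}}) x y" if xy: "{x, y} \<in> insert {u, v} E" for x y
  proof (cases "{x, y} = {u, v}")
    case True
    have "{u, v} \<notin> E" using uv linked_edge by blast
    then have "insert {u, v} E - {{x, y}} = E" using True by auto
    moreover have "\<not> linked E x y"
      using True uv linked_sym by (auto simp: doubleton_eq_iff)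
    ultimately show ?thesis by simp
  next
    case False
    then have xyE: "{x, y} \<in> E" using xy by blast
    let ?F = "E - {{x, y}}"
    have eq: "insert {u, v} E - {{x, y}} = insert {u, v} ?F" using False by auto
    have F: "linked E a b" if "linked ?F a b" for a b using that by (rule linked_mono) auto
    have "\<not> linked ?F x y" using forest_bridge[OF E xyE] .
    moreover have xy_linked: "linked E x y" using xyE by (rule linked_edge)
    moreover have False if "linked ?F x u" "linked ?F v y"
      using uv linked_trans[OF linked_trans[OF linked_sym[OF F[OF that(1)]] xy_linked] linked_sym[OF F[OF that(2)]]]
      by simp
    moreover have False if "linked ?F x v" "linked ?F u y"
      using uv linked_trans[OF linked_trans[OF F[OF that(2)] linked_sym[OF xy_linked]] F[OF that(1)]]
      by simp
    ultimately show ?thesis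
      unfolding eq using linked_insertD[of u v ?F x y] by blast
  qed
  then show ?thesis using forest_pair[OF E] by (auto simp: forest_def)
qed

section \<open>Simple paths and their uniqueness in forests\<close>

lemma simple_path_Nil [simp]: "simple_path E []"
  by (simp add: simple_path_def)

lemma simple_path_single [simp]: "simple_path E [x]"
  by (simp add: simple_path_def)

lemma simple_path_Cons_Cons [simp]:
  "simple_path E (x # y # p) \<longleftrightarrow> {x, y} \<in> E \<and> x \<notin> set (y # p) \<and> simple_path E (y # p)"
  by (auto simp: simple_path_def)

lemma simple_path_append:
  "p \<noteq> [] \<Longrightarrow> q \<noteq> [] \<Longrightarrow> simple_path E (p @ q) \<longleftrightarrow>
    simple_path E p \<and> simple_path E q \<and> set p \<inter> set q = {} \<and> {last p, hd q} \<in> E"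
  by (auto simp: simple_path_def successively_append_iff)

lemma simple_path_appendD1: "simple_path E (p @ q) \<Longrightarrow> simple_path E p"
  by (auto simp: simple_path_def successively_append_iff)

lemma simple_path_appendD2: "simple_path E (p @ q) \<Longrightarrow> simple_path E q"
  by (auto simp: simple_path_def successively_append_iff)

lemma simple_path_snoc:
  "p \<noteq> [] \<Longrightarrow> simple_path E (p @ [y]) \<longleftrightarrow> simple_path E p \<and> y \<notin> set p \<and> {last p, y} \<in> E"
  by (auto simp: simple_path_append)

lemma simple_path_mono: "simple_path E p \<Longrightarrow> E \<subseteq> F \<Longrightarrow> simple_path F p"
  unfolding simple_path_def by (auto elim: successively_mono)

lemma simple_path_avoid:
  assumes "simple_path E p" "x \<notin> set p" "x \<in> e"
  shows "simple_path (E - {e}) p"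
  using assms by (induction p rule: induct_list012) auto

lemma simple_path_linked:
  assumes "simple_path E p" "x \<in> set p"
  shows "linked E (hd p) x"
  using assms
proof (induction p rule: induct_list012)
  case (3 a b p)
  have ab: "linked E a b" using "3.prems" by (intro linked_edge) simp
  have "linked E b x" if "x \<noteq> a" using "3.IH"(2) "3.prems" that by simp
  then show ?case using linked_trans[OF ab] by (cases "x = a") simp_all
qed auto

lemma linked_simple_path:
  assumes "linked E x y"
  obtains p where "simple_path E p" "p \<noteq> []" "hd p = x" "last p = y"
proof -
  from assms have "\<exists>p. simple_path E p \<and> p \<noteq> [] \<and> hd p = x \<and> last p = y"
  proof (induction rule: linked_induct)
    case refl
    show ?case by (intro exI[of _ "[x]"]) auto
  next
    case (step y z)
    then obtain p where p: "simple_path E p" "p \<noteq> []" "hd p = x" "last p = y" by blast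
    show ?case
    proof (cases "z \<in> set p")
      case True
      then obtain a b where ab: "p = a @ z # b" by (meson split_list)
      then have "simple_path E (a @ [z])" using p simple_path_appendD1[of E "a @ [z]" b] by simp
      moreover have "hd (a @ [z]) = x" using ab p by (cases a) auto
      ultimately show ?thesis by (intro exI[of _ "a @ [z]"]) auto
    next
      case False
      then show ?thesis using p step.hyps by (intro exI[of _ "p @ [z]"]) (auto simp: simple_path_snoc)
    qed
  qed
  then show ?thesis using that by blast
qed

lemma simple_path_tree: "simple_path E p \<Longrightarrow> set p \<subseteq> tree E (hd p)"
  by (auto simp: tree_def simple_path_linked)

text \<open>Where two paths diverge after \<open>x\<close>, to \<open>y\<close> and to
  \<open>z\<close>, both remainders avoid \<open>x\<close> and hence the edge {x, y}. Walking from
  \<open>x\<close> over \<open>z\<close> to the common end and back to \<open>y\<close> bypasses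
  that edge, although it is a bridge.\<close>

lemma forest_path_unique:
  assumes "forest E" "simple_path E p" "simple_path E q" "p \<noteq> []" "q \<noteq> []"
    "hd p = hd q" "last p = last q"
  shows "p = q"
  using assms(2-)
proof (induction p arbitrary: q rule: induct_list012)
  case (2 x)
  show ?case
  proof (cases q rule: remdups_adj.cases)
    case (3 a b r)
    then have "last q \<in> set (b # r)" by simp
    then show ?thesis using 2 3 by auto
  qed (use 2 in auto)
next
  case (3 x y p)
  obtain z q' where q: "q = x # z # q'"
  proof (cases q rule: remdups_adj.cases)
    case (2 a)
    have "last (y # p) \<in> set (y # p)" by simp
    then show ?thesis using "3.prems" 2 by simp
  qed (use "3.prems" in auto)
  show ?case
  proof (cases "y = z")
    case True
    then have "y # p = z # q'" using "3.prems" q by (intro "3.IH"(2)) auto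
    then show ?thesis using q by simp
  next
    case False
    let ?F = "E - {{x, y}}"
    have "simple_path ?F (y # p)" using "3.prems"(1) by (intro simple_path_avoid[of _ _ x]) auto
    from simple_path_linked[OF this, of "last (y # p)"] have y: "linked ?F y (last (y # p))" by simp
    have "simple_path ?F (z # q')" using "3.prems"(2) q by (intro simple_path_avoid[of _ _ x]) auto
    from simple_path_linked[OF this, of "last (z # q')"] have "linked ?F z (last (z # q'))" by simp
    moreover have "linked ?F x z" using "3.prems"(2) q False by (intro linked_edge) (auto simp: doubleton_eq_iff)
    ultimately have "linked ?F x (last (z # q'))" by (rule linked_trans[rotated])
    moreover have "last (z # q') = last (y # p)" using "3.prems" q by simp
    ultimately have "linked ?F x (last (y # p))" by simp
    then have "linked ?F x y" by (rule linked_trans[OF _ linked_sym[OF y]])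
    moreover have "{x, y} \<in> E" using "3.prems" by simp
    ultimately show ?thesis using forest_bridge[OF assms(1)] by simp
  qed
qed auto

text \<open>The piece of the path from \<open>y\<close> to \<open>x\<close> has the same ends as the
  single edge {y, x}, so the two coincide: forest paths have no chords.\<close>

lemma forest_path_chord:
  assumes "forest E" "simple_path E (p @ [x])" "y \<in> set p" "{x, y} \<in> E"
  shows "p \<noteq> []" "last p = y"
proof -
  show "p \<noteq> []" using assms(3) by auto
  obtain a b where ab: "p = a @ y # b" using assms(3) by (meson split_list)
  have "simple_path E (y # b @ [x])"
    using assms(2) simple_path_appendD2[of E a "y # b @ [x]"] ab by simp
  moreover have "simple_path E [y, x]"
    using assms forest_edge_neq[OF assms(1,4)] by (auto simp: insert_commute)
  ultimately have "y # b @ [x] = [y, x]"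
    by (intro forest_path_unique[OF assms(1)]) auto
  then show "last p = y" using ab by simp
qed

text \<open>A path stands for its end vertex and also for its final edge, so one finite set counts
  both the other vertices and the edges of the tree of \<open>v\<close>. The end vertex has distance
  \<open>length q - 1\<close> from \<open>v\<close>.\<close>

definition paths_from :: "nat set set \<Rightarrow> nat \<Rightarrow> nat list set" where
  "paths_from E v = {q. simple_path E q \<and> hd q = v \<and> 2 \<le> length q}"

lemma finite_tree:
  assumes "finite E" "\<forall>e\<in>E. finite e"
  shows "finite (tree E v)"
proof -
  have "y \<in> insert v (\<Union>E)" if "linked E v y" for y
    using that by (induction rule: linked_induct) auto
  then have "tree E v \<subseteq> insert v (\<Union>E)" by (auto simp: tree_def)
  then show ?thesis using assms by (auto intro: finite_subset)
qed

lemma forest_finite_edge: "forest E \<Longrightarrow> \<forall>e\<in>E. finite e"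
  by (auto elim: forest_edgeE)

lemma finite_paths_from:
  assumes "finite E" "forest E"
  shows "finite (paths_from E v)"
proof -
  have fin: "finite (tree E v)" using assms forest_finite_edge finite_tree by blast
  have "paths_from E v \<subseteq> {q. set q \<subseteq> tree E v \<and> length q \<le> card (tree E v)}"
  proof
    fix q assume "q \<in> paths_from E v"
    then have q: "simple_path E q" "hd q = v" by (auto simp: paths_from_def)
    then have "set q \<subseteq> tree E v" "distinct q" using simple_path_tree by (auto simp: simple_path_def)
    then show "q \<in> {q. set q \<subseteq> tree E v \<and> length q \<le> card (tree E v)}"
      using fin by (auto simp flip: distinct_card intro!: card_mono)
  qed
  then show ?thesis using fin finite_lists_length_le finite_subset by blast
qed

text \<open>If the path to \<open>x\<close> avoids \<open>y\<close>, the edge can be appended to it.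
  Otherwise the path contains \<open>y\<close>, and as it has no chords the edge is its final
  one.\<close>

lemma tree_edges_paths:
  assumes "forest E"
  shows "tree_edges E v \<subseteq> (\<lambda>q. {last (butlast q), last q}) ` paths_from E v"
proof
  fix e assume e: "e \<in> tree_edges E v"
  then have eE: "e \<in> E" by (simp add: tree_edges_def)
  obtain x y where xy: "e = {x, y}" "x \<noteq> y" using forest_edgeE[OF assms eE] .
  have "linked E v x" using e xy by (auto simp: tree_edges_def tree_def)
  then obtain p where p: "simple_path E p" "p \<noteq> []" "hd p = v" "last p = x"
    by (rule linked_simple_path)
  show "e \<in> (\<lambda>q. {last (butlast q), last q}) ` paths_from E v"
  proof (cases "y \<in> set p")
    case False
    then have "simple_path E (p @ [y])" using p eE xy by (simp add: simple_path_snoc)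
    then have "p @ [y] \<in> paths_from E v"
      using p by (auto simp: paths_from_def Suc_le_eq)
    then show ?thesis using p xy by (intro image_eqI[of _ _ "p @ [y]"]) auto
  next
    case True
    have pq: "p = butlast p @ [x]" using p by (metis append_butlast_last_id)
    have y: "y \<in> set (butlast p)" using True xy by (subst (asm) pq) auto
    then have "last (butlast p) = y"
      using forest_path_chord[of E "butlast p" x y] assms pq p eE xy by metis
    moreover have "2 \<le> length p" using y by (cases p rule: remdups_adj.cases) auto
    ultimately show ?thesis using p xy by (intro image_eqI[of _ _ p]) (auto simp: paths_from_def)
  qed
qed

lemma paths_from_last_inj:
  assumes "forest E"
  shows "inj_on last (paths_from E v)"
proof (rule inj_onI)
  fix p q assume "p \<in> paths_from E v" "q \<in> paths_from E v" "last p = last q"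
  then show "p = q" using assms by (intro forest_path_unique[of E]) (auto simp: paths_from_def)
qed

lemma paths_from_last: 
  assumes "q \<in> paths_from E v"
  shows "last q \<in> tree E v - {v}"
proof -
  obtain a b r where "q = a # b # r"
    using assms by (cases q rule: remdups_adj.cases) (auto simp: paths_from_def)
  then have "last q \<in> set q" "last q \<noteq> v" using assms by (auto simp: paths_from_def)
  then show ?thesis using assms simple_path_tree[of E q] by (auto simp: paths_from_def)
qed

lemma card_paths_from_le:
  assumes "finite E" "forest E"
  shows "card (paths_from E v) \<le> card (tree E v) - 1"
proof -
  have fin: "finite (tree E v)" using assms forest_finite_edge finite_tree by blast
  have "card (paths_from E v) \<le> card (tree E v - {v})"
    using paths_from_last paths_from_last_inj[OF assms(2)] fin by (intro card_inj_on_le[of last]) blast+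
  then show ?thesis using fin by simp
qed

section \<open>Proper colorings and Kempe chains\<close>

definition used :: "coloring \<Rightarrow> nat \<Rightarrow> nat set" where
  "used col x = {k. \<exists>e. x \<in> e \<and> col e = Some k}"

lemma available_used: "available \<kappa> col x = {1..\<kappa>} - used col x"
  by (simp add: available_def used_def)

definition colorings :: "nat \<Rightarrow> nat set set \<Rightarrow> coloring set" where
  "colorings \<kappa> E = {col. dom col = E \<and> ran col \<subseteq> {1..\<kappa>} \<and>
     (\<forall>e\<in>E. \<forall>f\<in>E. e \<noteq> f \<longrightarrow> e \<inter> f \<noteq> {} \<longrightarrow> col e \<noteq> col f)}"

lemma finite_colorings: "finite E \<Longrightarrow> finite (colorings \<kappa> E)"
  by (rule finite_subset[OF _ finite_set_of_finite_maps[of E "{1..\<kappa>}"]]) (auto simp: colorings_def)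

lemma coloringsD_dom: "col \<in> colorings \<kappa> E \<Longrightarrow> dom col = E"
  by (simp add: colorings_def)

lemma coloringsD_range: "col \<in> colorings \<kappa> E \<Longrightarrow> col e = Some k \<Longrightarrow> k \<in> {1..\<kappa>}"
  by (auto simp: colorings_def ran_def)

lemma coloringsD_edge: "col \<in> colorings \<kappa> E \<Longrightarrow> col e = Some k \<Longrightarrow> e \<in> E"
  by (auto simp: colorings_def)

lemma coloringsE_color:
  assumes "col \<in> colorings \<kappa> E" "e \<in> E"
  obtains k where "col e = Some k" "k \<in> {1..\<kappa>}"
  using assms coloringsD_range[OF assms(1)] by (auto simp: colorings_def)

lemma coloringsD_proper:
  assumes "col \<in> colorings \<kappa> E" "col e = Some k" "col f = Some k" "x \<in> e" "x \<in> f"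
  shows "e = f"
proof (rule ccontr)
  assume "e \<noteq> f"
  moreover have "e \<in> E" "f \<in> E" "e \<inter> f \<noteq> {}" using assms coloringsD_edge by auto
  ultimately have "col e \<noteq> col f" using assms(1) unfolding colorings_def by blast
  then show False using assms by simp
qed

lemma coloringsI:
  assumes "dom col = E" "\<And>e k. col e = Some k \<Longrightarrow> k \<in> {1..\<kappa>}"
    and "\<And>e f x k. col e = Some k \<Longrightarrow> col f = Some k \<Longrightarrow> x \<in> e \<Longrightarrow> x \<in> f \<Longrightarrow> e = f"
  shows "col \<in> colorings \<kappa> E"
proof -
  have "col e \<noteq> col f" if ef: "e \<in> E" "f \<in> E" "e \<noteq> f" "e \<inter> f \<noteq> {}" for e f
  proof
    assume eq: "col e = col f"
    obtain k where "col e = Some k" using ef assms(1) by blast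
    then show False using assms(3)[of e k f] eq ef by auto
  qed
  then show ?thesis using assms(1,2) by (auto simp: colorings_def ran_def)
qed

lemma used_subset: "col \<in> colorings \<kappa> E \<Longrightarrow> used col x \<subseteq> {1..\<kappa>}"
  using coloringsD_range by (auto simp: used_def)

lemma card_used:
  assumes "col \<in> colorings \<kappa> E"
  shows "card (used col x) = degree E x"
proof -
  have "bij_betw (\<lambda>e. the (col e)) {e \<in> E. x \<in> e} (used col x)"
  proof (rule bij_betw_imageI)
    show "inj_on (\<lambda>e. the (col e)) {e \<in> E. x \<in> e}"
    proof (rule inj_onI)
      fix e f assume ef: "e \<in> {e \<in> E. x \<in> e}" "f \<in> {e \<in> E. x \<in> e}" "the (col e) = the (col f)"
      then obtain k l where "col e = Some k" "col f = Some l"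
        using coloringsE_color[OF assms] by (metis (no_types, lifting) mem_Collect_eq)
      then show "e = f" using ef coloringsD_proper[OF assms, of e k f x] by simp
    qed
    show "(\<lambda>e. the (col e)) ` {e \<in> E. x \<in> e} = used col x"
    proof (intro equalityI subsetI)
      fix k assume "k \<in> (\<lambda>e. the (col e)) ` {e \<in> E. x \<in> e}"
      then obtain e where e: "e \<in> E" "x \<in> e" "k = the (col e)" by auto
      then have "col e = Some k" using coloringsE_color[OF assms e(1)] by (metis option.sel)
      then show "k \<in> used col x" using e by (auto simp: used_def)
    next
      fix k assume "k \<in> used col x"
      then obtain e where "x \<in> e" "col e = Some k" by (auto simp: used_def)
      then show "k \<in> (\<lambda>e. the (col e)) ` {e \<in> E. x \<in> e}"
        using coloringsD_edge[OF assms] by (intro image_eqI[of _ _ e]) auto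
    qed
  qed
  then show ?thesis by (simp add: degree_def bij_betw_same_card)
qed

lemma card_available:
  assumes "col \<in> colorings \<kappa> E"
  shows "card (available \<kappa> col x) = \<kappa> - degree E x"
  using used_subset[OF assms, of x] finite_subset[OF used_subset[OF assms, of x]] card_used[OF assms]
  by (simp add: available_used card_Diff_subset)

definition bicolored :: "coloring \<Rightarrow> nat \<Rightarrow> nat \<Rightarrow> nat set set" where
  "bicolored col a b = {e. col e = Some a \<or> col e = Some b}"

lemma bicolored_subset: "col \<in> colorings \<kappa> E \<Longrightarrow> bicolored col a b \<subseteq> E"
  using coloringsD_edge by (auto simp: bicolored_def)

text \<open>The transposition is applied to every edge that meets the chain, not just to edges of
  the chain. Colors other than \<open>a\<close> and \<open>b\<close> are fixed by it, so the result
  is the same, and at a vertex of the chain all edges are treated alike.\<close>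

definition kempe_swap :: "coloring \<Rightarrow> nat \<Rightarrow> nat \<Rightarrow> nat \<Rightarrow> coloring" where
  "kempe_swap col a b v = (\<lambda>e. if e \<inter> tree (bicolored col a b) v \<noteq> {}
     then map_option (Transposition.transpose a b) (col e) else col e)"

lemma kempe_swap_other: "e \<notin> bicolored col a b \<Longrightarrow> kempe_swap col a b v e = col e"
  by (cases "col e") (auto simp: kempe_swap_def bicolored_def Transposition.transpose_def)

lemma kempe_swap_outside: "e \<inter> tree (bicolored col a b) v = {} \<Longrightarrow> kempe_swap col a b v e = col e"
  by (simp add: kempe_swap_def)

lemma kempe_swap_inside: "x \<in> e \<Longrightarrow> x \<in> tree (bicolored col a b) v \<Longrightarrow>
    kempe_swap col a b v e = map_option (Transposition.transpose a b) (col e)"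
  by (auto simp: kempe_swap_def)

lemma dom_kempe_swap [simp]: "dom (kempe_swap col a b v) = dom col"
  by (auto simp: kempe_swap_def dom_def)

lemma transpose_cases: "Transposition.transpose a b k \<in> {a, b} \<longleftrightarrow> k \<in> {a, b}"
  by (auto simp: Transposition.transpose_def)

lemma bicolored_kempe_swap [simp]: "bicolored (kempe_swap col a b v) a b = bicolored col a b"
proof -
  have "(kempe_swap col a b v e = Some a \<or> kempe_swap col a b v e = Some b) \<longleftrightarrow> (col e = Some a \<or> col e = Some b)" for e
    using transpose_cases[of a b] by (cases "col e") (auto simp: kempe_swap_def)
  then show ?thesis by (simp add: bicolored_def)
qed

lemma kempe_swap_kempe_swap [simp]: "kempe_swap (kempe_swap col a b v) a b v = col"
proof
  fix e
  show "kempe_swap (kempe_swap col a b v) a b v e = col e"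
    unfolding kempe_swap_def[of "kempe_swap col a b v"] bicolored_kempe_swap
    by (cases "col e") (auto simp: kempe_swap_def)
qed

lemma tree_edge_subset:
  assumes "{p, q} \<in> F" "x \<in> {p, q}" "x \<in> tree F v"
  shows "{p, q} \<subseteq> tree F v"
proof -
  have "linked F x p" "linked F x q"
    using assms linked_edge[OF assms(1)] linked_sym by auto
  then show ?thesis using assms(3) linked_trans by (auto simp: tree_def)
qed

text \<open>Two edges at \<open>x\<close> with colors in {a, b} both belong to the chain or both do
  not, according to whether \<open>x\<close> does; injectivity of the transposition then keeps their
  colors apart. Membership of a color in {a, b} is not altered by the swap, which settles the mixed
  case.\<close>

lemma kempe_swap_colorings:
  assumes E: "forest E" and col: "col \<in> colorings \<kappa> E" and ab: "a \<in> {1..\<kappa>}" "b \<in> {1..\<kappa>}"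
  shows "kempe_swap col a b v \<in> colorings \<kappa> E"
proof (rule coloringsI)
  let ?c = "kempe_swap col a b v" and ?G = "bicolored col a b"
  let ?K = "tree ?G v"
  show "dom ?c = E" using coloringsD_dom[OF col] by simp
  show "k \<in> {1..\<kappa>}" if "?c e = Some k" for e k
    using that ab coloringsD_range[OF col, of e]
    by (cases "col e") (auto simp: kempe_swap_def Transposition.transpose_def split: if_splits)
  fix e f x k assume ef: "?c e = Some k" "?c f = Some k" "x \<in> e" "x \<in> f"
  have meets: "g \<inter> ?K \<noteq> {} \<longleftrightarrow> x \<in> ?K" if "g \<in> ?G" "x \<in> g" for g
  proof -
    obtain p q where "g = {p, q}" using forest_pair[OF E] bicolored_subset[OF col] \<open>g \<in> ?G\<close> by blast
    then show ?thesis using that tree_edge_subset[of p q ?G] by blast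
  qed
  obtain i j where ij: "col e = Some i" "col f = Some j"
    using ef by (auto simp: kempe_swap_def split: if_splits)
  show "e = f"
  proof (cases "e \<in> ?G \<longleftrightarrow> f \<in> ?G")
    case True
    have "i = j"
    proof (cases "e \<in> ?G")
      case in_G: True
      then have "e \<inter> ?K \<noteq> {} \<longleftrightarrow> f \<inter> ?K \<noteq> {}" using True meets ef by blast
      then have "kempe_swap col a b v e = kempe_swap col a b v f \<Longrightarrow> i = j"
        using ij by (auto simp: kempe_swap_def dest: injD[OF inj_transpose] split: if_splits)
      then show ?thesis using ef by simp
    next
      case False
      then show ?thesis using True ef ij by (simp add: kempe_swap_other)
    qed
    then show ?thesis using ij ef coloringsD_proper[OF col] by blast
  next
    case False
    have "g \<in> ?G \<longleftrightarrow> k \<in> {a, b}" if "?c g = Some k" for g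
    proof -
      have "g \<in> ?G \<longleftrightarrow> g \<in> bicolored ?c a b" by simp
      also have "\<dots> \<longleftrightarrow> k \<in> {a, b}" using that by (auto simp: bicolored_def)
      finally show ?thesis .
    qed
    then show ?thesis using False ef by blast
  qed
qed

lemma used_kempe_swap: "used (kempe_swap col a b v) v = Transposition.transpose a b ` used col v"
proof -
  have "kempe_swap col a b v e = map_option (Transposition.transpose a b) (col e)" if "v \<in> e" for e
    using that by (rule kempe_swap_inside) simp
  then have "used (kempe_swap col a b v) v =
    {k. \<exists>e. v \<in> e \<and> map_option (Transposition.transpose a b) (col e) = Some k}"
    unfolding used_def by (metis (no_types, lifting))
  then show ?thesis by (auto simp: used_def)
qed

section \<open>Bichromatic paths and their frequency\<close>

definition bichromatic :: "coloring \<Rightarrow> nat list \<Rightarrow> bool" where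
  "bichromatic col p \<longleftrightarrow> (\<exists>a b. simple_path (bicolored col a b) p)"

lemma simple_path_cong:
  assumes "simple_path F p" "\<And>x y. x \<in> set p \<Longrightarrow> y \<in> set p \<Longrightarrow> {x, y} \<in> F \<Longrightarrow> {x, y} \<in> F'"
  shows "simple_path F' p"
  using assms by (induction p rule: induct_list012) auto

text \<open>Properness makes the two colors alternate along the path, so the color of {z, t} can be
  read off {x, y}, which remains when \<open>t\<close> is dropped.\<close>

lemma bichromatic_snocD:
  assumes col: "col \<in> colorings \<kappa> E" and bi: "bichromatic col (r @ [x, y, z, t])"
  obtains a b where "col {x, y} = Some a" "col {z, t} = Some a" "col {y, z} = Some b" "a \<noteq> b"
    "simple_path (bicolored col a b) (r @ [x, y, z])" "a \<in> {1..\<kappa>}"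
proof -
  obtain c d where p: "simple_path (bicolored col c d) (r @ [x, y, z, t])"
    using bi by (auto simp: bichromatic_def)
  have xyz: "simple_path (bicolored col c d) [x, y, z, t]"
    using p by (rule simple_path_appendD2)
  have p3: "simple_path (bicolored col c d) (r @ [x, y, z])"
    using simple_path_appendD1[of _ "r @ [x, y, z]" "[t]"] p by simp
  have neq: "{x, y} \<noteq> {y, z}" "{y, z} \<noteq> {z, t}" using xyz by (auto simp: doubleton_eq_iff)
  obtain a b a' where ab: "col {x, y} = Some a" "col {y, z} = Some b" "col {z, t} = Some a'"
    and sub: "{a, b, a'} \<subseteq> {c, d}"
    using xyz by (auto simp: bicolored_def)
  have "a \<noteq> b" using neq ab coloringsD_proper[OF col, of "{x, y}" a "{y, z}" y] by auto
  moreover have "a' \<noteq> b" using neq ab coloringsD_proper[OF col, of "{y, z}" b "{z, t}" z] by auto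
  ultimately have "a' = a" "bicolored col c d = bicolored col a b" using sub by (auto simp: bicolored_def)
  then show ?thesis using that[of a b] ab \<open>a \<noteq> b\<close> p3 coloringsD_range[OF col ab(1)] by simp
qed

text \<open>Given the path up to \<open>z\<close>, the \<open>\<kappa> - 1\<close> possible colors of \<open>{z, t}\<close> are equally frequent, since
  they can be exchanged on the Kempe chain of \<open>z\<close> without affecting the path.\<close>

lemma bichromatic_extend:
  assumes E: "finite E" "forest E" and p: "simple_path E (r @ [x, y, z, t])"
  shows "card {col \<in> colorings \<kappa> E. bichromatic col (r @ [x, y, z, t])} * (\<kappa> - 1) \<le>
    card {col \<in> colorings \<kappa> E. bichromatic col (r @ [x, y, z])}"
proof -
  let ?S4 = "{col \<in> colorings \<kappa> E. bichromatic col (r @ [x, y, z, t])}"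
  let ?S3 = "{col \<in> colorings \<kappa> E. bichromatic col (r @ [x, y, z])}"
  \<comment> \<open>\<open>g\<close> gives {z, t} the color \<open>d\<close>, which may be any color
    but that of {y, z}. \<open>h\<close> undoes this: the old color of {z, t} is read off {x, y},
    which the swap leaves alone, \<open>d\<close> is read off {z, t}, and the swap is an
    involution.\<close>
  define g where "g = (\<lambda>(col::coloring, d). kempe_swap col (the (col {x, y})) d z)"
  define h where "h = (\<lambda>col::coloring. (kempe_swap col (the (col {x, y})) (the (col {z, t})) z, the (col {z, t})))"
  let ?T = "SIGMA col:?S4. {1..\<kappa>} - {the (col {y, z})}"
  have edges: "{x, y} \<in> E" "{y, z} \<in> E" "{z, t} \<in> E"
    using p simple_path_appendD2[of E r "[x, y, z, t]"] by auto
  have "simple_path E ((r @ [x, y]) @ [z])"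
    using p simple_path_appendD1[of E "r @ [x, y, z]" "[t]"] by simp
  then have rxy: "simple_path E (r @ [x, y])" "z \<notin> set (r @ [x, y])"
    by (subst (asm) simple_path_snoc; simp)+
  have key: "g (col, d) \<in> ?S3 \<and> h (g (col, d)) = (col, d)"
    if col: "col \<in> colorings \<kappa> E" and bi: "bichromatic col (r @ [x, y, z, t])"
      and d: "d \<in> {1..\<kappa>}" "d \<noteq> the (col {y, z})" for col d
  proof -
    obtain a b where ab: "col {x, y} = Some a" "col {z, t} = Some a" "col {y, z} = Some b" "a \<noteq> b"
      and path: "simple_path (bicolored col a b) (r @ [x, y, z])" and a: "a \<in> {1..\<kappa>}"
      using bichromatic_snocD[OF col bi] .
    let ?c = "kempe_swap col a d z" and ?F = "E - {{y, z}}"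
    let ?K = "tree (bicolored col a d) z"
    have yz: "{y, z} \<notin> bicolored col a d" using ab d by (auto simp: bicolored_def)
    \<comment> \<open>The edge {y, z} has color \<open>b\<close>, hence is not on the chain of the
      colors \<open>a\<close> and \<open>d\<close>. As it is a bridge, the chain of \<open>z\<close>
      cannot reach the earlier part of the path.\<close>
    have avoid: "s \<notin> ?K" if s: "s \<in> set (r @ [x, y])" for s
    proof
      assume "s \<in> ?K"
      then have "linked (bicolored col a d) z s" by (simp add: tree_def)
      then have zs: "linked ?F z s"
        by (rule linked_mono) (use yz bicolored_subset[OF col] in auto)
      have path': "simple_path ?F (r @ [x, y])" using rxy by (intro simple_path_avoid[of _ _ z]) auto
      have "linked ?F (hd (r @ [x, y])) s" "linked ?F (hd (r @ [x, y])) y"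
        using simple_path_linked[OF path', of s] simple_path_linked[OF path', of y] s by auto
      then have "linked ?F y s" using linked_trans[OF linked_sym] by blast
      then have "linked ?F y z" using linked_sym[OF zs] by (rule linked_trans)
      then show False using forest_bridge[OF E(2) edges(2)] by simp
    qed
    have same: "?c {i, j} = col {i, j}" if "i \<in> set (r @ [x, y])" "j \<in> set (r @ [x, y])" for i j
      using avoid that by (intro kempe_swap_outside) auto
    have c_xy: "?c {x, y} = Some a" using same[of x y] ab by simp
    have c_yz: "?c {y, z} = Some b" using yz ab by (simp add: kempe_swap_other)
    have c_zt: "?c {z, t} = Some d"
      using kempe_swap_inside[of z "{z, t}" col a d z] ab by simp
    have g: "g (col, d) = ?c" using ab by (simp add: g_def)
    have "simple_path (bicolored ?c a b) (r @ [x, y])"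
    proof (rule simple_path_cong)
      show "simple_path (bicolored col a b) (r @ [x, y])"
        using path simple_path_appendD1[of _ "r @ [x, y]" "[z]"] by simp
      show "{i, j} \<in> bicolored ?c a b" if "i \<in> set (r @ [x, y])" "j \<in> set (r @ [x, y])"
        "{i, j} \<in> bicolored col a b" for i j
        using that same[of i j] by (simp add: bicolored_def)
    qed
    then have "simple_path (bicolored ?c a b) ((r @ [x, y]) @ [z])"
      using rxy c_yz by (subst simple_path_snoc) (auto simp: bicolored_def)
    then have "bichromatic ?c (r @ [x, y, z])" by (auto simp: bichromatic_def)
    moreover have "?c \<in> colorings \<kappa> E" using E(2) col a d(1) by (rule kempe_swap_colorings)
    moreover have "h ?c = (col, d)" using c_xy c_zt by (simp add: h_def)
    ultimately show ?thesis using g by simp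
  qed
  have fin: "finite (colorings \<kappa> E)" using E(1) by (rule finite_colorings)
  have "card ({1..\<kappa>} - {the (col {y, z})}) = \<kappa> - 1" if "col \<in> colorings \<kappa> E" for col
    using coloringsE_color[OF that edges(2)] by (metis card_Diff_singleton card_atLeastAtMost diff_Suc_1 option.sel)
  then have "card ?T = card ?S4 * (\<kappa> - 1)"
    using fin by (subst card_SigmaI) auto
  moreover have "card ?T \<le> card ?S3"
  proof (rule card_inj_on_le)
    have gT: "g p \<in> ?S3 \<and> h (g p) = p" if "p \<in> ?T" for p
      using key[of "fst p" "snd p"] that by (cases p) auto
    then show "inj_on g ?T" by (intro inj_on_inverseI[where g = h]) blast
    show "g ` ?T \<subseteq> ?S3" using gT by blast
    show "finite ?S3" using fin by simp
  qed
  ultimately show ?thesis by simp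
qed

text \<open>The induction starts at three vertices, where the trivial bound is used; each further
  vertex, removed at the far end, contributes one factor \<open>\<kappa> - 1\<close>.\<close>

lemma bichromatic_card:
  assumes E: "finite E" "forest E" and "simple_path E p" "length p = n + 3"
  shows "card {col \<in> colorings \<kappa> E. bichromatic col p} * (\<kappa> - 1) ^ n \<le> card (colorings \<kappa> E)"
  using assms(3,4)
proof (induction n arbitrary: p)
  case 0
  show ?case using finite_colorings[OF E(1)] by (auto intro!: card_mono)
next
  case (Suc n)
  have "length (rev p) = Suc (Suc (Suc (Suc n)))" using Suc.prems(2) by simp
  then obtain t z y x r where "rev p = t # z # y # x # r" unfolding length_Suc_conv by blast
  then have "rev (rev p) = rev (t # z # y # x # r)" by (rule arg_cong)
  then have p: "p = rev r @ [x, y, z, t]" by simp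
  let ?N = "\<lambda>q. card {col \<in> colorings \<kappa> E. bichromatic col q}"
  have "?N p * (\<kappa> - 1) ^ Suc n = ?N p * (\<kappa> - 1) * (\<kappa> - 1) ^ n" by simp
  also have "\<dots> \<le> ?N (rev r @ [x, y, z]) * (\<kappa> - 1) ^ n"
    using bichromatic_extend[OF E, of "rev r" x y z t \<kappa>] Suc.prems p by (intro mult_right_mono) auto
  also have "\<dots> \<le> card (colorings \<kappa> E)"
    using Suc.prems p simple_path_appendD1[of E "rev r @ [x, y, z]" "[t]"] by (intro Suc.IH) auto
  finally show ?case .
qed

section \<open>The algorithm performs Kempe swaps\<close>

text \<open>Among three bicolored edges at \<open>t\<close> two share a color, and a proper coloring
  identifies them. Hence chains do not branch.\<close>

lemma colorings_pigeonhole: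
  assumes "col \<in> colorings \<kappa> E" "{t, x} \<in> bicolored col a b" "{t, y} \<in> bicolored col a b"
    "{t, z} \<in> bicolored col a b"
  shows "x = y \<or> x = z \<or> y = z"
proof -
  have eq: "i = j" if "col {t, i} = Some k" "col {t, j} = Some k" for i j k
    using coloringsD_proper[OF assms(1) that, of t] by (auto simp: doubleton_eq_iff)
  show ?thesis using assms(2-) eq by (auto simp: bicolored_def)
qed

text \<open>\<open>E\<close> is the forest before the insertion, but \<open>R\<close> is the set of
  roots after it, with \<open>v\<close> already demoted: the tree of \<open>v\<close> has no root of
  its own, and the joined tree is rooted on the side of \<open>u\<close>.\<close>

locale attachment =
  fixes E :: "nat set set" and R :: "nat set" and u v :: nat
  assumes finite_edges: "finite E" and forest: "forest E" and not_linked: "\<not> linked E u v"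
    and no_roots: "R \<inter> tree E v = {}" and ex_root: "\<exists>r\<in>R. linked E u r"
begin

abbreviation E' :: "nat set set" where "E' \<equiv> insert {u, v} E"

lemma forest': "forest E'"
  using forest not_linked by (rule forest_insert)

lemma new_edge: "{u, v} \<notin> E"
  using not_linked linked_edge by blast

lemma path_through_new_edge:
  assumes p: "simple_path E p" "p \<noteq> []" "last p = u" and q: "simple_path E q" "q \<noteq> []" "hd q = v"
  shows "simple_path E' (p @ q)"
proof -
  have "linked E x u" if "x \<in> set p" for x
  proof -
    have "linked E (hd p) x" "linked E (hd p) u"
      using simple_path_linked[OF p(1)] that p by (auto dest: last_in_set)
    then show ?thesis using linked_trans[OF linked_sym] by blast
  qed
  moreover have "linked E v x" if "x \<in> set q" for x
    using simple_path_linked[OF q(1) that] q by simp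
  ultimately have "set p \<inter> set q = {}"
    using not_linked linked_trans[OF linked_sym, of E _ u v] linked_sym by blast
  moreover have "simple_path E' p" "simple_path E' q"
    using p q by (auto intro: simple_path_mono)
  ultimately show ?thesis using p q by (simp add: simple_path_append)
qed

text \<open>The roots of the joined tree lie on the side of \<open>u\<close>, so by uniqueness every
  path from a root to \<open>last q\<close> enters through {u, v} and ends with \<open>q\<close>.
  Inside the old tree of \<open>v\<close>, being a child thus means being farther from
  \<open>v\<close>, whichever root is designated.\<close>

lemma child_iff:
  assumes q: "simple_path E q" "q \<noteq> []" "hd q = v"
  shows "child E' R (last q) y \<longleftrightarrow> {last q, y} \<in> E \<and> y \<notin> set q"
proof
  let ?x = "last q"
  have q_tree: "set q \<subseteq> tree E v" using simple_path_tree[OF q(1)] q by simp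
  then have x_tree: "linked E v ?x" using last_in_set[OF q(2)] by (auto simp: tree_def)
  {
    assume "child E' R ?x y"
    then obtain p where p: "simple_path E' (p @ [?x, y])" "hd (p @ [?x, y]) \<in> R"
      by (auto simp: child_def)
    let ?h = "hd (p @ [?x])"
    have h: "?h \<in> R" using p(2) by (cases p) auto
    then have hv: "\<not> linked E v ?h" using no_roots by (auto simp: tree_def)
    have p': "simple_path E' (p @ [?x])" using simple_path_appendD1[of E' "p @ [?x]" "[y]"] p by simp
    have "linked E' ?h ?x" using simple_path_linked[OF p', of ?x] by simp
    moreover have "\<not> linked E ?h ?x" using hv linked_trans[OF x_tree] linked_sym by blast
    ultimately have "linked E ?h u" using linked_insertD[of u v E ?h ?x] hv linked_sym by blast
    then obtain p1 where p1: "simple_path E p1" "p1 \<noteq> []" "hd p1 = ?h" "last p1 = u"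
      by (rule linked_simple_path)
    have "simple_path E' (p1 @ q)" using p1 q by (intro path_through_new_edge) auto
    then have eq: "p @ [?x] = p1 @ q"
      using p' p1 q by (intro forest_path_unique[OF forest']) auto
    have "simple_path E' ((p @ [?x]) @ [y])" using p by simp
    then have y: "y \<notin> set (p @ [?x])" "{?x, y} \<in> E'"
      by (subst (asm) simple_path_snoc; simp)+
    have "{?x, y} \<noteq> {u, v}"
    proof
      assume "{?x, y} = {u, v}"
      moreover have "?x \<noteq> u" using x_tree not_linked linked_sym by blast
      ultimately have "y = u" by (auto simp: doubleton_eq_iff)
      moreover have "u \<in> set p1" using p1 last_in_set by blast
      ultimately show False using y eq by simp
    qed
    moreover have "y \<notin> set q" using y eq by simp
    ultimately show "{?x, y} \<in> E \<and> y \<notin> set q" using y by simp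
  }
  {
    assume y: "{?x, y} \<in> E \<and> y \<notin> set q"
    obtain r where r: "r \<in> R" "linked E u r" using ex_root by blast
    obtain p where p: "simple_path E p" "p \<noteq> []" "hd p = r" "last p = u"
      using linked_simple_path[OF linked_sym[OF r(2)]] .
    have "simple_path E (q @ [y])" using y q by (simp add: simple_path_snoc)
    then have "simple_path E' (p @ (q @ [y]))" using p q by (intro path_through_new_edge) auto
    moreover have "p @ (q @ [y]) = (p @ butlast q) @ [?x, y]" using q by simp
    ultimately have "simple_path E' ((p @ butlast q) @ [?x, y])" by simp
    moreover have "hd ((p @ butlast q) @ [?x, y]) \<in> R" using p r by simp
    ultimately show "child E' R ?x y" unfolding child_def by blast
  }
qed

text \<open>No chain edge leaves \<open>q\<close>. At \<open>v\<close> the color \<alpha> is free,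
  so there is only one chain edge; an inner vertex has both of its chain edges on \<open>q\<close>;
  at the end, color \<open>a\<close> belongs to the last edge of \<open>q\<close> and color
  \<open>b\<close> is covered by \<open>maximal\<close>.\<close>

lemma kempe_chain_closed:
  assumes col: "col \<in> colorings \<kappa> E" and \<alpha>: "\<alpha> \<notin> used col v"
    and q: "simple_path (bicolored col \<alpha> \<beta>) q" "hd q = v" "2 \<le> length q"
    and ab: "{a, b} = {\<alpha>, \<beta>}" "col {last (butlast q), last q} = Some a"
    and maximal: "\<And>y. col {last q, y} = Some b \<Longrightarrow> y \<in> set q"
  shows "tree (bicolored col \<alpha> \<beta>) v = set q"
proof (intro equalityI subsetI)
  let ?G = "bicolored col \<alpha> \<beta>"
  have closed: "y \<in> set q" if t: "t \<in> set q" and ty: "{t, y} \<in> ?G" for t y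
  proof -
    obtain q1 q2 where split: "q = q1 @ t # q2" using t by (meson split_list)
    show ?thesis
    proof (cases q2)
      case Nil
      then have last: "last q = t" using split by simp
      have "col {t, y} = Some a \<or> col {t, y} = Some b" using ty ab(1) by (auto simp: bicolored_def doubleton_eq_iff)
      then show ?thesis
      proof
        assume "col {t, y} = Some a"
        then have "{t, y} = {last (butlast q), t}"
          using coloringsD_proper[OF col _ ab(2), of "{t, y}" t] last by auto
        then have "y = last (butlast q)" by (auto simp: doubleton_eq_iff)
        moreover have "butlast q \<noteq> []" using q(3) by (cases q rule: remdups_adj.cases) auto
        ultimately show ?thesis using in_set_butlastD last_in_set by metis
      qed (use maximal last in blast)
    next
      case (Cons s q3)
      have "simple_path ?G (t # s # q3)"
        using q(1) unfolding split Cons by (rule simple_path_appendD2)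
      then have ts: "{t, s} \<in> ?G" by simp
      show ?thesis
      proof (cases q1 rule: rev_cases)
        case Nil
        then have "t = v" using split q(2) by simp
        then have "col {t, s} = Some \<beta>" "col {t, y} = Some \<beta>"
          using ts ty \<alpha> by (auto simp: bicolored_def used_def)
        then have "{t, s} = {t, y}" using coloringsD_proper[OF col, of _ \<beta> _ t] by auto
        then show ?thesis using split Cons by (auto simp: doubleton_eq_iff)
      next
        case (snoc q0 s')
        have "simple_path ?G (s' # t # s # q3)"
          using q(1) simple_path_appendD2[of ?G q0 "s' # t # s # q3"] unfolding split Cons snoc by simp
        then have "{t, s'} \<in> ?G" "s' \<noteq> s" by (auto simp: insert_commute)
        then have "y = s \<or> y = s'" using colorings_pigeonhole[OF col ts _ ty] by blast
        then show ?thesis using split Cons snoc by auto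
      qed
    qed
  qed
  {
    fix y assume "y \<in> tree ?G v"
    then have "linked ?G v y" by (simp add: tree_def)
    then show "y \<in> set q"
    proof (induction rule: linked_induct)
      case refl
      show ?case using q by (cases q) auto
    qed (rule closed)
  }
  {
    fix y assume "y \<in> set q"
    then show "y \<in> tree ?G v" using simple_path_tree[OF q(1)] q(2) by auto
  }
qed

text \<open>Here \<open>q\<close> is the path walked so far, whose edges have already been recolored; its last edge had
  color \<open>a\<close> and now has color \<open>b\<close>.\<close>

lemma fix_forbidden_kempe:
  assumes col: "col \<in> colorings \<kappa> E" and \<alpha>: "\<alpha> \<notin> used col v"
    and q: "simple_path (bicolored col \<alpha> \<beta>) q" "hd q = v" "2 \<le> length q"
    and ab: "{a, b} = {\<alpha>, \<beta>}" "col {last (butlast q), last q} = Some a"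
    and c: "dom c = E'" "c {u, v} = Some \<beta>"
      "\<And>e. e \<in> E \<Longrightarrow> c e = (if e \<subseteq> set q then kempe_swap col \<alpha> \<beta> v e else col e)"
  shows "fix_forbidden R c (last q) a b = (kempe_swap col \<alpha> \<beta> v)({u, v} \<mapsto> \<beta>)"
  using q ab c
\<comment> \<open>\<open>fix_forbidden\<close> is tail recursive and comes without a termination
  proof. The measure supplies it: the walk is a simple path in the tree of \<open>v\<close>, and
  each call makes it longer.\<close>
proof (induction "card (tree E v) - length q" arbitrary: q a b c rule: less_induct)
  case less
  note q = less.prems(1-3) and ab = less.prems(4,5) and c = less.prems(6-8)
  let ?G = "bicolored col \<alpha> \<beta>" and ?sw = "kempe_swap col \<alpha> \<beta> v" and ?x = "last q"
  have G: "?G \<subseteq> E" using bicolored_subset[OF col] .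
  have qE: "simple_path E q" using simple_path_mono[OF q(1) G] .
  have q_ne: "q \<noteq> []" using q(3) by auto
  have colored: "colored_child R c ?x b y \<longleftrightarrow> y \<notin> set q \<and> col {?x, y} = Some b" for y
    unfolding colored_child_def c(1) child_iff[OF qE q_ne q(2)]
    using c(3)[of "{?x, y}"] coloringsD_edge[OF col, of "{?x, y}"] by auto
  have uniq: "y = z" if "col {?x, y} = Some b" "col {?x, z} = Some b" for y z
    using coloringsD_proper[OF col that, of ?x] by (auto simp: doubleton_eq_iff)
  show ?case
  proof (cases "\<exists>y. colored_child R c ?x b y")
    case True
    then obtain y where y: "colored_child R c ?x b y" by blast
    then have y': "y \<notin> set q" "col {?x, y} = Some b" using colored by auto
    have the: "(THE w. colored_child R c ?x b w) = y"
      using y by (rule the_equality) (use uniq y' colored in blast)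
    let ?c = "c({?x, y} \<mapsto> a)" and ?q = "q @ [y]"
    have unfold: "fix_forbidden R c ?x a b = fix_forbidden R ?c y b a"
      by (subst fix_forbidden.simps) (use True the in \<open>simp add: Let_def\<close>)
    have xyG: "{?x, y} \<in> ?G" using y' ab(1) by (auto simp: bicolored_def doubleton_eq_iff)
    have qG': "simple_path ?G ?q" using q(1) q_ne y' xyG by (simp add: simple_path_snoc)
    have qE': "simple_path E ?q" using simple_path_mono[OF qG' G] .
    have xyE: "{?x, y} \<in> E" using G xyG by blast
    have "set ?q \<subseteq> tree E v" using simple_path_tree[OF qE'] q q_ne by simp
    moreover have "finite (tree E v)"
      using finite_tree finite_edges forest_finite_edge[OF forest] by blast
    ultimately have "card (set ?q) \<le> card (tree E v)" by (intro card_mono)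
    moreover have "card (set ?q) = length ?q"
      using qE' by (intro distinct_card) (simp add: simple_path_def)
    ultimately have decr: "card (tree E v) - length ?q < card (tree E v) - length q" by simp
    have c': "?c e = (if e \<subseteq> set ?q then ?sw e else col e)" if e: "e \<in> E" for e
    proof (cases "e = {?x, y}")
      case True
      have "?x \<in> tree ?G v" using simple_path_tree[OF q(1)] q q_ne last_in_set by blast
      then have "?sw e = map_option (Transposition.transpose \<alpha> \<beta>) (col e)"
        using True by (intro kempe_swap_inside[of ?x]) auto
      also have "\<dots> = Some a" using True y' ab(1) by (auto simp: doubleton_eq_iff)
      finally show ?thesis using True q_ne by simp
    next
      case False
      \<comment> \<open>The step to \<open>y\<close> brings only the edge {?x, y} into the vertex
        set of the walk; any other would be a chord.\<close>
      have "e \<subseteq> set q" if sub: "e \<subseteq> set ?q"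
      proof (rule ccontr)
        assume "\<not> e \<subseteq> set q"
        then have "y \<in> e" using sub by auto
        then obtain s where s: "e = {y, s}" "s \<noteq> y" using forest_edgeE[OF forest e] by auto
        then have "s \<in> set q" using sub by auto
        then have "?x = s" using forest_path_chord[OF forest qE'] e s by blast
        then show False using False s by auto
      qed
      then have "e \<subseteq> set ?q \<longleftrightarrow> e \<subseteq> set q" by auto
      then show ?thesis using False c(3)[OF e] by simp
    qed
    have "fix_forbidden R ?c (last ?q) b a = ?sw({u, v} \<mapsto> \<beta>)"
    proof (rule less.hyps[OF decr])
      show "hd ?q = v" "2 \<le> length ?q" "{b, a} = {\<alpha>, \<beta>}" "col {last (butlast ?q), last ?q} = Some b"
        using q q_ne ab y' by auto
      show "dom ?c = E'" using c(1) xyE by auto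
      show "?c {u, v} = Some \<beta>" using c(2) xyE new_edge by auto
    qed (use qG' c' in auto)
    then show ?thesis using unfold by simp
  next
    case False
    have unfold: "fix_forbidden R c ?x a b = c"
      by (subst fix_forbidden.simps) (use False in auto)
    \<comment> \<open>The walk stops when no edge of color \<open>b\<close> leads away. Then
      \<open>q\<close> is the entire chain, and no edge outside it is affected by the swap.\<close>
    have K: "tree ?G v = set q"
      using col \<alpha> q ab by (rule kempe_chain_closed) (use False colored in blast)
    have "c e = (?sw({u, v} \<mapsto> \<beta>)) e" for e
    proof (cases "e \<in> E")
      case True
      have "?sw e = col e" if not: "\<not> e \<subseteq> set q"
      proof (cases "e \<in> ?G")
        case in_G: True
        obtain x y where xy: "e = {x, y}" using forest_pair[OF forest True] by blast
        have "e \<inter> tree ?G v = {}"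
        proof (rule ccontr)
          assume "e \<inter> tree ?G v \<noteq> {}"
          then obtain z where "z \<in> {x, y}" "z \<in> tree ?G v" using xy by blast
          then have "{x, y} \<subseteq> tree ?G v" using in_G xy by (intro tree_edge_subset) auto
          then show False using not xy K by simp
        qed
        then show ?thesis by (rule kempe_swap_outside)
      qed (rule kempe_swap_other)
      moreover have "e \<noteq> {u, v}" using True new_edge by blast
      ultimately show ?thesis using c(3)[OF True] by simp
    next
      case not_E: False
      show ?thesis
      proof (cases "e = {u, v}")
        case False
        have "c e = None" using False not_E c(1) by auto
        moreover have "?sw e = None" using not_E coloringsD_dom[OF col] by (auto simp: kempe_swap_def)
        ultimately show ?thesis using False by simp
      qed (use c(2) in simp)
    qed
    then show ?thesis using unfold by auto
  qed
qed

text \<open>The swap acts on the coloring before the insertion, where \<alpha> is free at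
  \<open>v\<close>, and the new edge is added afterwards. This is possible because the new edge is
  no child edge of \<open>v\<close>, so that the walk never recolors it.\<close>

definition recolor :: "nat \<Rightarrow> coloring \<Rightarrow> nat \<Rightarrow> coloring pmf" where
  "recolor \<kappa> col \<beta> = (if \<beta> \<in> used col v
     then map_pmf (\<lambda>\<alpha>. (kempe_swap col \<alpha> \<beta> v)({u, v} \<mapsto> \<beta>)) (pmf_of_set (available \<kappa> col v))
     else return_pmf (col({u, v} \<mapsto> \<beta>)))"

lemma root_to_child_kempe:
  assumes col: "col \<in> colorings \<kappa> E" and deg: "degree E v < \<kappa>"
  shows "root_to_child \<kappa> R (col({u, v} \<mapsto> \<beta>)) v \<beta> = recolor \<kappa> col \<beta>"
proof -
  let ?c = "col({u, v} \<mapsto> \<beta>)"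
  have dom: "dom ?c = E'" using coloringsD_dom[OF col] by simp
  have colored: "colored_child R ?c v \<beta> w \<longleftrightarrow> col {v, w} = Some \<beta>" for w
  proof -
    have "child E' R v w \<longleftrightarrow> {v, w} \<in> E" 
      using child_iff[of "[v]" w] forest_edge_neq[OF forest, of v w] by auto
    moreover have "{v, w} \<noteq> {u, v}" if "{v, w} \<in> E" using that new_edge by auto
    ultimately show ?thesis
      unfolding colored_child_def dom using coloringsD_edge[OF col, of "{v, w}"] by auto
  qed
  show ?thesis
  proof (cases "\<beta> \<in> used col v")
    case False
    then have "\<nexists>w. colored_child R ?c v \<beta> w" using colored by (auto simp: used_def)
    then show ?thesis using False by (simp add: root_to_child_def recolor_def)
  next
    case True
    then obtain e where e: "v \<in> e" "col e = Some \<beta>" by (auto simp: used_def)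
    then obtain w where "e = {v, w}" using forest_pair[OF forest coloringsD_edge[OF col e(2)]] by blast
    then have w: "col {v, w} = Some \<beta>" using e by simp
    then have vwE: "{v, w} \<in> E" using coloringsD_edge[OF col] by blast
    then have vw: "v \<noteq> w" using forest_edge_neq[OF forest] by blast
    have the: "(THE w. colored_child R ?c v \<beta> w) = w"
      unfolding colored
    proof (rule the_equality)
      show "x = w" if "col {v, x} = Some \<beta>" for x
        using coloringsD_proper[OF col that w, of v] by (auto simp: doubleton_eq_iff)
    qed (rule w)
    \<comment> \<open>Because of the clash the new edge repeats a color already present at
      \<open>v\<close>, so \<alpha> is drawn from the colors that were free there before the
      insertion.\<close>
    have "used ?c v = insert \<beta> (used col v)"
    proof -
      have "used ?c v \<subseteq> insert \<beta> (used col v)" by (auto simp: used_def split: if_splits)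
      moreover have "\<beta> \<in> used ?c v" by (auto simp: used_def)
      moreover have "k \<in> used ?c v" if "k \<in> used col v" for k
      proof -
        obtain e where "v \<in> e" "col e = Some k" using \<open>k \<in> used col v\<close> by (auto simp: used_def)
        moreover have "e \<noteq> {u, v}" using calculation coloringsD_edge[OF col] new_edge by blast
        ultimately have "v \<in> e" "?c e = Some k" by auto
        then show ?thesis unfolding used_def by blast
      qed
      ultimately show ?thesis by (intro equalityI subsetI) auto
    qed
    then have avail: "available \<kappa> ?c v = available \<kappa> col v" using True by (auto simp: available_used)
    have "card (available \<kappa> col v) > 0" using deg by (simp add: card_available[OF col])
    then have fin: "finite (available \<kappa> col v)" "available \<kappa> col v \<noteq> {}" by (auto simp: card_gt_0_iff)
    have step: "fix_forbidden R (?c({v, w} \<mapsto> \<alpha>)) w \<beta> \<alpha> = (kempe_swap col \<alpha> \<beta> v)({u, v} \<mapsto> \<beta>)"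
      if "\<alpha> \<in> available \<kappa> col v" for \<alpha>
    proof -
      have \<alpha>: "\<alpha> \<notin> used col v" using that by (simp add: available_used)
      have sw: "kempe_swap col \<alpha> \<beta> v {v, w} = Some \<alpha>"
        using kempe_swap_inside[of v "{v, w}" col \<alpha> \<beta> v] w by simp
      have inside: "e = {v, w}" if "e \<in> E" "e \<subseteq> {v, w}" for e
      proof -
        obtain x y where "e = {x, y}" "x \<noteq> y" using forest_edgeE[OF forest \<open>e \<in> E\<close>] .
        then show ?thesis using that by auto
      qed
      have "fix_forbidden R (?c({v, w} \<mapsto> \<alpha>)) (last [v, w]) \<beta> \<alpha> = (kempe_swap col \<alpha> \<beta> v)({u, v} \<mapsto> \<beta>)"
      proof (rule fix_forbidden_kempe[OF col \<alpha>])
        show "simple_path (bicolored col \<alpha> \<beta>) [v, w]" using w vw by (simp add: bicolored_def)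
        show "dom (?c({v, w} \<mapsto> \<alpha>)) = E'" using dom vwE by auto
        show "(?c({v, w} \<mapsto> \<alpha>)) {u, v} = Some \<beta>" using vwE new_edge by auto
        show "(?c({v, w} \<mapsto> \<alpha>)) e = (if e \<subseteq> set [v, w] then kempe_swap col \<alpha> \<beta> v e else col e)"
          if "e \<in> E" for e
          using sw that inside[OF that] new_edge by auto
      qed (use w in auto)
      then show ?thesis by simp
    qed
    have "root_to_child \<kappa> R ?c v \<beta> = pmf_of_set (available \<kappa> col v) \<bind>
        (\<lambda>\<alpha>. return_pmf (fix_forbidden R (?c({v, w} \<mapsto> \<alpha>)) w \<beta> \<alpha>))"
      using w by (auto simp: root_to_child_def colored the[unfolded colored] avail)
    also have "\<dots> = pmf_of_set (available \<kappa> col v) \<bind>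
        (\<lambda>\<alpha>. return_pmf ((kempe_swap col \<alpha> \<beta> v)({u, v} \<mapsto> \<beta>)))"
      using fin step by (intro bind_pmf_cong refl) (simp add: set_pmf_of_set)
    finally show ?thesis using True by (simp add: recolor_def map_pmf_def)
  qed
qed

definition attach :: "nat \<Rightarrow> coloring \<Rightarrow> coloring pmf" where
  "attach \<kappa> col = pmf_of_set (available \<kappa> col u) \<bind> recolor \<kappa> col"

end

lemma insert_edge_attach:
  assumes "attachment E R u v" and R: "R = reroot E v R\<^sub>0 - {v}"
    and uv: "name_endpoints \<Delta> E b xy = (u, v)"
    and col: "col \<in> colorings \<kappa> E" and deg: "degree E v < \<kappa>"
  shows "insert_edge \<Delta> \<kappa> b (R\<^sub>0, col) xy = map_pmf (Pair R) (attachment.attach u v \<kappa> col)"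
proof -
  interpret attachment E R u v by fact
  show ?thesis
    unfolding insert_edge_def attach_def
    by (simp add: coloringsD_dom[OF col] uv root_to_child_kempe[OF col deg] map_bind_pmf flip: R map_pmf_def)
qed

section \<open>Uniformity of the coloring and expected recourse of an insertion\<close>

locale random_attachment = attachment +
  fixes \<kappa> :: nat
  assumes degree_u: "degree E u < \<kappa>" and degree_v: "degree E v < \<kappa>"
begin

abbreviation cut :: "coloring \<Rightarrow> coloring" where
  "cut col \<equiv> col({u, v} := None)"

abbreviation new_color :: "coloring \<Rightarrow> nat" where
  "new_color col \<equiv> the (col {u, v})"

lemma extend_coloring:
  assumes col: "col \<in> colorings \<kappa> E" and \<beta>: "\<beta> \<in> {1..\<kappa>}" "\<beta> \<notin> used col u" "\<beta> \<notin> used col v"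
  shows "col({u, v} \<mapsto> \<beta>) \<in> colorings \<kappa> E'"
proof (rule coloringsI)
  let ?c = "col({u, v} \<mapsto> \<beta>)"
  show "dom ?c = E'" using coloringsD_dom[OF col] by simp
  show "k \<in> {1..\<kappa>}" if "?c e = Some k" for e k
    using that \<beta>(1) coloringsD_range[OF col, of e k] by (cases "e = {u, v}") auto
  have clash: "col e \<noteq> Some \<beta>" if "x \<in> e" "x \<in> {u, v}" for e x
    using that \<beta> by (auto simp: used_def)
  fix e f x k assume "?c e = Some k" "?c f = Some k" "x \<in> e" "x \<in> f"
  then show "e = f"
    using clash[of x] coloringsD_proper[OF col, of e k f x] by (auto split: if_splits)
qed

lemma cut_coloring:
  assumes "col \<in> colorings \<kappa> E'"
  shows "cut col \<in> colorings \<kappa> E"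
proof (rule coloringsI)
  show "dom (cut col) = E" using coloringsD_dom[OF assms] new_edge by auto
  show "k \<in> {1..\<kappa>}" if "cut col e = Some k" for e k
    using that coloringsD_range[OF assms, of e k] by (auto split: if_splits)
  show "e = f" if "cut col e = Some k" "cut col f = Some k" "x \<in> e" "x \<in> f" for e f x k
    using that coloringsD_proper[OF assms, of e k f x] by (auto split: if_splits)
qed

lemma new_color:
  assumes "col \<in> colorings \<kappa> E'"
  shows "col {u, v} = Some (new_color col)" "new_color col \<in> {1..\<kappa>}"
    "new_color col \<notin> used (cut col) u" "new_color col \<notin> used (cut col) v"
proof -
  obtain k where k: "col {u, v} = Some k" "k \<in> {1..\<kappa>}" using coloringsE_color[OF assms, of "{u, v}"] by auto
  then show "col {u, v} = Some (new_color col)" "new_color col \<in> {1..\<kappa>}" by auto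
  have "k \<notin> used (cut col) x" if "x \<in> {u, v}" for x
    using coloringsD_proper[OF assms _ k(1) _ that] by (auto simp: used_def split: if_splits)
  then show "new_color col \<notin> used (cut col) u" "new_color col \<notin> used (cut col) v" using k by auto
qed

lemma cut_extend: "col \<in> colorings \<kappa> E \<Longrightarrow> cut (col({u, v} \<mapsto> \<beta>)) = col"
  using coloringsD_edge[of col \<kappa> E "{u, v}"] new_edge by (cases "col {u, v}") (auto simp: fun_upd_idem)

lemma extend_cut: "col \<in> colorings \<kappa> E' \<Longrightarrow> (cut col)({u, v} \<mapsto> new_color col) = col"
  using new_color(1) by (simp add: fun_upd_idem)

lemma used_kempe_swap_u:
  assumes col: "col \<in> colorings \<kappa> E"
  shows "used (kempe_swap col \<alpha> \<beta> v) u = used col u"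
proof -
  have "kempe_swap col \<alpha> \<beta> v e = col e" if u: "u \<in> e" for e
  proof (cases "e \<in> bicolored col \<alpha> \<beta>")
    case True
    let ?G = "bicolored col \<alpha> \<beta>"
    have "e \<in> E" using True bicolored_subset[OF col] by blast
    then obtain x y where xy: "e = {x, y}" using forest_pair[OF forest] by blast
    have "e \<inter> tree ?G v = {}"
    proof (rule ccontr)
      assume "e \<inter> tree ?G v \<noteq> {}"
      then obtain z where "z \<in> {x, y}" "z \<in> tree ?G v" using xy by blast
      then have "{x, y} \<subseteq> tree ?G v" using True xy by (intro tree_edge_subset) auto
      then have "linked ?G v u" using u xy by (auto simp: tree_def)
      then have "linked E v u" by (rule linked_mono) (rule bicolored_subset[OF col])
      then show False using not_linked linked_sym by blast
    qed
    then show ?thesis by (rule kempe_swap_outside)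
  qed (rule kempe_swap_other)
  then have "u \<in> e \<and> kempe_swap col \<alpha> \<beta> v e = Some k \<longleftrightarrow> u \<in> e \<and> col e = Some k" for e k by auto
  then show ?thesis unfolding used_def by simp
qed


lemma used_kempe_swap_v:
  assumes "\<beta> \<in> used col v" "\<alpha> \<notin> used col v"
  shows "\<beta> \<notin> used (kempe_swap col \<alpha> \<beta> v) v" "\<alpha> \<in> used (kempe_swap col \<alpha> \<beta> v) v"
proof -
  have "Transposition.transpose \<alpha> \<beta> k = \<beta> \<longleftrightarrow> k = \<alpha>" for k
    by (auto simp: Transposition.transpose_def)
  then show "\<beta> \<notin> used (kempe_swap col \<alpha> \<beta> v) v"
    unfolding used_kempe_swap using assms by (metis imageE)
  show "\<alpha> \<in> used (kempe_swap col \<alpha> \<beta> v) v"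
    unfolding used_kempe_swap using assms by (intro image_eqI[of _ _ \<beta>]) auto
qed

lemma used_kempe_swap_v':
  assumes "\<beta> \<notin> used col v" "\<alpha> \<in> used col v"
  shows "\<beta> \<in> used (kempe_swap col \<alpha> \<beta> v) v" "\<alpha> \<notin> used (kempe_swap col \<alpha> \<beta> v) v"
proof -
  have "Transposition.transpose \<alpha> \<beta> k = \<alpha> \<longleftrightarrow> k = \<beta>" for k
    by (auto simp: Transposition.transpose_def)
  then show "\<alpha> \<notin> used (kempe_swap col \<alpha> \<beta> v) v"
    unfolding used_kempe_swap using assms by (metis imageE)
  show "\<beta> \<in> used (kempe_swap col \<alpha> \<beta> v) v"
    unfolding used_kempe_swap using assms by (intro image_eqI[of _ _ \<alpha>]) auto
qed

text \<open>An expectation without its normalization. The arbitrary function \<open>h\<close> of old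
  and new coloring lets one regrouping serve three times: the constant 1 counts colorings, an
  indicator gives uniformity, and \<open>recourse\<close> gives the cost.\<close>

definition transition_sum :: "(coloring \<Rightarrow> coloring \<Rightarrow> real) \<Rightarrow> real" where
  "transition_sum h = (\<Sum>col\<in>colorings \<kappa> E. \<Sum>\<beta>\<in>available \<kappa> col u.
     if \<beta> \<in> used col v
     then (\<Sum>\<alpha>\<in>available \<kappa> col v. h col ((kempe_swap col \<alpha> \<beta> v)({u, v} \<mapsto> \<beta>))) / (\<kappa> - degree E v)
     else h col (col({u, v} \<mapsto> \<beta>)))"

lemma finite_available [simp]: "finite (available \<kappa> col x)"
  by (simp add: available_def)

lemma finite_used: "col \<in> colorings \<kappa> E \<Longrightarrow> finite (used col x)"
  by (rule finite_subset[OF used_subset]) auto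

lemma finite_E' [simp]: "finite E'"
  using finite_edges by simp

text \<open>Terms are sorted by the outcome \<open>c\<close>. Without a clash, removing the new edge
  recovers the old coloring. With a clash, \<beta> is used and \<alpha> free at \<open>v\<close>
  before the swap, and conversely after it. Hence the pairs of \<open>c\<close> and a color \<alpha>
  used at \<open>v\<close> in \<open>cut c\<close> enumerate all cases, and repeating the swap
  recovers the old coloring.\<close>

lemma transition_sum_reindex:
  "transition_sum h = (\<Sum>c\<in>colorings \<kappa> E'. h (cut c) c +
     (\<Sum>\<alpha>\<in>used (cut c) v. h (kempe_swap (cut c) \<alpha> (new_color c) v) c) / (\<kappa> - degree E v))"
proof -
  let ?C = "colorings \<kappa> E" and ?C' = "colorings \<kappa> E'"
  let ?P = "SIGMA col:?C. available \<kappa> col u"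
  let ?used = "{(col, \<beta>). \<beta> \<in> used col v}"
  have fin: "finite ?C" "finite ?C'" using finite_colorings finite_edges by auto
  have finP: "finite ?P" using fin by auto
  let ?f = "\<lambda>(col, \<beta>). \<Sum>\<alpha>\<in>available \<kappa> col v. h col ((kempe_swap col \<alpha> \<beta> v)({u, v} \<mapsto> \<beta>))"
  let ?g = "\<lambda>(col, \<beta>). h col (col({u, v} \<mapsto> \<beta>))"
  have "transition_sum h = (\<Sum>x\<in>?P. if x \<in> ?used then ?f x / (\<kappa> - degree E v) else ?g x)"
    unfolding transition_sum_def using fin by (subst sum.Sigma) (auto intro!: sum.cong)
  also have "\<dots> = (\<Sum>x\<in>?P \<inter> ?used. ?f x / (\<kappa> - degree E v)) + (\<Sum>x\<in>?P \<inter> - ?used. ?g x)"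
    using finP by (subst sum.If_cases) auto
  also have "(\<Sum>x\<in>?P \<inter> - ?used. ?g x) = (\<Sum>c\<in>?C'. h (cut c) c)"
  proof (rule sum.reindex_bij_witness[of _ "\<lambda>c. (cut c, new_color c)" "\<lambda>(col, \<beta>). col({u, v} \<mapsto> \<beta>)"])
    fix c assume c: "c \<in> ?C'"
    show "(case (cut c, new_color c) of (col, \<beta>) \<Rightarrow> col({u, v} \<mapsto> \<beta>)) = c"
      using extend_cut[OF c] by simp
    show "(cut c, new_color c) \<in> ?P \<inter> - ?used"
      using cut_coloring[OF c] new_color[OF c] by (auto simp: available_used)
  next
    fix x assume x: "x \<in> ?P \<inter> - ?used"
    obtain col \<beta> where [simp]: "x = (col, \<beta>)" by (cases x)
    have col: "col \<in> ?C" using x by auto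
    show "(case x of (col, \<beta>) \<Rightarrow> col({u, v} \<mapsto> \<beta>)) \<in> ?C'"
      using x by (auto simp: available_used intro!: extend_coloring)
    show "(cut (case x of (col, \<beta>) \<Rightarrow> col({u, v} \<mapsto> \<beta>)), new_color (case x of (col, \<beta>) \<Rightarrow> col({u, v} \<mapsto> \<beta>))) = x"
      using cut_extend[OF col, of \<beta>] by simp
    show "h (cut (case x of (col, \<beta>) \<Rightarrow> col({u, v} \<mapsto> \<beta>))) (case x of (col, \<beta>) \<Rightarrow> col({u, v} \<mapsto> \<beta>)) = ?g x"
      using cut_extend[OF col, of \<beta>] by simp
  qed
  also have "(\<Sum>x\<in>?P \<inter> ?used. ?f x / (\<kappa> - degree E v)) = (\<Sum>x\<in>?P \<inter> ?used. ?f x) / (\<kappa> - degree E v)"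
    by (simp add: sum_divide_distrib)
  also have "(\<Sum>x\<in>?P \<inter> ?used. ?f x) =
    (\<Sum>(x, \<alpha>)\<in>(SIGMA x:?P \<inter> ?used. available \<kappa> (fst x) v).
       h (fst x) ((kempe_swap (fst x) \<alpha> (snd x) v)({u, v} \<mapsto> snd x)))"
    using finP by (subst sum.Sigma[symmetric]) (auto intro!: sum.cong)
  also have "\<dots> = (\<Sum>(c, \<alpha>)\<in>(SIGMA c:?C'. used (cut c) v). h (kempe_swap (cut c) \<alpha> (new_color c) v) c)"
  proof (rule sum.reindex_bij_witness[of _
        "\<lambda>(c, \<alpha>). ((kempe_swap (cut c) \<alpha> (new_color c) v, new_color c), \<alpha>)"
        "\<lambda>((col, \<beta>), \<alpha>). ((kempe_swap col \<alpha> \<beta> v)({u, v} \<mapsto> \<beta>), \<alpha>)"], goal_cases)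
    case (3 y)
    then obtain c \<alpha> where y: "y = (c, \<alpha>)" "c \<in> ?C'" "\<alpha> \<in> used (cut c) v" by auto
    then show ?case using extend_cut[of c] by simp
  next
    case (4 y)
    then obtain c \<alpha> where y: "y = (c, \<alpha>)" and c: "c \<in> ?C'" and \<alpha>: "\<alpha> \<in> used (cut c) v" by auto
    have "\<alpha> \<in> {1..\<kappa>}" using used_subset[OF cut_coloring[OF c]] \<alpha> by blast
    then have "kempe_swap (cut c) \<alpha> (new_color c) v \<in> ?C"
      using new_color(2)[OF c] cut_coloring[OF c] by (intro kempe_swap_colorings[OF forest])
    then show ?case
      using y used_kempe_swap_v'[OF new_color(4)[OF c] \<alpha>] new_color[OF c] \<open>\<alpha> \<in> {1..\<kappa>}\<close>
        used_kempe_swap_u[OF cut_coloring[OF c]]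
      by (auto simp: available_used)
  next
    case (1 x)
    then obtain col \<beta> \<alpha> where x: "x = ((col, \<beta>), \<alpha>)" and col: "col \<in> ?C" by auto
    have "\<alpha> \<in> {1..\<kappa>}" "\<beta> \<in> {1..\<kappa>}" using 1 x by (auto simp: available_used)
    then have "kempe_swap col \<alpha> \<beta> v \<in> ?C" using col by (intro kempe_swap_colorings[OF forest])
    then show ?case using cut_extend[of "kempe_swap col \<alpha> \<beta> v" \<beta>] x by simp
  next
    case (2 x)
    then obtain col \<beta> \<alpha> where x: "x = ((col, \<beta>), \<alpha>)" and col: "col \<in> ?C"
      and \<beta>: "\<beta> \<in> available \<kappa> col u" "\<beta> \<in> used col v" and \<alpha>: "\<alpha> \<in> available \<kappa> col v" by auto
    have ab: "\<alpha> \<in> {1..\<kappa>}" "\<beta> \<in> {1..\<kappa>}" using \<alpha> \<beta> by (auto simp: available_used)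
    then have sw: "kempe_swap col \<alpha> \<beta> v \<in> ?C" using col by (intro kempe_swap_colorings[OF forest])
    have used: "\<beta> \<notin> used (kempe_swap col \<alpha> \<beta> v) v" "\<alpha> \<in> used (kempe_swap col \<alpha> \<beta> v) v"
      using used_kempe_swap_v[OF \<beta>(2), of \<alpha>] \<alpha> by (auto simp: available_used)
    have "\<beta> \<notin> used (kempe_swap col \<alpha> \<beta> v) u"
      using \<beta>(1) used_kempe_swap_u[OF col] by (simp add: available_used)
    then have "(kempe_swap col \<alpha> \<beta> v)({u, v} \<mapsto> \<beta>) \<in> ?C'"
      using sw ab used by (intro extend_coloring)
    then show ?case using x used cut_extend[OF sw, of \<beta>] by simp
  next
    case (5 x)
    then obtain col \<beta> \<alpha> where x: "x = ((col, \<beta>), \<alpha>)" and col: "col \<in> ?C" by auto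
    have "\<alpha> \<in> {1..\<kappa>}" "\<beta> \<in> {1..\<kappa>}" using 5 x by (auto simp: available_used)
    then have "kempe_swap col \<alpha> \<beta> v \<in> ?C" using col by (intro kempe_swap_colorings[OF forest])
    then show ?case using cut_extend[of "kempe_swap col \<alpha> \<beta> v" \<beta>] x by simp
  qed
  also have "\<dots> = (\<Sum>c\<in>?C'. \<Sum>\<alpha>\<in>used (cut c) v. h (kempe_swap (cut c) \<alpha> (new_color c) v) c)"
    using fin finite_used cut_coloring by (subst sum.Sigma) auto
  finally show ?thesis
    by (simp only: sum.distrib sum_divide_distrib)
qed

lemma card_available_pos:
  assumes "col \<in> colorings \<kappa> E"
  shows "available \<kappa> col u \<noteq> {}" "available \<kappa> col v \<noteq> {}"
  using degree_u degree_v card_available[OF assms, of u] card_available[OF assms, of v] by auto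

lemma transition_sum_const: "transition_sum (\<lambda>_ _. 1) = card (colorings \<kappa> E) * (\<kappa> - degree E u)"
proof -
  have "transition_sum (\<lambda>_ _. 1) = (\<Sum>col\<in>colorings \<kappa> E. \<Sum>\<beta>\<in>available \<kappa> col u. 1)"
    unfolding transition_sum_def using degree_v by (intro sum.cong refl) (simp add: card_available)
  also have "\<dots> = (\<Sum>col\<in>colorings \<kappa> E. real (\<kappa> - degree E u))"
    by (intro sum.cong refl) (simp add: card_available)
  finally show ?thesis by simp
qed

lemma card_used_cut: "c \<in> colorings \<kappa> E' \<Longrightarrow> card (used (cut c) v) = degree E v"
  by (intro card_used[of _ \<kappa>] cut_coloring)

text \<open>Double counting with \<open>h\<close> constantly 1: every coloring of \<open>E'\<close>
  receives the weight 1 + deg v / (\<kappa> - deg v) = \<kappa> / (\<kappa> - deg v).\<close>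

lemma card_colorings_insert:
  "real (card (colorings \<kappa> E)) * (\<kappa> - degree E u) * (\<kappa> - degree E v) = card (colorings \<kappa> E') * \<kappa>"
proof -
  have "real (card (colorings \<kappa> E)) * (\<kappa> - degree E u) = transition_sum (\<lambda>_ _. 1)" by (simp add: transition_sum_const)
  also have "\<dots> = (\<Sum>c\<in>colorings \<kappa> E'. 1 + real (degree E v) / (\<kappa> - degree E v))"
    unfolding transition_sum_reindex by (intro sum.cong refl) (simp add: card_used_cut)
  also have "\<dots> = card (colorings \<kappa> E') * (1 + real (degree E v) / (\<kappa> - degree E v))" by simp
  also have "1 + real (degree E v) / (\<kappa> - degree E v) = \<kappa> / (\<kappa> - degree E v)"
    using degree_v by (simp add: field_simps of_nat_diff)
  finally show ?thesis using degree_v by (simp add: field_simps)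
qed

lemma colorings_insert_nonempty:
  assumes "colorings \<kappa> E \<noteq> {}"
  shows "colorings \<kappa> E' \<noteq> {}"
proof
  assume "colorings \<kappa> E' = {}"
  then have "real (card (colorings \<kappa> E)) * (\<kappa> - degree E u) * (\<kappa> - degree E v) = 0"
    unfolding card_colorings_insert by simp
  then show False using assms degree_u degree_v finite_colorings[OF finite_edges] by auto
qed

text \<open>The old coloring is kept in the pair because the recourse compares both
  colorings.\<close>

definition transition :: "(coloring \<times> coloring) pmf" where
  "transition = pmf_of_set (colorings \<kappa> E) \<bind> (\<lambda>col. map_pmf (Pair col) (attach \<kappa> col))"

lemma finite_recolor:
  assumes "col \<in> colorings \<kappa> E"
  shows "finite (set_pmf (recolor \<kappa> col \<beta>))"
  using card_available_pos[OF assms] by (simp add: recolor_def)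

lemma finite_attach:
  assumes "col \<in> colorings \<kappa> E"
  shows "finite (set_pmf (attach \<kappa> col))"
  using card_available_pos[OF assms] finite_recolor[OF assms] by (simp add: attach_def)

lemma expectation_transition:
  assumes ne: "colorings \<kappa> E \<noteq> {}"
  shows "measure_pmf.expectation transition (\<lambda>(col, c). h col c) =
    transition_sum h / (real (card (colorings \<kappa> E)) * (\<kappa> - degree E u))"
proof -
  have rec: "measure_pmf.expectation (recolor \<kappa> col \<beta>) (h col) =
     (if \<beta> \<in> used col v
     then (\<Sum>\<alpha>\<in>available \<kappa> col v. h col ((kempe_swap col \<alpha> \<beta> v)({u, v} \<mapsto> \<beta>))) / (\<kappa> - degree E v)
     else h col (col({u, v} \<mapsto> \<beta>)))" (is "_ = ?r col \<beta>") if col: "col \<in> colorings \<kappa> E" for col \<beta>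
    using card_available_pos[OF col] card_available[OF col] by (simp add: recolor_def integral_pmf_of_set)
  have att: "measure_pmf.expectation (attach \<kappa> col) (h col) =
     (\<Sum>\<beta>\<in>available \<kappa> col u. ?r col \<beta>) / (\<kappa> - degree E u)" if col: "col \<in> colorings \<kappa> E" for col
  proof -
    have "measure_pmf.expectation (attach \<kappa> col) (h col) = (\<Sum>\<beta>\<in>available \<kappa> col u.
        measure_pmf.expectation (recolor \<kappa> col \<beta>) (h col) /\<^sub>R real (card (available \<kappa> col u)))"
      unfolding attach_def using card_available_pos(1)[OF col] finite_recolor[OF col]
      by (intro pmf_expectation_bind_pmf_of_set) auto
    also have "\<dots> = (\<Sum>\<beta>\<in>available \<kappa> col u. ?r col \<beta> / (\<kappa> - degree E u))"
      by (simp only: rec[OF col] card_available[OF col] real_scaleR_def divide_inverse mult.commute)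
    also have "\<dots> = (\<Sum>\<beta>\<in>available \<kappa> col u. ?r col \<beta>) / (\<kappa> - degree E u)"
      by (rule sum_divide_distrib[symmetric])
    finally show ?thesis .
  qed
  have "measure_pmf.expectation transition (\<lambda>(col, c). h col c) =
    (\<Sum>col\<in>colorings \<kappa> E. measure_pmf.expectation (attach \<kappa> col) (h col) / card (colorings \<kappa> E))"
    unfolding transition_def
    using ne finite_colorings[OF finite_edges] finite_attach
    by (subst pmf_expectation_bind_pmf_of_set) (simp_all add: divide_inverse mult.commute)
  also have "\<dots> = (\<Sum>col\<in>colorings \<kappa> E. (\<Sum>\<beta>\<in>available \<kappa> col u. ?r col \<beta>) /
      (real (card (colorings \<kappa> E)) * (\<kappa> - degree E u)))"
    using att by (intro sum.cong refl) (simp add: field_simps)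
  also have "\<dots> = transition_sum h / (real (card (colorings \<kappa> E)) * (\<kappa> - degree E u))"
    unfolding transition_sum_def by (rule sum_divide_distrib[symmetric])
  finally show ?thesis .
qed

text \<open>The weight \<kappa> / (\<kappa> - deg v) of an outcome in the regrouped sum is the same
  for all outcomes, and \<open>card_colorings_insert\<close> normalizes it to the uniform
  probability.\<close>

lemma attach_uniform:
  assumes ne: "colorings \<kappa> E \<noteq> {}"
  shows "pmf_of_set (colorings \<kappa> E) \<bind> attach \<kappa> = pmf_of_set (colorings \<kappa> E')"
proof (rule pmf_eqI)
  fix c
  let ?C' = "colorings \<kappa> E'" and ?Na = "real (card (colorings \<kappa> E)) * (\<kappa> - degree E u)"
  let ?d = "real (\<kappa> - degree E v)"
  have "pmf_of_set (colorings \<kappa> E) \<bind> attach \<kappa> = map_pmf snd transition"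
    by (simp add: transition_def map_bind_pmf pmf.map_comp o_def)
  then have "pmf (pmf_of_set (colorings \<kappa> E) \<bind> attach \<kappa>) c =
      measure_pmf.expectation (map_pmf snd transition) (indicator {c})"
    by (simp add: measure_pmf_single del: integral_map_pmf)
  also have "\<dots> = measure_pmf.expectation transition (\<lambda>x. indicator {c} (snd x))"
    by (rule integral_map_pmf)
  also have "\<dots> = measure_pmf.expectation transition (\<lambda>(_, c'). indicator {c} c')"
    by (intro arg_cong[where f = "measure_pmf.expectation transition"]) auto
  also have "\<dots> = transition_sum (\<lambda>_. indicator {c}) / ?Na"
    by (rule expectation_transition[OF ne])
  also have "transition_sum (\<lambda>_. indicator {c}) = (\<Sum>c'\<in>?C'. indicator {c} c' * (\<kappa> / ?d))"
    unfolding transition_sum_reindex using degree_v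
    by (intro sum.cong refl) (simp add: card_used_cut field_simps of_nat_diff)
  also have "\<dots> = indicator ?C' c * (\<kappa> / ?d)"
  proof -
    have "(\<Sum>c'\<in>?C'. indicator {c} c' * (\<kappa> / ?d)) = (\<Sum>c'\<in>?C'. if c' = c then \<kappa> / ?d else 0)"
      by (intro sum.cong refl) auto
    then show ?thesis using finite_colorings[OF finite_E', of \<kappa>] by simp
  qed
  also have "\<dots> / ?Na = indicator ?C' c * (\<kappa> / (?Na * ?d))" by simp
  also have "?Na * ?d = card ?C' * \<kappa>" by (rule card_colorings_insert)
  also have "indicator ?C' c * (\<kappa> / (card ?C' * \<kappa>)) = indicator ?C' c / card ?C'" 
    using degree_v by simp
  also have "\<dots> = pmf (pmf_of_set ?C') c"
    using colorings_insert_nonempty[OF ne] finite_colorings[OF finite_E', of \<kappa>] by simp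
  finally show "pmf (pmf_of_set (colorings \<kappa> E) \<bind> attach \<kappa>) c = pmf (pmf_of_set ?C') c" .
qed

section \<open>Expected recourse of a single insertion\<close>

definition expected_recourse :: real where
  "expected_recourse = measure_pmf.expectation transition (\<lambda>(col, c). real (recourse col c))"

text \<open>Insertions without a clash cost nothing, as the new edge has no earlier color. In the
  other terms the degrees cancel by \<open>card_colorings_insert\<close>, which leaves an average
  over the colorings of \<open>E'\<close> and the factor 1 / \<kappa>.\<close>

lemma expected_recourse_eq:
  assumes ne: "colorings \<kappa> E \<noteq> {}"
  shows "expected_recourse = (\<Sum>c\<in>colorings \<kappa> E'. \<Sum>\<alpha>\<in>used (cut c) v.
    real (recourse (kempe_swap (cut c) \<alpha> (new_color c) v) c)) / (card (colorings \<kappa> E') * \<kappa>)"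
proof -
  have zero: "recourse (cut c) c = 0" for c
  proof -
    have "{e \<in> dom (cut c). c e \<noteq> cut c e} = {}" by auto
    then show ?thesis unfolding recourse_def by (simp only: card.empty)
  qed
  have "expected_recourse = transition_sum (\<lambda>col c. real (recourse col c)) /
      (real (card (colorings \<kappa> E)) * (\<kappa> - degree E u))"
    unfolding expected_recourse_def by (rule expectation_transition[OF ne])
  also have "transition_sum (\<lambda>col c. real (recourse col c)) = (\<Sum>c\<in>colorings \<kappa> E'. \<Sum>\<alpha>\<in>used (cut c) v.
    real (recourse (kempe_swap (cut c) \<alpha> (new_color c) v) c)) / (\<kappa> - degree E v)"
    unfolding transition_sum_reindex by (simp add: zero sum_divide_distrib)
  finally show ?thesis unfolding card_colorings_insert[symmetric] by (simp add: mult_ac)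
qed

text \<open>Some edge at \<open>v\<close> has color \<alpha> after the insertion and had \<beta>
  before, so at least one edge changes. Conversely only chain edges change, and each is the final
  edge of a path from \<open>v\<close> within the chain.\<close>

lemma recourse_kempe_swap:
  assumes c: "c \<in> colorings \<kappa> E'" and \<alpha>: "\<alpha> \<in> used (cut c) v"
  shows "1 \<le> recourse (kempe_swap (cut c) \<alpha> (new_color c) v) c"
    "recourse (kempe_swap (cut c) \<alpha> (new_color c) v) c \<le> card (paths_from (bicolored (cut c) \<alpha> (new_color c)) v)"
proof -
  let ?\<beta> = "new_color c"
  let ?sw = "kempe_swap (cut c) \<alpha> ?\<beta> v" and ?G = "bicolored (cut c) \<alpha> ?\<beta>"
  let ?S = "{e \<in> dom ?sw. c e \<noteq> ?sw e}"
  have cut: "cut c \<in> colorings \<kappa> E" using cut_coloring[OF c] .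
  have dom: "dom ?sw = E" using coloringsD_dom[OF cut] by simp
  have G: "?G \<subseteq> E" by (rule bicolored_subset[OF cut])
  have fG: "forest ?G" "finite ?G" using forest_subset[OF forest G] finite_subset[OF G finite_edges] by auto
  have fin: "finite ?S" using finite_edges dom by simp
  obtain e where e: "v \<in> e" "cut c e = Some \<alpha>" using \<alpha> by (auto simp: used_def)
  have "?sw e = Some ?\<beta>" using kempe_swap_inside[OF e(1), of "cut c" \<alpha> ?\<beta> v] e by simp
  moreover have "c e = Some \<alpha>" using e by (auto split: if_splits)
  moreover have "\<alpha> \<noteq> ?\<beta>" using \<alpha> new_color(4)[OF c] by blast
  ultimately have "e \<in> ?S" by auto
  then have "?S \<noteq> {}" by blast
  then show "1 \<le> recourse ?sw c" using fin card_gt_0_iff unfolding recourse_def by (simp add: Suc_le_eq card_gt_0_iff)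
  have "?S \<subseteq> tree_edges ?G v"
  proof
    fix e assume e: "e \<in> ?S"
    then have eE: "e \<in> E" using dom by blast
    then have "c e = cut c e" using new_edge by auto
    then have neq: "?sw e \<noteq> cut c e" using e unfolding mem_Collect_eq by metis
    then have eG: "e \<in> ?G" using kempe_swap_other by metis
    have "e \<inter> tree ?G v \<noteq> {}" using neq kempe_swap_outside by metis
    moreover obtain x y where xy: "e = {x, y}" using forest_pair[OF forest eE] by blast
    ultimately obtain z where "z \<in> {x, y}" "z \<in> tree ?G v" by blast
    then have "{x, y} \<subseteq> tree ?G v" using eG xy by (intro tree_edge_subset) auto
    then show "e \<in> tree_edges ?G v" using eG xy by (simp add: tree_edges_def)
  qed
  also have "\<dots> \<subseteq> (\<lambda>q. {last (butlast q), last q}) ` paths_from ?G v" using fG by (intro tree_edges_paths)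
  finally show "recourse ?sw c \<le> card (paths_from ?G v)"
    unfolding recourse_def using finite_paths_from[OF fG(2,1)] by (intro surj_card_le)
qed

lemma expected_recourse_ge:
  assumes ne: "colorings \<kappa> E \<noteq> {}"
  shows "degree E v / \<kappa> \<le> expected_recourse"
proof -
  let ?C' = "colorings \<kappa> E'"
  have pos: "0 < card ?C'"
    using colorings_insert_nonempty[OF ne] finite_colorings[OF finite_E', of \<kappa>] by (simp add: card_gt_0_iff)
  have "real (card ?C') * degree E v = (\<Sum>c\<in>?C'. \<Sum>\<alpha>\<in>used (cut c) v. 1)" by (simp add: card_used_cut)
  also have "\<dots> \<le> (\<Sum>c\<in>?C'. \<Sum>\<alpha>\<in>used (cut c) v. real (recourse (kempe_swap (cut c) \<alpha> (new_color c) v) c))"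
    using recourse_kempe_swap(1) by (intro sum_mono) fastforce
  finally have "real (card ?C') * degree E v / (card ?C' * \<kappa>) \<le> expected_recourse"
    unfolding expected_recourse_eq[OF ne] by (intro divide_right_mono) auto
  then show ?thesis using pos by simp
qed

text \<open>Prefixing \<open>u\<close> to a path of the chain yields a path that is bichromatic in
  the new coloring, as {u, v} has color \<beta>. So the recourse is bounded by the number of
  bichromatic paths through {u, v}, whose frequency among the colorings of \<open>E'\<close> is
  known.\<close>

lemma expected_recourse_le:
  assumes ne: "colorings \<kappa> E \<noteq> {}" and \<kappa>: "2 \<le> \<kappa>"
  shows "expected_recourse \<le> (\<Sum>q\<in>paths_from E v. 1 / (real \<kappa> - 1) ^ (length q - 2)) / \<kappa>"
proof -
  let ?C' = "colorings \<kappa> E'" and ?Q = "paths_from E v"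
  let ?B = "\<lambda>q. {c \<in> ?C'. bichromatic c (u # q)}"
  have fin: "finite ?C'" "finite ?Q"
    using finite_colorings[OF finite_E'] finite_paths_from[OF finite_edges forest] by auto
  have pos: "0 < card ?C'"
    using colorings_insert_nonempty[OF ne] fin by (simp add: card_gt_0_iff)
  have u_notin: "u \<notin> set q" if "q \<in> ?Q" for q
    using that simple_path_tree[of E q] not_linked linked_sym by (auto simp: paths_from_def tree_def)
  have new_path: "simple_path F (u # q) \<longleftrightarrow> simple_path F q \<and> {u, v} \<in> F" if "q \<in> ?Q" for F q
    using that u_notin[OF that] by (cases q) (auto simp: paths_from_def)
  have inner: "(\<Sum>\<alpha>\<in>used (cut c) v. card (paths_from (bicolored (cut c) \<alpha> (new_color c)) v)) \<le>
      card {q \<in> ?Q. bichromatic c (u # q)}" if c: "c \<in> ?C'" for c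
  proof -
    let ?\<beta> = "new_color c"
    let ?P = "\<lambda>\<alpha>. paths_from (bicolored (cut c) \<alpha> ?\<beta>) v"
    have G: "bicolored (cut c) \<alpha> ?\<beta> \<subseteq> E" for \<alpha> by (rule bicolored_subset[OF cut_coloring[OF c]])
    have finP: "finite (?P \<alpha>)" for \<alpha>
      using finite_paths_from finite_subset[OF G finite_edges] forest_subset[OF forest G] by blast
    \<comment> \<open>Among the edges at \<open>v\<close> only the new one has color \<beta>, so the
      first edge of \<open>q\<close> has color \<alpha>. Paths for distinct \<alpha> are therefore
      distinct, and the sum over \<alpha> counts no path twice.\<close>
    have first: "\<exists>w r. q = v # w # r \<and> cut c {v, w} = Some \<alpha>" if q: "q \<in> ?P \<alpha>" for q \<alpha>
    proof -
      obtain x w r where "q = x # w # r"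
        using q by (cases q rule: remdups_adj.cases) (auto simp: paths_from_def)
      then have q_eq: "q = v # w # r" and "{v, w} \<in> bicolored (cut c) \<alpha> ?\<beta>"
        using q by (auto simp: paths_from_def)
      then have "cut c {v, w} = Some \<alpha> \<or> cut c {v, w} = Some ?\<beta>" unfolding bicolored_def by blast
      moreover have "cut c {v, w} \<noteq> Some ?\<beta>" using new_color(4)[OF c] unfolding used_def by blast
      ultimately show ?thesis using q_eq by blast
    qed
    have "(\<Sum>\<alpha>\<in>used (cut c) v. card (?P \<alpha>)) = card (\<Union>\<alpha>\<in>used (cut c) v. ?P \<alpha>)"
    proof (rule card_UN_disjoint[symmetric])
      show "finite (used (cut c) v)" using finite_used[OF cut_coloring[OF c]] .
      show "\<forall>i\<in>used (cut c) v. \<forall>j\<in>used (cut c) v. i \<noteq> j \<longrightarrow> ?P i \<inter> ?P j = {}"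
      proof (intro ballI impI equals0I)
        fix i j q assume "i \<noteq> j" "q \<in> ?P i \<inter> ?P j"
        then show False using first[of q i] first[of q j] by (metis IntD1 IntD2 list.inject option.inject)
      qed
    qed (use finP in blast)
    also have "\<dots> \<le> card {q \<in> ?Q. bichromatic c (u # q)}"
    proof (rule card_mono)
      show "(\<Union>\<alpha>\<in>used (cut c) v. ?P \<alpha>) \<subseteq> {q \<in> ?Q. bichromatic c (u # q)}"
      proof
        fix q assume "q \<in> (\<Union>\<alpha>\<in>used (cut c) v. ?P \<alpha>)"
        then obtain \<alpha> where q: "q \<in> ?P \<alpha>" by blast
        then have qQ: "q \<in> ?Q" using simple_path_mono[OF _ G] by (auto simp: paths_from_def)
        have "bicolored (cut c) \<alpha> ?\<beta> \<subseteq> bicolored c \<alpha> ?\<beta>" by (auto simp: bicolored_def split: if_splits)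
        then have "simple_path (bicolored c \<alpha> ?\<beta>) q" using q simple_path_mono by (auto simp: paths_from_def)
        moreover have "{u, v} \<in> bicolored c \<alpha> ?\<beta>" using new_color(1)[OF c] by (simp add: bicolored_def)
        ultimately have "simple_path (bicolored c \<alpha> ?\<beta>) (u # q)" using new_path[OF qQ] by blast
        then show "q \<in> {q \<in> ?Q. bichromatic c (u # q)}" using qQ by (auto simp: bichromatic_def)
      qed
    qed (use fin in simp)
    finally show ?thesis .
  qed
  have count: "card (?B q) \<le> card ?C' * (1 / (real \<kappa> - 1) ^ (length q - 2))" if q: "q \<in> ?Q" for q
  proof -
    have "simple_path E' q" using q by (auto simp: paths_from_def intro: simple_path_mono)
    then have path: "simple_path E' (u # q)" using new_path[OF q] by simp
    have len: "length (u # q) = (length q - 2) + 3" using q by (simp add: paths_from_def)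
    have "card (?B q) * (\<kappa> - 1) ^ (length q - 2) \<le> card ?C'"
      by (rule bichromatic_card[OF finite_E' forest' path len])
    then have "real (card (?B q) * (\<kappa> - 1) ^ (length q - 2)) \<le> card ?C'" by (simp only: of_nat_le_iff)
    then have "real (card (?B q)) * (real \<kappa> - 1) ^ (length q - 2) \<le> card ?C'" using \<kappa> by (simp add: of_nat_diff)
    then show ?thesis using \<kappa> by (simp add: field_simps)
  qed
  have "(\<Sum>c\<in>?C'. \<Sum>\<alpha>\<in>used (cut c) v. real (recourse (kempe_swap (cut c) \<alpha> (new_color c) v) c)) \<le>
      (\<Sum>c\<in>?C'. real (card {q \<in> ?Q. bichromatic c (u # q)}))"
  proof (rule sum_mono)
    fix c assume c: "c \<in> ?C'"
    have "(\<Sum>\<alpha>\<in>used (cut c) v. recourse (kempe_swap (cut c) \<alpha> (new_color c) v) c) \<le>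
      (\<Sum>\<alpha>\<in>used (cut c) v. card (paths_from (bicolored (cut c) \<alpha> (new_color c)) v))"
      using recourse_kempe_swap(2)[OF c] by (rule sum_mono)
    also have "\<dots> \<le> card {q \<in> ?Q. bichromatic c (u # q)}" by (rule inner[OF c])
    finally show "(\<Sum>\<alpha>\<in>used (cut c) v. real (recourse (kempe_swap (cut c) \<alpha> (new_color c) v) c)) \<le>
        real (card {q \<in> ?Q. bichromatic c (u # q)})"
      by (simp only: of_nat_sum[symmetric] of_nat_le_iff)
  qed
  also have "\<dots> = (\<Sum>c\<in>?C'. \<Sum>q\<in>?Q. if bichromatic c (u # q) then 1 else 0)"
    using fin by (simp add: sum.If_cases Int_def)
  also have "\<dots> = (\<Sum>q\<in>?Q. \<Sum>c\<in>?C'. if bichromatic c (u # q) then 1 else 0)" by (rule sum.swap)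
  also have "\<dots> = (\<Sum>q\<in>?Q. real (card (?B q)))" using fin by (simp add: sum.If_cases Int_def)
  also have "\<dots> \<le> (\<Sum>q\<in>?Q. card ?C' * (1 / (real \<kappa> - 1) ^ (length q - 2)))"
    using count by (rule sum_mono)
  also have "\<dots> = card ?C' * (\<Sum>q\<in>?Q. 1 / (real \<kappa> - 1) ^ (length q - 2))" by (simp add: sum_distrib_left)
  finally have "expected_recourse \<le>
      card ?C' * (\<Sum>q\<in>?Q. 1 / (real \<kappa> - 1) ^ (length q - 2)) / (card ?C' * \<kappa>)"
    unfolding expected_recourse_eq[OF ne] by (intro divide_right_mono) auto
  then show ?thesis using pos by simp
qed

end

section \<open>Growth of the number of paths\<close>

text \<open>Paths from \<open>v\<close> correspond to the other vertices by their end and to the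
  edges by their final edge. Two different paths with the same final edge would traverse it in
  opposite directions, and each would be longer than the other.\<close>

lemma card_tree:
  assumes "finite E" "forest E"
  shows "card (tree E v) = card (tree_edges E v) + 1"
proof -
  let ?Q = "paths_from E v" and ?l = "\<lambda>q::nat list. {last (butlast q), last q}"
  have finT: "finite (tree E v)" using assms finite_tree forest_finite_edge by blast
  have finE: "finite (tree_edges E v)" using assms by (simp add: tree_edges_def)
  have snoc: "\<exists>r x. q = r @ [x, last q] \<and> simple_path E (r @ [x]) \<and> hd (r @ [x]) = v" if "q \<in> ?Q" for q
  proof -
    have "2 \<le> length (rev q)" using that by (simp add: paths_from_def)
    then obtain a b p where "rev q = a # b # p" by (cases "rev q" rule: remdups_adj.cases) auto
    then have "rev (rev q) = rev (a # b # p)" by (rule arg_cong)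
    then have q: "q = (rev p @ [b]) @ [a]" by simp
    then have sp: "simple_path E ((rev p @ [b]) @ [a])" "hd ((rev p @ [b]) @ [a]) = v"
      using that by (auto simp: paths_from_def)
    have "simple_path E (rev p @ [b])" using sp(1) by (rule simple_path_appendD1)
    moreover have "hd (rev p @ [b]) = v" using sp(2) by (cases "rev p") auto
    ultimately show ?thesis using q by auto
  qed
  have l_tree: "?l q \<in> tree_edges E v" if qQ: "q \<in> ?Q" for q
  proof -
    obtain r x where q: "q = r @ [x, last q]" using snoc[OF qQ] by blast
    have sp: "simple_path E (r @ [x, last q])" using that q by (simp add: paths_from_def)
    then have "simple_path E [x, last q]" by (rule simple_path_appendD2)
    then have "{x, last q} \<in> E" by simp
    moreover have "last (butlast q) = x" by (subst q) (simp add: butlast_append)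
    moreover have "set q \<subseteq> tree E v" using simple_path_tree[of E q] qQ by (simp add: paths_from_def)
    moreover have "{x, last q} \<subseteq> set q" by (subst (2) q) simp
    ultimately show ?thesis by (auto simp: tree_edges_def)
  qed
  have "inj_on ?l ?Q"
  proof (rule inj_onI)
    fix p q assume p: "p \<in> ?Q" and q: "q \<in> ?Q" and eq: "?l p = ?l q"
    obtain r x where r: "p = r @ [x, last p]" "simple_path E (r @ [x])" "hd (r @ [x]) = v" using snoc[OF p] by blast
    obtain s y where s: "q = s @ [y, last q]" "simple_path E (s @ [y])" "hd (s @ [y]) = v" using snoc[OF q] by blast
    have x: "last (butlast p) = x" by (subst r(1)) (simp add: butlast_append)
    have y: "last (butlast q) = y" by (subst s(1)) (simp add: butlast_append)
    show "p = q"
    proof (cases "last p = last q")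
      case True
      then show ?thesis using paths_from_last_inj[OF assms(2)] p q by (meson inj_onD)
    next
      case False
      then have "x = last q" "y = last p" using eq x y by (auto simp: doubleton_eq_iff)
      then have "r @ [x] = q" "s @ [y] = p"
        using r s p q by (auto intro!: forest_path_unique[OF assms(2)] simp: paths_from_def)
      then have "length q < length p" "length p < length q"
        using arg_cong[OF r(1), of length] arg_cong[OF s(1), of length] by auto
      then show ?thesis by simp
    qed
  qed
  then have "card ?Q \<le> card (tree_edges E v)"
    using l_tree finE by (intro card_inj_on_le[of ?l]) auto
  moreover have "card (tree_edges E v) \<le> card ?Q"
    using tree_edges_paths[OF assms(2)] finite_paths_from[OF assms] by (rule surj_card_le[rotated])
  moreover have "tree E v - {v} \<subseteq> last ` ?Q"
  proof
    fix y assume y: "y \<in> tree E v - {v}"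
    then obtain p where p: "simple_path E p" "p \<noteq> []" "hd p = v" "last p = y"
      by (auto simp: tree_def elim: linked_simple_path)
    then have "2 \<le> length p" using y by (cases p rule: remdups_adj.cases) auto
    then show "y \<in> last ` ?Q" using p by (auto simp: paths_from_def)
  qed
  then have "card (tree E v - {v}) \<le> card ?Q"
    using finite_paths_from[OF assms] by (intro surj_card_le) auto
  moreover have "card ?Q \<le> card (tree E v) - 1" by (rule card_paths_from_le[OF assms])
  moreover have "card (tree E v - {v}) = card (tree E v) - 1" using finT by simp
  moreover have "0 < card (tree E v)" using finT tree_self[of v E] card_gt_0_iff by blast
  ultimately show ?thesis by linarith
qed

lemma card_neighbours:
  assumes "finite E"
  shows "finite {w. {x, w} \<in> E}" "card {w. {x, w} \<in> E} \<le> degree E x"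
proof -
  have inj: "inj_on (\<lambda>w. {x, w}) {w. {x, w} \<in> E}" by (auto simp: inj_on_def doubleton_eq_iff)
  have sub: "(\<lambda>w. {x, w}) ` {w. {x, w} \<in> E} \<subseteq> {e \<in> E. x \<in> e}" by auto
  have fin: "finite {e \<in> E. x \<in> e}" using assms by simp
  show "finite {w. {x, w} \<in> E}" using inj_on_finite[OF inj sub fin] .
  show "card {w. {x, w} \<in> E} \<le> degree E x"
    unfolding degree_def using card_inj_on_le[OF inj sub fin] .
qed

text \<open>Index \<open>k\<close> means distance \<open>k + 1\<close> from \<open>v\<close>, in
  accordance with the exponent \<open>length q - 2\<close> in the bound of the recourse.\<close>

definition level :: "nat set set \<Rightarrow> nat \<Rightarrow> nat \<Rightarrow> nat list set" where
  "level E v k = {q \<in> paths_from E v. length q = k + 2}"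

lemma card_level_0:
  assumes "finite E"
  shows "card (level E v 0) \<le> degree E v"
proof -
  have "level E v 0 \<subseteq> (\<lambda>w. [v, w]) ` {w. {v, w} \<in> E}"
  proof
    fix q assume q: "q \<in> level E v 0"
    then obtain a b where "q = [a, b]" by (auto simp: level_def length_Suc_conv numeral_2_eq_2)
    then show "q \<in> (\<lambda>w. [v, w]) ` {w. {v, w} \<in> E}" using q by (auto simp: level_def paths_from_def)
  qed
  then have "card (level E v 0) \<le> card {w. {v, w} \<in> E}"
    using card_neighbours(1)[OF assms] surj_card_le by blast
  then show ?thesis using card_neighbours(2)[OF assms, of v] by linarith
qed

lemma card_level_Suc:
  assumes E: "finite E" "forest E" and deg: "\<And>x. x \<in> tree E v \<Longrightarrow> degree E x \<le> \<Delta>"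
  shows "card (level E v (Suc k)) \<le> card (level E v k) * (\<Delta> - 1)"
proof -
  let ?N = "\<lambda>q. {w. {last q, w} \<in> E} - {last (butlast q)}"
  have fin: "finite (level E v k)" using finite_paths_from[OF E] by (simp add: level_def)
  have finN: "finite (?N q)" for q using card_neighbours(1)[OF E(1)] by simp
  have step: "butlast q \<in> level E v k \<and> last q \<in> ?N (butlast q)" if q: "q \<in> level E v (Suc k)" for q
  proof -
    have "length (rev q) = Suc (Suc (Suc k))" using q by (simp add: level_def)
    then obtain a b c p where "rev q = a # b # c # p" unfolding length_Suc_conv by blast
    then have "rev (rev q) = rev (a # b # c # p)" by (rule arg_cong)
    then have q_eq: "q = (rev p @ [c, b]) @ [a]" by simp
    have sp: "simple_path E ((rev p @ [c, b]) @ [a])" "hd ((rev p @ [c, b]) @ [a]) = v"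
      using q q_eq by (auto simp: level_def paths_from_def)
    have "simple_path E (rev p @ [c, b])" using sp(1) by (rule simple_path_appendD1)
    moreover have "hd (rev p @ [c, b]) = v" using sp(2) by (cases "rev p") auto
    moreover have "simple_path E (rev p @ [c, b, a])" using sp(1) by simp
    then have "simple_path E [c, b, a]" by (rule simple_path_appendD2)
    ultimately show ?thesis using q q_eq by (auto simp: level_def paths_from_def butlast_append)
  qed
  have cardN: "card (?N q) \<le> \<Delta> - 1" if q: "q \<in> level E v k" for q
  proof -
    have "length (rev q) = Suc (Suc k)" using q by (simp add: level_def)
    then obtain a b p where "rev q = a # b # p" unfolding length_Suc_conv by blast
    then have "rev (rev q) = rev (a # b # p)" by (rule arg_cong)
    then have q_eq: "q = rev p @ [b, a]" by simp
    have "simple_path E (rev p @ [b, a])" using q q_eq by (simp add: level_def paths_from_def)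
    then have "simple_path E [b, a]" by (rule simple_path_appendD2)
    then have mem: "last (butlast q) \<in> {w. {last q, w} \<in> E}"
      using q_eq by (simp add: butlast_append insert_commute)
    have "set q \<subseteq> tree E v" using simple_path_tree[of E q] q by (auto simp: level_def paths_from_def)
    then have "degree E (last q) \<le> \<Delta>" using deg q_eq by auto
    then have "card {w. {last q, w} \<in> E} \<le> \<Delta>" using card_neighbours(2)[OF E(1), of "last q"] by linarith
    then show ?thesis using mem card_neighbours(1)[OF E(1)] by (simp add: card_Diff_singleton)
  qed
  have "card (level E v (Suc k)) \<le> card (SIGMA q:level E v k. ?N q)"
  proof (rule card_inj_on_le)
    show "inj_on (\<lambda>q. (butlast q, last q)) (level E v (Suc k))"
    proof (rule inj_onI)
      fix p q assume "p \<in> level E v (Suc k)" "q \<in> level E v (Suc k)" "(butlast p, last p) = (butlast q, last q)"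
      moreover from this have "p \<noteq> []" "q \<noteq> []" by (auto simp: level_def)
      ultimately show "p = q" by (metis append_butlast_last_id prod.inject)
    qed
    show "(\<lambda>q. (butlast q, last q)) ` level E v (Suc k) \<subseteq> (SIGMA q:level E v k. ?N q)"
      using step by blast
    show "finite (SIGMA q:level E v k. ?N q)" using fin finN by blast
  qed
  also have "\<dots> = (\<Sum>q\<in>level E v k. card (?N q))" using fin finN by simp
  also have "\<dots> \<le> (\<Sum>q\<in>level E v k. \<Delta> - 1)" using cardN by (rule sum_mono)
  finally show ?thesis by simp
qed

lemma card_level_le:
  assumes E: "finite E" "forest E" and deg: "\<And>x. x \<in> tree E v \<Longrightarrow> degree E x \<le> \<Delta>"
  shows "card (level E v k) \<le> \<Delta> * (\<Delta> - 1) ^ k"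
proof (induction k)
  case 0
  show ?case using card_level_0[OF E(1), of v] deg[of v] by simp
next
  case (Suc k)
  have "card (level E v (Suc k)) \<le> card (level E v k) * (\<Delta> - 1)" by (rule card_level_Suc[OF E deg])
  also have "\<dots> \<le> \<Delta> * (\<Delta> - 1) ^ k * (\<Delta> - 1)" using Suc.IH by (rule mult_right_mono) simp
  finally show ?case by (simp add: mult_ac)
qed

definition path_weight :: "real \<Rightarrow> nat set set \<Rightarrow> nat \<Rightarrow> real" where
  "path_weight b E v = (\<Sum>q\<in>paths_from E v. 1 / b ^ (length q - 2))"

lemma card_paths_from_le_edges:
  assumes "finite E" "forest E"
  shows "card (paths_from E v) \<le> card (tree_edges E v)"
  using card_paths_from_le[OF assms, of v] card_tree[OF assms, of v] by simp

lemma path_weight_le_edges: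
  assumes "finite E" "forest E" "1 \<le> b"
  shows "path_weight b E v \<le> card (tree_edges E v)"
proof -
  have "path_weight b E v \<le> (\<Sum>q\<in>paths_from E v. 1)"
    unfolding path_weight_def using assms(3) by (intro sum_mono) (simp add: divide_le_eq_1 one_le_power)
  then show ?thesis using card_paths_from_le_edges[OF assms(1,2), of v] by simp
qed

text \<open>Only the neighbours of \<open>v\<close> have weight 1; every farther vertex has weight
  at most 1 / b.\<close>

lemma path_weight_le_degree:
  assumes "finite E" "forest E" "1 \<le> b"
  shows "path_weight b E v \<le> degree E v + card (tree_edges E v) / b"
proof -
  let ?Q = "paths_from E v"
  have fin: "finite ?Q" using finite_paths_from[OF assms(1,2)] .
  have bound: "1 / b ^ (length q - 2) \<le> (if length q = 2 then 1 else 0) + 1 / b" if qQ: "q \<in> ?Q" for q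
  proof (cases "length q = 2")
    case False
    then obtain k where "length q - 2 = Suc k" using qQ by (cases "length q - 2") (auto simp: paths_from_def)
    then have "b ^ (length q - 2) = b * b ^ k" by simp
    moreover have "b * 1 \<le> b * b ^ k" using assms(3) by (intro mult_left_mono one_le_power) auto
    ultimately show ?thesis using False assms(3) by (simp add: frac_le)
  qed (use assms(3) in simp)
  have "path_weight b E v \<le> (\<Sum>q\<in>?Q. (if length q = 2 then 1 else 0) + 1 / b)"
    unfolding path_weight_def using bound by (rule sum_mono)
  also have "\<dots> = card (level E v 0) + card ?Q / b"
    using fin by (simp add: sum.distrib sum.If_cases level_def Int_def numeral_2_eq_2)
  also have "\<dots> \<le> degree E v + card (tree_edges E v) / b"
    using card_level_0[OF assms(1), of v] card_paths_from_le_edges[OF assms(1,2), of v] assms(3)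
    by (intro add_mono divide_right_mono) auto
  finally show ?thesis .
qed

text \<open>On level k two bounds compete. The branching \<Delta> - 1 is at most \<open>b\<close>,
  so the level weighs at most \<Delta>; and it has at most m vertices, so it weighs at most m / 2 ^
  k because \<open>b\<close> is at least 2. After division by \<Delta> the weight lies in [0, 1] and
  is below its square root, to which the second bound is applied; this leaves a geometric
  series.\<close>

lemma path_weight_le_sqrt:
  assumes E: "finite E" "forest E" and deg: "\<And>x. x \<in> tree E v \<Longrightarrow> degree E x \<le> \<Delta>"
    and \<Delta>: "3 \<le> \<Delta>" and b: "real \<Delta> - 1 \<le> b"
  shows "path_weight b E v \<le> 4 * real \<Delta> * sqrt (card (tree_edges E v) / \<Delta>)"
proof -
  let ?Q = "paths_from E v" and ?m = "card (tree_edges E v)"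
  define M where "M = Suc (Max (length ` ?Q))"
  have fin: "finite ?Q" using finite_paths_from[OF E] .
  have b2: "2 \<le> b" using \<Delta> b by simp
  have "length q - 2 \<in> {..<M}" if "q \<in> ?Q" for q
  proof -
    have "length q \<le> Max (length ` ?Q)" using fin that by (intro Max_ge) auto
    then show ?thesis by (simp add: M_def)
  qed
  then have sub: "(\<lambda>q. length q - 2) ` ?Q \<subseteq> {..<M}" by blast
  have level_eq: "{q \<in> ?Q. length q - 2 = k} = level E v k" for k by (auto simp: level_def paths_from_def)
  have "path_weight b E v = (\<Sum>k<M. \<Sum>q\<in>{q \<in> ?Q. length q - 2 = k}. 1 / b ^ (length q - 2))"
    unfolding path_weight_def using fin sub by (intro sum.group[symmetric]) auto
  also have "\<dots> = (\<Sum>k<M. card (level E v k) / b ^ k)"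
    by (intro sum.cong refl) (simp add: level_eq[symmetric])
  also have "\<dots> \<le> (\<Sum>k<M. \<Delta> * sqrt (?m / \<Delta>) * (3 / 4) ^ k)"
  proof (rule sum_mono)
    fix k
    define x where "x = card (level E v k) / b ^ k / \<Delta>"
    have "real (card (level E v k)) \<le> real (\<Delta> * (\<Delta> - 1) ^ k)"
      using card_level_le[OF E deg] by (simp only: of_nat_le_iff)
    also have "\<dots> = \<Delta> * (real \<Delta> - 1) ^ k" using \<Delta> by (simp add: of_nat_diff)
    also have "\<dots> \<le> \<Delta> * b ^ k" using \<Delta> b by (intro mult_left_mono power_mono) auto
    finally have x1: "x \<le> 1" unfolding x_def using b2 \<Delta> by (simp add: divide_le_eq mult.commute)
    have x0: "0 \<le> x" unfolding x_def using b2 by simp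
    have "level E v k \<subseteq> ?Q" by (auto simp: level_def)
    then have "card (level E v k) \<le> ?m"
      using card_mono[OF fin] card_paths_from_le_edges[OF E, of v] by (meson le_trans)
    moreover have "(2::real) ^ k \<le> b ^ k" using b2 by (intro power_mono) auto
    ultimately have "card (level E v k) / b ^ k \<le> ?m / 2 ^ k" by (intro frac_le) auto
    then have "x \<le> ?m / 2 ^ k / \<Delta>" unfolding x_def by (intro divide_right_mono) auto
    also have "\<dots> = ?m / \<Delta> * (1 / 2) ^ k" by (simp add: power_one_over)
    finally have "sqrt x \<le> sqrt (?m / \<Delta> * (1 / 2) ^ k)" by (rule real_sqrt_le_mono)
    then have xm: "sqrt x \<le> sqrt (?m / \<Delta>) * sqrt (1 / 2) ^ k"
      by (simp only: real_sqrt_mult real_sqrt_power)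
    have "x * x \<le> x * 1" using x0 x1 by (intro mult_left_mono) auto
    then have "x \<le> sqrt x" using x0 by (intro real_le_rsqrt) (simp add: power2_eq_square)
    also have "\<dots> \<le> sqrt (?m / \<Delta>) * sqrt (1 / 2) ^ k" by (rule xm)
    \<comment> \<open>3 / 4 is a rational upper bound of sqrt (1 / 2); its geometric series is at
      most 4, the constant of the lemma.\<close>
    also have "\<dots> \<le> sqrt (?m / \<Delta>) * (3 / 4) ^ k"
      by (intro mult_left_mono power_mono real_le_lsqrt) (auto simp: power2_eq_square)
    finally have "\<Delta> * x \<le> \<Delta> * (sqrt (?m / \<Delta>) * (3 / 4) ^ k)" by (intro mult_left_mono) auto
    then show "card (level E v k) / b ^ k \<le> \<Delta> * sqrt (?m / \<Delta>) * (3 / 4) ^ k"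
      using \<Delta> by (simp add: x_def mult.assoc)
  qed
  also have "\<dots> = \<Delta> * sqrt (?m / \<Delta>) * (\<Sum>k<M. (3 / 4) ^ k)" by (simp add: sum_distrib_left)
  also have "\<dots> \<le> \<Delta> * sqrt (?m / \<Delta>) * 4"
  proof (rule mult_left_mono)
    have "(\<Sum>k<M. (3 / 4 :: real) ^ k) = 4 * (1 - (3 / 4) ^ M)" by (subst sum_gp_strict) simp
    then show "(\<Sum>k<M. (3 / 4 :: real) ^ k) \<le> 4" by simp
  qed simp
  finally show ?thesis by (simp add: mult_ac)
qed

section \<open>Amortization\<close>

lemma edges_of_snoc [simp]: "edges_of (us @ [(x, y)]) = insert {x, y} (edges_of us)"
  by (simp add: edges_of_def)

lemma edges_of_Nil [simp]: "edges_of [] = {}"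
  by (simp add: edges_of_def)

lemma finite_edges_of [simp]: "finite (edges_of us)"
  by (simp add: edges_of_def)

lemma degree_empty [simp]: "degree {} x = 0"
  by (simp add: degree_def)

lemma insertion_sequence_Nil [simp]: "insertion_sequence V \<Delta> []"
  by (simp add: insertion_sequence_def)

lemma insertion_sequence_snoc:
  "insertion_sequence V \<Delta> (us @ [(x, y)]) \<longleftrightarrow> insertion_sequence V \<Delta> us \<and> x \<in> V \<and> y \<in> V \<and>
    \<not> linked (edges_of us) x y \<and> (\<forall>z\<in>V. degree (insert {x, y} (edges_of us)) z \<le> \<Delta>)"
proof -
  have 1: "(\<forall>i<length (us @ [(x, y)]). P i) \<longleftrightarrow> (\<forall>i<length us. P i) \<and> P (length us)" for P
    by (auto simp: less_Suc_eq)
  have 2: "(\<forall>i\<le>length (us @ [(x, y)]). P i) \<longleftrightarrow> (\<forall>i\<le>length us. P i) \<and> P (Suc (length us))" for P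
    by (auto simp: le_Suc_eq)
  show ?thesis
    unfolding insertion_sequence_def 1 2
    by (auto simp: nth_append)
qed

lemma insertion_sequence_forest:
  assumes "insertion_sequence V \<Delta> us"
  shows "forest (edges_of us)" "\<Union>(edges_of us) \<subseteq> V"
    "\<And>z. z \<in> V \<Longrightarrow> degree (edges_of us) z \<le> \<Delta>"
proof -
  have "forest (edges_of us) \<and> \<Union>(edges_of us) \<subseteq> V \<and> (\<forall>z\<in>V. degree (edges_of us) z \<le> \<Delta>)"
    using assms
  proof (induction us rule: rev_induct)
    case (snoc xy us)
    then show ?case by (cases xy) (auto simp: insertion_sequence_snoc intro: forest_insert)
  qed (simp add: forest_def)
  then show "forest (edges_of us)" "\<Union>(edges_of us) \<subseteq> V"
    "\<And>z. z \<in> V \<Longrightarrow> degree (edges_of us) z \<le> \<Delta>" by auto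
qed

lemma degree_insert:
  assumes "finite E" "{u, v} \<notin> E"
  shows "degree (insert {u, v} E) x = degree E x + (if x \<in> {u, v} then 1 else 0)"
proof -
  have "{e \<in> insert {u, v} E. x \<in> e} = (if x \<in> {u, v} then insert {u, v} {e \<in> E. x \<in> e} else {e \<in> E. x \<in> e})"
    by auto
  then show ?thesis using assms by (simp add: degree_def)
qed

lemma forest_induct [consumes 2, case_names empty insert]:
  assumes "finite E" "forest E" and empty: "P {}"
    and insert: "\<And>F x y. finite F \<Longrightarrow> forest F \<Longrightarrow> \<not> linked F x y \<Longrightarrow> P F \<Longrightarrow> P (insert {x, y} F)"
  shows "P E"
  using assms(1,2)
proof (induction E rule: finite_induct)
  case (insert e F)
  obtain x y where e: "e = {x, y}" using forest_pair[OF insert.prems] by blast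
  have "insert e F - {{x, y}} = F" using insert.hyps e by auto
  then have "\<not> linked F x y" using forest_bridge[OF insert.prems, of x y] e by simp
  moreover have "forest F" using insert.prems by (rule forest_subset) auto
  ultimately show ?case using assms(4) insert.IH insert.hyps e by blast
qed (rule empty)

text \<open>If \<open>R\<close> is viewed as a set of roots, \<open>f\<close> maps every edge to its lower endpoint.\<close>

lemma forest_orientation:
  assumes "finite E" "forest E" "\<forall>r\<in>R. \<forall>s\<in>R. linked E r s \<longrightarrow> r = s"
  shows "\<exists>f. inj_on f E \<and> (\<forall>e\<in>E. f e \<in> e \<and> f e \<notin> R)"
  using assms
proof (induction arbitrary: R rule: forest_induct)
  case (insert F x y)
  let ?E = "insert {x, y} F"
  have up: "linked ?E r s" if "linked F r s" for r s using that by (rule linked_mono) auto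
  have xy: "linked ?E x y" by (rule linked_edge) simp
  \<comment> \<open>Roots in both parts would be linked by the new edge, hence equal, and would link
    \<open>x\<close> to \<open>y\<close> already in \<open>F\<close>. The endpoint in a part without
    root becomes a root for the induction hypothesis and the lower end of the new edge.\<close>
  have "(\<forall>r\<in>R. \<not> linked F r x) \<or> (\<forall>r\<in>R. \<not> linked F r y)"
  proof (rule ccontr)
    assume "\<not> ?thesis"
    then obtain r s where rs: "r \<in> R" "linked F r x" "s \<in> R" "linked F s y" by blast
    have "linked ?E r s"
      using linked_trans[OF linked_trans[OF up[OF rs(2)] xy] linked_sym[OF up[OF rs(4)]]] .
    then have "r = s" using insert.prems rs by blast
    then have "linked F x y" using linked_trans[OF linked_sym[OF rs(2)]] rs(4) by blast
    then show False using insert.hyps by blast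
  qed
  then obtain a where a: "a \<in> {x, y}" "\<forall>r\<in>R. \<not> linked F r a" by blast
  have "\<forall>r\<in>insert a R. \<forall>s\<in>insert a R. linked F r s \<longrightarrow> r = s"
  proof (intro ballI impI)
    fix r s assume rs: "r \<in> insert a R" "s \<in> insert a R" "linked F r s"
    show "r = s"
    proof (cases "r = a \<or> s = a")
      case True
      then show ?thesis using rs a(2) linked_sym[OF rs(3)] by auto
    next
      case False
      then show ?thesis using rs up[OF rs(3)] insert.prems by auto
    qed
  qed
  from insert.IH[OF this] obtain f where f: "inj_on f F" "\<forall>e\<in>F. f e \<in> e \<and> f e \<notin> insert a R"
    by blast
  have new: "{x, y} \<notin> F" using insert.hyps linked_edge by blast
  let ?f = "f({x, y} := a)"
  have "inj_on ?f ?E"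
    using f new by (auto simp: inj_on_def)
  moreover have "a \<notin> R" using a(2) by auto
  then have "\<forall>e\<in>?E. ?f e \<in> e \<and> ?f e \<notin> R" using f a(1) by auto
  ultimately show ?case by blast
qed simp

section \<open>Potential for merges of two small trees\<close>

definition degree_potential :: "nat set set \<Rightarrow> nat" where
  "degree_potential E = (\<Sum>e\<in>E. Min (degree E ` e))"

text \<open>The minimum is at most the degree of the lower endpoint, and in an orientation of the
  forest the lower endpoints of distinct edges are distinct. So the sum is bounded by the sum of all
  degrees.\<close>

lemma degree_potential_le:
  assumes "finite E" "forest E"
  shows "degree_potential E \<le> 2 * card E"
proof -
  obtain f where f: "inj_on f E" "\<forall>e\<in>E. f e \<in> e"
    using forest_orientation[OF assms, of "{}"] by auto
  have fin: "finite (\<Union>E)" using assms forest_finite_edge by blast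
  have "degree_potential E \<le> (\<Sum>e\<in>E. degree E (f e))"
    unfolding degree_potential_def using f(2) forest_finite_edge[OF assms(2)] by (intro sum_mono Min_le) auto
  also have "\<dots> = (\<Sum>x\<in>f ` E. degree E x)" using f(1) by (simp add: sum.reindex)
  also have "\<dots> \<le> (\<Sum>x\<in>\<Union>E. degree E x)" using f(2) fin by (intro sum_mono2) auto
  also have "\<dots> = (\<Sum>x\<in>\<Union>E. \<Sum>e\<in>E. if x \<in> e then 1 else 0)"
    using assms(1) by (simp add: degree_def sum.If_cases Int_def)
  also have "\<dots> = (\<Sum>e\<in>E. \<Sum>x\<in>\<Union>E. if x \<in> e then 1 else 0)" by (rule sum.swap)
  also have "\<dots> \<le> (\<Sum>e\<in>E. 2)"
  proof (rule sum_mono)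
    fix e assume e: "e \<in> E"
    then obtain x y where xy: "e = {x, y}" using forest_pair[OF assms(2)] by blast
    have "(\<Sum>x\<in>\<Union>E. if x \<in> e then 1 else 0 :: nat) = card {x \<in> \<Union>E. x \<in> e}"
      using fin by (simp add: sum.If_cases Int_def)
    also have "\<dots> \<le> card e" using xy by (intro card_mono) auto
    also have "\<dots> \<le> 2" using xy by (simp add: card_insert_if)
    finally show "(\<Sum>x\<in>\<Union>E. if x \<in> e then 1 else 0 :: nat) \<le> 2" .
  qed
  finally show ?thesis by simp
qed

lemma degree_potential_insert:
  assumes "finite E" "forest E" "\<not> linked E u v"
  shows "degree_potential E + min (degree E u) (degree E v) \<le> degree_potential (insert {u, v} E)"
proof -
  let ?E = "insert {u, v} E"
  have new: "{u, v} \<notin> E" using assms(3) linked_edge by blast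
  have le: "degree E x \<le> degree ?E x" for x using degree_insert[OF assms(1) new] by simp
  have "Min (degree E ` e) \<le> Min (degree ?E ` e)" if e: "e \<in> E" for e
  proof -
    obtain x y where "e = {x, y}" using forest_pair[OF assms(2) e] by blast
    then show ?thesis using le[of x] le[of y] by (auto simp: min_def)
  qed
  then have "degree_potential E \<le> (\<Sum>e\<in>E. Min (degree ?E ` e))"
    unfolding degree_potential_def by (rule sum_mono)
  moreover have "min (degree E u) (degree E v) \<le> Min (degree ?E ` {u, v})"
    using le[of u] le[of v] by (auto simp: min_def)
  moreover have "degree_potential ?E = Min (degree ?E ` {u, v}) + (\<Sum>e\<in>E. Min (degree ?E ` e))"
    unfolding degree_potential_def using assms(1) new by (rule sum.insert)
  ultimately show ?thesis by linarith
qed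

section \<open>Potential for merges into large trees\<close>

text \<open>The term \<open>16 / \<surd>(s \<Delta>)\<close> makes the potential of \<open>s\<close> vertices increase by at least \<open>4 \<surd>(s / \<Delta>)\<close> when
  their tree doubles its size, which is the bound of \<open>path_weight_le_sqrt\<close>; the constant \<open>17\<close> leaves a
  jump of at least \<open>1 / \<Delta>\<close> when a tree exceeds \<open>\<Delta>\<close> edges.\<close>

definition size_potential :: "nat \<Rightarrow> nat \<Rightarrow> real" where
  "size_potential \<Delta> s = (if s \<le> \<Delta> + 1 then 0 else 17 / \<Delta> - 16 / sqrt (s * \<Delta>))"

lemma size_potential_le: "size_potential \<Delta> s \<le> 17 / \<Delta>"
  by (simp add: size_potential_def)

lemma size_potential_ge:
  assumes "\<Delta> + 1 < s" "0 < \<Delta>"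
  shows "1 / \<Delta> \<le> size_potential \<Delta> s"
proof -
  have "real \<Delta> * real \<Delta> \<le> real s * real \<Delta>" using assms by (intro mult_right_mono) auto
  then have "real \<Delta> \<le> sqrt (s * \<Delta>)" by (intro real_le_rsqrt) (simp add: power2_eq_square)
  then have "16 / sqrt (s * \<Delta>) \<le> 16 / \<Delta>" using assms by (intro divide_left_mono) auto
  then show ?thesis using assms by (simp add: size_potential_def field_simps)
qed

lemma size_potential_mono:
  assumes "s \<le> t" "0 < \<Delta>"
  shows "size_potential \<Delta> s \<le> size_potential \<Delta> t"
proof (cases "s \<le> \<Delta> + 1")
  case True
  have "0 \<le> size_potential \<Delta> t"
  proof (cases "t \<le> \<Delta> + 1")
    case False
    then have "1 / \<Delta> \<le> size_potential \<Delta> t" using assms(2) by (intro size_potential_ge) auto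
    moreover have "0 \<le> 1 / real \<Delta>" by simp
    ultimately show ?thesis by linarith
  qed (simp add: size_potential_def)
  then show ?thesis using True by (simp add: size_potential_def)
next
  case False
  have "sqrt (s * \<Delta>) \<le> sqrt (t * \<Delta>)" using assms(1) by (intro real_sqrt_le_mono) (simp add: mult_right_mono)
  moreover have "0 < sqrt (s * \<Delta>)" using False assms(2) by simp
  ultimately have "16 / sqrt (t * \<Delta>) \<le> 16 / sqrt (s * \<Delta>)" by (intro divide_left_mono) auto
  then show ?thesis using False assms by (simp add: size_potential_def)
qed

lemma size_potential_double:
  assumes "\<Delta> + 1 < s" "0 < \<Delta>"
  shows "4 * sqrt (s / \<Delta>) \<le> s * (size_potential \<Delta> (2 * s) - size_potential \<Delta> s)"
proof -
  define r where "r = sqrt (s * \<Delta>)"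
  have r: "0 < r" using assms by (simp add: r_def)
  have "r * r = s * \<Delta>" unfolding r_def by simp
  \<comment> \<open>As 4 / 3 is below sqrt 2, doubling reduces 16 / r to at most 12 / r, and a gain
    of 4 / r per vertex remains.\<close>
  have "4 / 3 * r \<le> sqrt 2 * r" using r by (intro mult_right_mono real_le_rsqrt) (auto simp: power2_eq_square)
  also have "\<dots> = sqrt (2 * s * \<Delta>)" by (simp add: r_def real_sqrt_mult)
  finally have le: "4 / 3 * r \<le> sqrt (2 * s * \<Delta>)" .
  have "0 < sqrt (2 * s * \<Delta>)" using le r by linarith
  then have "16 / sqrt (2 * s * \<Delta>) \<le> 16 / (4 / 3 * r)"
    using le r by (intro divide_left_mono mult_pos_pos) auto
  also have "\<dots> = 12 / r" by simp
  finally have "16 / sqrt (2 * s * \<Delta>) \<le> 12 / r" .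
  moreover have "size_potential \<Delta> s = 17 / \<Delta> - 16 / r"
    "size_potential \<Delta> (2 * s) = 17 / \<Delta> - 16 / sqrt (2 * s * \<Delta>)"
    using assms by (simp_all add: size_potential_def r_def)
  moreover have "4 / r = 16 / r - 12 / r" by (simp flip: diff_divide_distrib)
  ultimately have diff: "4 / r \<le> size_potential \<Delta> (2 * s) - size_potential \<Delta> s" by linarith
  have "sqrt (s / \<Delta>) = s / r"
  proof -
    have "s / r = s * r / (r * r)" using r by simp
    also have "\<dots> = r / \<Delta>" using \<open>r * r = s * \<Delta>\<close> assms by simp
    also have "\<dots> = sqrt (s / \<Delta>)"
    proof -
      have "(r / \<Delta>)\<^sup>2 = s / \<Delta>" using assms \<open>r * r = s * \<Delta>\<close> by (simp add: power2_eq_square)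
      then show ?thesis using r by (intro real_sqrt_unique[symmetric]) auto
    qed
    finally show ?thesis by simp
  qed
  then have "4 * sqrt (s / \<Delta>) = s * (4 / r)" by simp
  also have "\<dots> \<le> s * (size_potential \<Delta> (2 * s) - size_potential \<Delta> s)" using diff by (intro mult_left_mono) auto
  finally show ?thesis .
qed

definition tree_potential :: "nat \<Rightarrow> nat set \<Rightarrow> nat set set \<Rightarrow> real" where
  "tree_potential \<Delta> V E = (\<Sum>x\<in>V. size_potential \<Delta> (card (tree E x)))"

text \<open>Isolated vertices have potential 0, and there are at most two other vertices per edge:
  34 = 2 * 17.\<close>

lemma tree_potential_le:
  assumes "finite E" "forest E" "finite V" "0 < \<Delta>"
  shows "tree_potential \<Delta> V E \<le> 34 * card E / \<Delta>"
proof -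
  have fin: "finite (\<Union>E)" using assms forest_finite_edge by blast
  have zero: "size_potential \<Delta> (card (tree E x)) = 0" if "x \<notin> \<Union>E" for x
  proof -
    have "y = x" if "linked E x y" for y
      using that \<open>x \<notin> \<Union>E\<close> by (induction rule: linked_induct) auto
    then have "tree E x = {x}" by (auto simp: tree_def)
    then show ?thesis by (simp add: size_potential_def)
  qed
  have "tree_potential \<Delta> V E = (\<Sum>x\<in>V \<inter> \<Union>E. size_potential \<Delta> (card (tree E x)))"
    unfolding tree_potential_def using assms(3) zero by (intro sum.mono_neutral_right) auto
  also have "\<dots> \<le> (\<Sum>x\<in>V \<inter> \<Union>E. 17 / \<Delta>)" using size_potential_le by (rule sum_mono)
  also have "\<dots> = card (V \<inter> \<Union>E) * (17 / \<Delta>)" by simp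
  also have "\<dots> \<le> (2 * card E) * (17 / \<Delta>)"
  proof (intro mult_right_mono)
    have "card (V \<inter> \<Union>E) \<le> card (\<Union>E)" using fin by (intro card_mono) auto
    also have "\<dots> \<le> (\<Sum>e\<in>E. card e)" by (rule card_Union_le_sum_card)
    also have "\<dots> \<le> (\<Sum>e\<in>E. 2)"
    proof (rule sum_mono)
      fix e assume "e \<in> E"
      then obtain x y where "e = {x, y}" using forest_pair[OF assms(2)] by blast
      then show "card e \<le> 2" by (simp add: card_insert_if)
    qed
    finally show "real (card (V \<inter> \<Union>E)) \<le> 2 * card E" by (simp flip: of_nat_mult)
  qed (use assms in simp)
  finally show ?thesis by simp
qed

text \<open>All vertices of the tree of \<open>v\<close> gain equally, and no vertex loses, as trees
  only grow.\<close>

lemma tree_potential_insert: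
  assumes "finite E" "forest E" "\<not> linked E u v" "finite V" "tree E v \<subseteq> V" "0 < \<Delta>"
  shows "card (tree E v) * (size_potential \<Delta> (card (tree E u) + card (tree E v)) - size_potential \<Delta> (card (tree E v)))
    \<le> tree_potential \<Delta> V (insert {u, v} E) - tree_potential \<Delta> V E"
proof -
  let ?E = "insert {u, v} E" and ?p = "\<lambda>E x. size_potential \<Delta> (card (tree E x))"
  have forest': "forest ?E" using assms(2,3) by (rule forest_insert)
  have fin: "finite (tree F x)" if "finite F" "forest F" for F x
    using that finite_tree forest_finite_edge by blast
  have mono: "?p E x \<le> ?p ?E x" for x
  proof (intro size_potential_mono card_mono assms)
    show "finite (tree ?E x)" using fin forest' assms(1) by simp
    show "tree E x \<subseteq> tree ?E x" using linked_mono[of E x _ ?E] by (auto simp: tree_def)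
  qed
  have disj: "tree E u \<inter> tree E v = {}"
  proof (rule equals0I)
    fix y assume "y \<in> tree E u \<inter> tree E v"
    then have "linked E u y" "linked E v y" by (simp_all add: tree_def)
    then show False using assms(3) linked_trans[OF _ linked_sym] by blast
  qed
  have joined: "card (tree ?E x) = card (tree E u) + card (tree E v)" if "x \<in> tree E v" for x
  proof -
    have "linked E x u \<or> linked E x v" using that linked_sym by (auto simp: tree_def)
    then have "tree ?E x = tree E u \<union> tree E v" by (rule tree_insert_joined)
    then show ?thesis using disj fin assms by (simp add: card_Un_disjoint)
  qed
  have same: "card (tree E x) = card (tree E v)" if "x \<in> tree E v" for x
    using that tree_eq[of E v x] by (simp add: tree_def)
  have "card (tree E v) * (size_potential \<Delta> (card (tree E u) + card (tree E v)) - size_potential \<Delta> (card (tree E v)))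
      = (\<Sum>x\<in>tree E v. size_potential \<Delta> (card (tree E u) + card (tree E v)) - size_potential \<Delta> (card (tree E v)))"
    by simp
  also have "\<dots> = (\<Sum>x\<in>tree E v. ?p ?E x - ?p E x)"
  proof (rule sum.cong[OF refl])
    fix x assume x: "x \<in> tree E v"
    show "size_potential \<Delta> (card (tree E u) + card (tree E v)) - size_potential \<Delta> (card (tree E v)) = ?p ?E x - ?p E x"
      unfolding joined[OF x] same[OF x] ..
  qed
  also have "\<dots> \<le> (\<Sum>x\<in>V. ?p ?E x - ?p E x)" using mono assms by (intro sum_mono2) auto
  finally show ?thesis by (simp add: tree_potential_def sum_subtractf)
qed

text \<open>Three regimes are paid for differently: two small trees by the degrees, a small tree
  attached to a large one by the jump of the potential at the threshold \<Delta>, two large trees by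
  the doubling of the smaller.\<close>

lemma path_weight_amortized:
  assumes E: "finite E" "forest E" and uv: "\<not> linked E u v" and V: "finite V" "tree E v \<subseteq> V"
    and deg: "\<And>x. x \<in> V \<Longrightarrow> degree E x \<le> \<Delta>" and \<Delta>: "3 \<le> \<Delta>" "\<Delta> \<le> \<kappa>" and att: "may_attach \<Delta> E u v"
  shows "path_weight (real \<kappa> - 1) E v / \<kappa> \<le>
    tree_potential \<Delta> V (insert {u, v} E) - tree_potential \<Delta> V E +
    (real (degree_potential (insert {u, v} E)) - degree_potential E + 2) / \<Delta>"
proof -
  let ?E = "insert {u, v} E" and ?w = "path_weight (real \<kappa> - 1) E v"
  let ?mu = "card (tree_edges E u)" and ?mv = "card (tree_edges E v)"
  let ?su = "card (tree E u)" and ?sv = "card (tree E v)"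
  let ?g = "?sv * (size_potential \<Delta> (?su + ?sv) - size_potential \<Delta> ?sv)"
  have su: "?su = ?mu + 1" and sv: "?sv = ?mv + 1" using card_tree[OF E] by blast+
  have b: "1 \<le> real \<kappa> - 1" "real \<Delta> - 1 \<le> real \<kappa> - 1" using \<Delta> by auto
  have gain: "?g \<le> tree_potential \<Delta> V ?E - tree_potential \<Delta> V E"
    using tree_potential_insert[OF E uv V, of \<Delta>] \<Delta> by simp
  have dgain: "real (degree_potential E) + min (degree E u) (degree E v) \<le> degree_potential ?E"
    using degree_potential_insert[OF E uv] by linarith
  have w0: "0 \<le> ?w" unfolding path_weight_def using b by (intro sum_nonneg) auto
  have \<kappa>\<Delta>: "x / \<kappa> \<le> x / \<Delta>" if "0 \<le> x" for x :: real using that \<Delta> by (intro divide_left_mono) auto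
  show ?thesis
  proof (cases "?mu \<le> \<Delta> \<and> ?mv \<le> \<Delta>")
    case True
    then have d: "degree E v \<le> degree E u" using att by (simp add: may_attach_def)
    have "0 \<le> ?g" using size_potential_mono[of ?sv "?su + ?sv" \<Delta>] \<Delta> by simp
    have "?w \<le> degree E v + ?mv / (real \<kappa> - 1)" by (rule path_weight_le_degree[OF E b(1)])
    \<comment> \<open>The vertices beyond the neighbours of \<open>v\<close> weigh at most \<Delta>
      / (\<Delta> - 1), the source of the additive 2.\<close>
    also have "?mv / (real \<kappa> - 1) \<le> \<Delta> / (real \<Delta> - 1)" using True b \<Delta> by (intro frac_le) auto
    also have "\<dots> \<le> 2" using \<Delta> by (simp add: divide_le_eq)
    finally have "?w / \<Delta> \<le> (degree E v + 2) / \<Delta>" by (intro divide_right_mono) auto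
    also have "\<dots> \<le> (real (degree_potential ?E) - degree_potential E + 2) / \<Delta>"
      using dgain d by (intro divide_right_mono) auto
    finally show ?thesis using \<kappa>\<Delta>[OF w0] gain \<open>0 \<le> ?g\<close> by linarith
  next
    case False
    then have le: "?mv \<le> ?mu" using att by (simp add: may_attach_def split: if_splits)
    then have big: "\<Delta> < ?mu" using False by linarith
    have "?w / \<Delta> \<le> ?g"
    proof (cases "?mv \<le> \<Delta>")
      case True
      have "?w \<le> ?mv" by (rule path_weight_le_edges[OF E b(1)])
      then have "?w / \<Delta> \<le> ?sv / \<Delta>" using sv by (intro divide_right_mono) auto
      also have "\<dots> = ?sv * (1 / \<Delta>)" by simp
      \<comment> \<open>Each vertex of the tree of \<open>v\<close> rises from potential 0 to at
        least 1 / \<Delta>.\<close>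
      also have "\<dots> \<le> ?sv * size_potential \<Delta> (?su + ?sv)"
        using big su \<Delta> by (intro mult_left_mono size_potential_ge) auto
      also have "size_potential \<Delta> ?sv = 0" using True sv by (simp add: size_potential_def)
      then have "?sv * size_potential \<Delta> (?su + ?sv) = ?g" by simp
      finally show ?thesis .
    next
      case False
      have "?w \<le> 4 * real \<Delta> * sqrt (?mv / \<Delta>)"
        using deg V \<Delta>(1) b(2) by (intro path_weight_le_sqrt[OF E]) auto
      then have "?w / \<Delta> \<le> 4 * real \<Delta> * sqrt (?mv / \<Delta>) / \<Delta>" by (rule divide_right_mono) simp
      also have "\<dots> = 4 * sqrt (?mv / \<Delta>)" using \<Delta> by simp
      also have "\<dots> \<le> 4 * sqrt (?sv / \<Delta>)" using sv
        by (intro mult_left_mono real_sqrt_le_mono divide_right_mono) auto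
      also have "\<dots> \<le> ?sv * (size_potential \<Delta> (2 * ?sv) - size_potential \<Delta> ?sv)"
        using False sv \<Delta> by (intro size_potential_double) auto
      \<comment> \<open>The tree of \<open>u\<close> is at least as large, so the joined tree has at
        least twice the size.\<close>
      also have "\<dots> \<le> ?g"
        using le su sv \<Delta> by (intro mult_left_mono diff_right_mono size_potential_mono) auto
      finally show ?thesis .
    qed
    moreover have "0 \<le> (real (degree_potential ?E) - degree_potential E + 2) / \<Delta>" using dgain by simp
    ultimately show ?thesis using \<kappa>\<Delta>[OF w0] gain by linarith
  qed
qed

section \<open>Total recourse\<close>

lemma expectation_bind_pmf_finite:
  fixes h :: "'b \<Rightarrow> real"
  assumes "finite (set_pmf p)" "\<And>x. x \<in> set_pmf p \<Longrightarrow> finite (set_pmf (f x))"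
  shows "measure_pmf.expectation (p \<bind> f) h = measure_pmf.expectation p (\<lambda>x. measure_pmf.expectation (f x) h)"
proof -
  have "measure_pmf.expectation (p \<bind> f) h =
      (\<Sum>x\<in>set_pmf p. pmf p x *\<^sub>R measure_pmf.expectation (f x) h)"
    using assms by (intro pmf_expectation_bind) auto
  also have "\<dots> = measure_pmf.expectation p (\<lambda>x. measure_pmf.expectation (f x) h)"
    using assms(1) by (intro integral_measure_pmf[symmetric]) auto
  finally show ?thesis .
qed

lemma name_endpoints_cases:
  obtains u v where "name_endpoints \<Delta> E b (x, y) = (u, v)" "(u, v) = (x, y) \<or> (u, v) = (y, x)"
    "may_attach \<Delta> E u v"
proof -
  have "may_attach \<Delta> E x y \<or> may_attach \<Delta> E y x" by (auto simp: may_attach_def)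
  then show ?thesis
    using that by (cases "may_attach \<Delta> E x y \<and> (may_attach \<Delta> E y x \<longrightarrow> b)") (auto simp: name_endpoints_def)
qed

text \<open>The invariant of a run. Only the marginal on states is prescribed, as the recourse so
  far may depend on the coloring. The root set is a constant because rerooting looks at the edges
  alone. Finite support makes all expectations finite sums.\<close>

definition uniform_state ::
  "nat \<Rightarrow> nat set \<Rightarrow> nat set set \<Rightarrow> nat set \<Rightarrow> (state \<times> nat) pmf \<Rightarrow> bool" where
  "uniform_state \<kappa> V E R D \<longleftrightarrow> (\<forall>x\<in>V. \<exists>r\<in>R. linked E x r) \<and> colorings \<kappa> E \<noteq> {} \<and>
     finite (set_pmf D) \<and> map_pmf fst D = map_pmf (Pair R) (pmf_of_set (colorings \<kappa> E))"

lemma uniform_state_Nil: "uniform_state \<kappa> V {} V (return_pmf ((V, Map.empty), 0))"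
proof -
  have "colorings \<kappa> {} = {Map.empty}" by (auto simp: colorings_def)
  then show ?thesis by (auto simp: uniform_state_def pmf_of_set_singleton intro: linked_refl)
qed

lemma dist_maint_snoc:
  "dist_maint \<Delta> \<kappa> tie V (us @ [xy]) = dist_maint \<Delta> \<kappa> tie V us \<bind> (\<lambda>(s, n).
     insert_edge \<Delta> \<kappa> (tie (rev us) xy) s xy \<bind> (\<lambda>s'. return_pmf (s', n + recourse (snd s) (snd s'))))"
  by (simp add: dist_maint_def)

text \<open>Rerooting at \<open>v\<close> and then demoting \<open>v\<close> removes exactly the
  roots in \<open>tree E v\<close>; vertices that lose their root reach the root of \<open>u\<close>
  over the new edge.\<close>

lemma attachment_reroot:
  assumes E: "finite E" "forest E" "\<not> linked E u v" and u: "u \<in> V"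
    and R: "\<forall>x\<in>V. \<exists>r\<in>R. linked E x r"
  shows "attachment E (reroot E v R - {v}) u v"
    and "\<forall>x\<in>V. \<exists>r\<in>reroot E v R - {v}. linked (insert {u, v} E) x r"
proof -
  let ?R = "reroot E v R - {v}" and ?E = "insert {u, v} E"
  have R': "?R = R - tree E v" by (auto simp: reroot_def)
  obtain r where r: "r \<in> R" "linked E u r" using R u by blast
  have "r \<notin> tree E v"
    using r(2) E(3) linked_trans[OF r(2) linked_sym, of v] by (auto simp: tree_def)
  then have r': "r \<in> ?R" using r(1) R' by simp
  show "attachment E ?R u v"
    using E r' r(2) R' by unfold_locales auto
  have up: "linked ?E a b" if "linked E a b" for a b using that by (rule linked_mono) auto
  show "\<forall>x\<in>V. \<exists>r\<in>?R. linked ?E x r"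
  proof
    fix x assume "x \<in> V"
    then obtain s where s: "s \<in> R" "linked E x s" using R by blast
    show "\<exists>r\<in>?R. linked ?E x r"
    proof (cases "s \<in> tree E v")
      case False
      then show ?thesis using s R' up by blast
    next
      case True
      then have "linked E s v" using linked_sym by (simp add: tree_def)
      then have "linked ?E x v" using up linked_trans[OF s(2)] by blast
      moreover have "linked ?E v u" by (rule linked_edge) (simp add: insert_commute)
      ultimately have "linked ?E x u" by (rule linked_trans)
      then have "linked ?E x r" using up[OF r(2)] by (rule linked_trans)
      then show ?thesis using r' by blast
    qed
  qed
qed

text \<open>The cost of the step depends on the state and not on the recourse so far. Its
  expectation can therefore be taken under the uniform marginal and added by linearity.\<close>

lemma uniform_state_step:
  assumes D: "uniform_state \<kappa> V E R D" and E: "finite E" "forest E" "\<not> linked E u v"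
    and uv: "u \<in> V" "name_endpoints \<Delta> E b xy = (u, v)"
    and deg: "degree E u < \<kappa>" "degree E v < \<kappa>"
  defines "D' \<equiv> D \<bind> (\<lambda>(s, n). insert_edge \<Delta> \<kappa> b s xy \<bind>
      (\<lambda>s'. return_pmf (s', n + recourse (snd s) (snd s'))))"
  shows "uniform_state \<kappa> V (insert {u, v} E) (reroot E v R - {v}) D'"
    and "measure_pmf.expectation D' (\<lambda>(s, n). real n) =
      measure_pmf.expectation D (\<lambda>(s, n). real n) + random_attachment.expected_recourse E u v \<kappa>"
    and "random_attachment E (reroot E v R - {v}) u v \<kappa>"
proof -
  let ?R = "reroot E v R - {v}" and ?C = "colorings \<kappa> E"
  have att: "attachment E ?R u v" and roots: "\<forall>x\<in>V. \<exists>r\<in>?R. linked (insert {u, v} E) x r"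
    using attachment_reroot[OF E uv(1), of R] D by (auto simp: uniform_state_def)
  show ra: "random_attachment E ?R u v \<kappa>"
    using att deg by (simp add: random_attachment_def random_attachment_axioms_def)
  interpret random_attachment E ?R u v \<kappa> by (rule ra)
  have ne: "?C \<noteq> {}" and finD: "finite (set_pmf D)"
    and marginal: "map_pmf fst D = map_pmf (Pair R) (pmf_of_set ?C)"
    using D by (auto simp: uniform_state_def)
  have finC: "finite ?C" using finite_colorings[OF E(1)] .
  have ins: "insert_edge \<Delta> \<kappa> b (R, col) xy = map_pmf (Pair ?R) (attach \<kappa> col)" if "col \<in> ?C" for col
    using att refl uv(2) that deg(2) by (rule insert_edge_attach)
  have "fst ` set_pmf D = Pair R ` ?C"
    using arg_cong[OF marginal, of set_pmf] ne finC by simp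
  then have supp: "\<exists>col\<in>?C. fst x = (R, col)" if "x \<in> set_pmf D" for x using that by blast
  have fin_ins: "finite (set_pmf (insert_edge \<Delta> \<kappa> b (fst x) xy))" if "x \<in> set_pmf D" for x
    using supp[OF that] ins finite_attach by auto
  have fin_step: "finite (set_pmf ((\<lambda>(s, n). insert_edge \<Delta> \<kappa> b s xy \<bind>
      (\<lambda>s'. return_pmf (s', n + recourse (snd s) (snd s')))) x))" if "x \<in> set_pmf D" for x
    using fin_ins[OF that] by (simp add: case_prod_beta)
  have "map_pmf fst D' = D \<bind> (\<lambda>x. insert_edge \<Delta> \<kappa> b (fst x) xy)"
    unfolding D'_def by (simp add: map_bind_pmf case_prod_beta bind_return_pmf')
  also have "\<dots> = map_pmf fst D \<bind> (\<lambda>s. insert_edge \<Delta> \<kappa> b s xy)" by (simp add: bind_map_pmf)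
  also have "\<dots> = pmf_of_set ?C \<bind> (\<lambda>col. insert_edge \<Delta> \<kappa> b (R, col) xy)"
    by (simp add: marginal bind_map_pmf)
  also have "\<dots> = pmf_of_set ?C \<bind> (\<lambda>col. map_pmf (Pair ?R) (attach \<kappa> col))"
    using ne finC ins by (intro bind_pmf_cong refl) auto
  also have "\<dots> = map_pmf (Pair ?R) (pmf_of_set ?C \<bind> attach \<kappa>)" by (simp add: map_bind_pmf)
  also have "pmf_of_set ?C \<bind> attach \<kappa> = pmf_of_set (colorings \<kappa> E')" by (rule attach_uniform[OF ne])
  finally have "map_pmf fst D' = map_pmf (Pair ?R) (pmf_of_set (colorings \<kappa> E'))" .
  moreover have "finite (set_pmf D')"
    unfolding D'_def set_bind_pmf using finD fin_step by blast
  ultimately show "uniform_state \<kappa> V E' ?R D'"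
    using roots colorings_insert_nonempty[OF ne] by (simp add: uniform_state_def)
  define cost where "cost = (\<lambda>s. measure_pmf.expectation (insert_edge \<Delta> \<kappa> b s xy) (\<lambda>s'. real (recourse (snd s) (snd s'))))"
  have inner: "measure_pmf.expectation (insert_edge \<Delta> \<kappa> b s xy \<bind>
      (\<lambda>s'. return_pmf (s', n + recourse (snd s) (snd s')))) (\<lambda>(s, n). real n) = real n + cost s"
    if "(s, n) \<in> set_pmf D" for s n
  proof -
    have fin: "finite (set_pmf (insert_edge \<Delta> \<kappa> b s xy))" using fin_ins[OF that] by simp
    have "measure_pmf.expectation (insert_edge \<Delta> \<kappa> b s xy \<bind>
      (\<lambda>s'. return_pmf (s', n + recourse (snd s) (snd s')))) (\<lambda>(s, n). real n) =
      measure_pmf.expectation (insert_edge \<Delta> \<kappa> b s xy) (\<lambda>s'. real n + real (recourse (snd s) (snd s')))"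
      using fin by (simp add: map_pmf_def[symmetric])
    also have "\<dots> = real n + cost s"
      unfolding cost_def using integrable_measure_pmf_finite[OF fin] by (subst Bochner_Integration.integral_add) simp_all
    finally show ?thesis .
  qed
  have "measure_pmf.expectation D' (\<lambda>(s, n). real n) = measure_pmf.expectation D (\<lambda>x.
     measure_pmf.expectation ((\<lambda>(s, n). insert_edge \<Delta> \<kappa> b s xy \<bind>
      (\<lambda>s'. return_pmf (s', n + recourse (snd s) (snd s')))) x) (\<lambda>(s, n). real n))"
    unfolding D'_def using finD fin_step by (rule expectation_bind_pmf_finite)
  also have "\<dots> = measure_pmf.expectation D (\<lambda>x. real (snd x) + cost (fst x))"
    using inner by (intro integral_cong_AE) (auto simp: AE_measure_pmf_iff)
  also have "\<dots> = measure_pmf.expectation D (\<lambda>x. real (snd x)) + measure_pmf.expectation D (\<lambda>x. cost (fst x))"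
    using integrable_measure_pmf_finite[OF finD] by (intro Bochner_Integration.integral_add)
  also have "measure_pmf.expectation D (\<lambda>x. cost (fst x)) = measure_pmf.expectation (map_pmf fst D) cost" by simp
  also have "\<dots> = measure_pmf.expectation (pmf_of_set ?C) (\<lambda>col. cost (R, col))" by (simp add: marginal)
  also have "\<dots> = measure_pmf.expectation (pmf_of_set ?C) (\<lambda>col.
      measure_pmf.expectation (map_pmf (Pair col) (attach \<kappa> col)) (\<lambda>(col, c). real (recourse col c)))"
    using ne finC ins by (intro integral_cong_AE) (auto simp: AE_measure_pmf_iff cost_def)
  also have "\<dots> = expected_recourse"
    unfolding expected_recourse_def transition_def using ne finC finite_attach
    by (intro expectation_bind_pmf_finite[symmetric]) auto
  finally show "measure_pmf.expectation D' (\<lambda>(s, n). real n) =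
      measure_pmf.expectation D (\<lambda>(s, n). real n) + expected_recourse"
    by (simp add: case_prod_unfold)
qed

definition total_recourse :: "nat \<Rightarrow> nat \<Rightarrow> tie_rule \<Rightarrow> nat set \<Rightarrow> (nat \<times> nat) list \<Rightarrow> real" where
  "total_recourse \<Delta> \<kappa> tie V us =
     measure_pmf.expectation (dist_maint \<Delta> \<kappa> tie V us) (\<lambda>(s, n). real n)"

lemma total_recourse_Nil [simp]: "total_recourse \<Delta> \<kappa> tie V [] = 0"
  by (simp add: total_recourse_def dist_maint_def)

lemma dist_maint_uniform:
  assumes "insertion_sequence V \<Delta> us" "\<Delta> \<le> \<kappa>"
  shows "\<exists>R. uniform_state \<kappa> V (edges_of us) R (dist_maint \<Delta> \<kappa> tie V us)"
  using assms(1)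
proof (induction us rule: rev_induct)
  case Nil
  show ?case using uniform_state_Nil by (auto simp: dist_maint_def)
next
  case (snoc xy us)
  obtain x y where xy: "xy = (x, y)" by (cases xy)
  let ?E = "edges_of us"
  have seq: "insertion_sequence V \<Delta> us" "x \<in> V" "y \<in> V" "\<not> linked ?E x y"
    and deg: "\<forall>z\<in>V. degree (insert {x, y} ?E) z \<le> \<Delta>"
    using snoc.prems by (auto simp: xy insertion_sequence_snoc)
  obtain R where R: "uniform_state \<kappa> V ?E R (dist_maint \<Delta> \<kappa> tie V us)" using snoc.IH[OF seq(1)] by blast
  obtain u v where uv: "name_endpoints \<Delta> ?E (tie (rev us) xy) (x, y) = (u, v)"
    "(u, v) = (x, y) \<or> (u, v) = (y, x)" by (rule name_endpoints_cases)
  have eq: "{u, v} = {x, y}" using uv(2) by auto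
  have nl: "\<not> linked ?E u v" using uv(2) seq(4) linked_sym by auto
  have new: "{x, y} \<notin> ?E" using seq(4) linked_edge by blast
  \<comment> \<open>Before the insertion each end has one edge less, so the bound \<Delta> \<le>
    \<kappa> becomes strict and a color is free.\<close>
  have dlt: "degree ?E z < \<kappa>" if "z \<in> {x, y}" for z
    using degree_insert[OF finite_edges_of new, of z] deg that seq assms(2) by force
  have "uniform_state \<kappa> V (insert {u, v} ?E) (reroot ?E v R - {v}) (dist_maint \<Delta> \<kappa> tie V (us @ [xy]))"
    unfolding dist_maint_snoc
    using insertion_sequence_forest(1)[OF seq(1)] nl uv seq dlt[of u] dlt[of v]
    by (intro uniform_state_step(1)[OF R finite_edges_of]) (auto simp: xy)
  then show ?case using xy eq by auto
qed

lemma total_recourse_snoc: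
  assumes seq: "insertion_sequence V \<Delta> (us @ [(x, y)])" and \<Delta>: "\<Delta> \<le> \<kappa>"
  obtains u v R where "(u, v) = (x, y) \<or> (u, v) = (y, x)" "may_attach \<Delta> (edges_of us) u v"
    "random_attachment (edges_of us) R u v \<kappa>" "colorings \<kappa> (edges_of us) \<noteq> {}"
    "total_recourse \<Delta> \<kappa> tie V (us @ [(x, y)]) =
      total_recourse \<Delta> \<kappa> tie V us + random_attachment.expected_recourse (edges_of us) u v \<kappa>"
proof -
  let ?E = "edges_of us"
  have seq': "insertion_sequence V \<Delta> us" "x \<in> V" "y \<in> V" "\<not> linked ?E x y"
    and deg: "\<forall>z\<in>V. degree (insert {x, y} ?E) z \<le> \<Delta>"
    using seq by (auto simp: insertion_sequence_snoc)
  obtain R where R: "uniform_state \<kappa> V ?E R (dist_maint \<Delta> \<kappa> tie V us)"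
    using dist_maint_uniform[OF seq'(1) \<Delta>] by blast
  obtain u v where uv: "name_endpoints \<Delta> ?E (tie (rev us) (x, y)) (x, y) = (u, v)"
    "(u, v) = (x, y) \<or> (u, v) = (y, x)" "may_attach \<Delta> ?E u v" by (rule name_endpoints_cases)
  have nl: "\<not> linked ?E u v" using uv(2) seq'(4) linked_sym by auto
  have new: "{x, y} \<notin> ?E" using seq'(4) linked_edge by blast
  have dlt: "degree ?E z < \<kappa>" if "z \<in> {x, y}" for z
    using degree_insert[OF finite_edges_of new, of z] deg that seq' \<Delta> by force
  have "u \<in> V" "degree ?E u < \<kappa>" "degree ?E v < \<kappa>" using uv(2) seq' dlt[of u] dlt[of v] by auto
  note step = uniform_state_step[OF R finite_edges_of insertion_sequence_forest(1)[OF seq'(1)] nl this(1) uv(1) this(2,3)]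
  show ?thesis
    using that[OF uv(2,3) step(3)] step(2) R
    by (simp add: total_recourse_def dist_maint_snoc uniform_state_def)
qed

text \<open>Either endpoint may become the child, depending on the naming rule and on ties, so only
  the minimum of the degrees is certain.\<close>

lemma total_recourse_snoc_ge:
  assumes "insertion_sequence V \<Delta> (us @ [(x, y)])" "\<Delta> \<le> \<kappa>"
  shows "total_recourse \<Delta> \<kappa> tie V us + min (degree (edges_of us) x) (degree (edges_of us) y) / \<kappa> \<le>
    total_recourse \<Delta> \<kappa> tie V (us @ [(x, y)])"
proof -
  obtain u v R where uv: "(u, v) = (x, y) \<or> (u, v) = (y, x)"
    "random_attachment (edges_of us) R u v \<kappa>" "colorings \<kappa> (edges_of us) \<noteq> {}"
    and eq: "total_recourse \<Delta> \<kappa> tie V (us @ [(x, y)]) =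
      total_recourse \<Delta> \<kappa> tie V us + random_attachment.expected_recourse (edges_of us) u v \<kappa>"
    using total_recourse_snoc[OF assms] by metis
  have "min (degree (edges_of us) x) (degree (edges_of us) y) / \<kappa> \<le> degree (edges_of us) v / \<kappa>"
    using uv(1) by (intro divide_right_mono) auto
  also have "\<dots> \<le> random_attachment.expected_recourse (edges_of us) u v \<kappa>"
    by (rule random_attachment.expected_recourse_ge[OF uv(2,3)])
  finally show ?thesis using eq by simp
qed

text \<open>The amortized bounds of the insertions telescope, and both potentials vanish on the
  empty forest.\<close>

lemma total_recourse_le:
  assumes "insertion_sequence V \<Delta> us" "finite V" "3 \<le> \<Delta>" "\<Delta> \<le> \<kappa>"
  shows "total_recourse \<Delta> \<kappa> tie V us \<le> tree_potential \<Delta> V (edges_of us) +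
    (degree_potential (edges_of us) + 2 * length us) / \<Delta>"
  using assms(1)
proof (induction us rule: rev_induct)
  case Nil
  have "tree {} x = {x}" for x
  proof -
    have "y = x" if "linked {} x y" for y using that by (induction rule: linked_induct) auto
    then show ?thesis by (auto simp: tree_def)
  qed
  then show ?case by (simp add: tree_potential_def size_potential_def degree_potential_def)
next
  case (snoc xy us)
  obtain x y where xy: "xy = (x, y)" by (cases xy)
  let ?E = "edges_of us"
  have seq: "insertion_sequence V \<Delta> us" "x \<in> V" "y \<in> V" "\<not> linked ?E x y"
    using snoc.prems by (auto simp: xy insertion_sequence_snoc)
  note E = insertion_sequence_forest[OF seq(1)]
  obtain u v R where uv: "(u, v) = (x, y) \<or> (u, v) = (y, x)" "may_attach \<Delta> ?E u v"
    "random_attachment ?E R u v \<kappa>" "colorings \<kappa> ?E \<noteq> {}"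
    and eq: "total_recourse \<Delta> \<kappa> tie V (us @ [(x, y)]) =
      total_recourse \<Delta> \<kappa> tie V us + random_attachment.expected_recourse ?E u v \<kappa>"
    using total_recourse_snoc[OF snoc.prems[unfolded xy] assms(4)] by metis
  have ins: "insert {x, y} ?E = insert {u, v} ?E" using uv(1) by auto
  have nl: "\<not> linked ?E u v" using uv(1) seq(4) linked_sym by auto
  have "v \<in> V" using uv(1) seq by auto
  have "z \<in> V" if "linked ?E v z" for z
    using that \<open>v \<in> V\<close> E(2) by (induction rule: linked_induct) auto
  then have sub: "tree ?E v \<subseteq> V" by (auto simp: tree_def)
  have "random_attachment.expected_recourse ?E u v \<kappa> \<le> path_weight (real \<kappa> - 1) ?E v / \<kappa>"
    unfolding path_weight_def using random_attachment.expected_recourse_le[OF uv(3,4)] assms by simp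
  also have "\<dots> \<le> tree_potential \<Delta> V (insert {u, v} ?E) - tree_potential \<Delta> V ?E +
    (real (degree_potential (insert {u, v} ?E)) - degree_potential ?E + 2) / \<Delta>"
    using E nl assms sub uv(2) by (intro path_weight_amortized) auto
  finally have "total_recourse \<Delta> \<kappa> tie V (us @ [(x, y)]) \<le>
     tree_potential \<Delta> V ?E + (degree_potential ?E + 2 * length us) / \<Delta> +
     (tree_potential \<Delta> V (insert {u, v} ?E) - tree_potential \<Delta> V ?E +
    (real (degree_potential (insert {u, v} ?E)) - degree_potential ?E + 2) / \<Delta>)"
    using eq snoc.IH[OF seq(1)] by linarith
  then show ?case by (simp add: xy ins add_divide_distrib diff_divide_distrib)
qed

lemma expected_amortized_recourse_le:
  assumes "insertion_sequence V \<Delta> us" "finite V" "3 \<le> \<Delta>" "\<Delta> \<le> \<kappa>"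
  shows "expected_amortized_recourse \<Delta> \<kappa> tie V us \<le> 38 / \<Delta>"
proof (cases "us = []")
  case True
  then show ?thesis by (simp add: expected_amortized_recourse_def)
next
  case False
  let ?E = "edges_of us"
  note E = insertion_sequence_forest[OF assms(1)]
  have card: "card ?E \<le> length us"
    unfolding edges_of_def using card_image_le[of "set us"] card_length[of us] by (meson finite_set le_trans)
  have "total_recourse \<Delta> \<kappa> tie V us \<le> tree_potential \<Delta> V ?E + (degree_potential ?E + 2 * length us) / \<Delta>"
    by (rule total_recourse_le[OF assms])
  also have "\<dots> \<le> 34 * card ?E / \<Delta> + (2 * card ?E + 2 * length us) / \<Delta>"
    using tree_potential_le[of ?E V \<Delta>] degree_potential_le[of ?E] E(1) assms
    by (intro add_mono divide_right_mono) auto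
  also have "\<dots> \<le> 34 * length us / \<Delta> + (2 * length us + 2 * length us) / \<Delta>"
    using card by (intro add_mono divide_right_mono) auto
  \<comment> \<open>34 comes from the large trees, 2 from the degree potential and 2 from the
    additive term of each insertion.\<close>
  also have "\<dots> = 38 / \<Delta> * length us" by (simp add: field_simps)
  finally show ?thesis
    using False by (simp add: expected_amortized_recourse_def total_recourse_def[symmetric] pos_divide_le_eq)
qed

section \<open>Insertion sequences for the lower bound\<close>

lemma isolated_not_linked:
  assumes "\<forall>e\<in>E. a \<notin> e" "a \<noteq> b"
  shows "\<not> linked E a b"
proof
  assume "linked E a b"
  then have "b = a" by (induction rule: linked_induct) (use assms(1) in auto)
  then show False using assms(2) by simp
qed

lemma degree_isolated: "\<forall>e\<in>E. a \<notin> e \<Longrightarrow> degree E a = 0"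
  unfolding degree_def by (metis (no_types, lifting) card.empty empty_Collect_eq)

text \<open>Joining two single edges: both endpoints have degree 1, so the color of the new edge
  clashes with probability \<open>1 / \<kappa>\<close> however the tie is broken.\<close>

lemma block_recourse:
  assumes seq: "insertion_sequence V \<Delta> us" and \<Delta>: "3 \<le> \<Delta>" "\<Delta> \<le> \<kappa>"
    and V: "{a, b, c, d} \<subseteq> V" and dist: "distinct [a, b, c, d]"
    and fresh: "\<forall>e\<in>edges_of us. e \<inter> {a, b, c, d} = {}"
  shows "insertion_sequence V \<Delta> (us @ [(a, b), (c, d), (b, c)])"
    and "total_recourse \<Delta> \<kappa> tie V us + 1 / \<kappa> \<le> total_recourse \<Delta> \<kappa> tie V (us @ [(a, b), (c, d), (b, c)])"
proof -
  let ?E = "edges_of us"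
  let ?E1 = "insert {a, b} ?E"
  let ?E2 = "insert {c, d} ?E1"
  have iso: "\<forall>e\<in>?E. a \<notin> e" "\<forall>e\<in>?E. b \<notin> e" "\<forall>e\<in>?E. c \<notin> e" "\<forall>e\<in>?E. d \<notin> e" using fresh by auto
  have iso1: "\<forall>e\<in>?E1. c \<notin> e" "\<forall>e\<in>?E1. d \<notin> e" using iso dist by auto
  have nl: "\<not> linked ?E a b" "\<not> linked ?E1 c d"
    using isolated_not_linked[OF iso(1)] isolated_not_linked[OF iso1(1)] dist by auto
  have "\<not> linked ?E1 c b" "\<not> linked ?E1 d b"
    using isolated_not_linked[OF iso1(1)] isolated_not_linked[OF iso1(2)] dist by auto
  then have "\<not> linked ?E1 b c" "\<not> linked ?E1 b d" using linked_sym[of ?E1 b] by metis+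
  then have nl2: "\<not> linked ?E2 b c" using linked_insertD[of c d ?E1 b c] by blast
  have new: "{a, b} \<notin> ?E" "{c, d} \<notin> ?E1" "{b, c} \<notin> ?E2"
    using nl nl2 linked_edge[of a b ?E] linked_edge[of c d ?E1] linked_edge[of b c ?E2] by metis+
  have deg: "degree ?E z \<le> \<Delta>" if "z \<in> V" for z by (rule insertion_sequence_forest(3)[OF seq that])
  have d1: "degree ?E1 z = degree ?E z + (if z \<in> {a, b} then 1 else 0)" for z
    using degree_insert[OF _ new(1)] by simp
  have d2: "degree ?E2 z = degree ?E1 z + (if z \<in> {c, d} then 1 else 0)" for z
    using degree_insert[OF _ new(2)] by simp
  have d3: "degree (insert {b, c} ?E2) z = degree ?E2 z + (if z \<in> {b, c} then 1 else 0)" for z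
    using degree_insert[OF _ new(3)] by simp
  have zero: "degree ?E a = 0" "degree ?E b = 0" "degree ?E c = 0" "degree ?E d = 0"
    using iso by (auto intro: degree_isolated)
  have le: "degree ?E1 z \<le> \<Delta>" "degree ?E2 z \<le> \<Delta>" "degree (insert {b, c} ?E2) z \<le> \<Delta>" if "z \<in> V" for z
    using deg[OF that] zero \<Delta>(1) unfolding d3 d2 d1 by auto
  have edges: "edges_of (us @ [(a, b), (c, d)]) = ?E2" by (auto simp: edges_of_def)
  have s1: "insertion_sequence V \<Delta> (us @ [(a, b)])"
    using seq V nl le by (simp add: insertion_sequence_snoc)
  have s2: "insertion_sequence V \<Delta> ((us @ [(a, b)]) @ [(c, d)])"
    by (subst insertion_sequence_snoc) (use s1 V nl le in simp)
  have s3: "insertion_sequence V \<Delta> (((us @ [(a, b)]) @ [(c, d)]) @ [(b, c)])"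
    by (subst insertion_sequence_snoc) (use s2 V nl2 le in \<open>simp add: edges\<close>)
  then show "insertion_sequence V \<Delta> (us @ [(a, b), (c, d), (b, c)])" by simp
  have nonneg: "total_recourse \<Delta> \<kappa> tie V ws \<le> total_recourse \<Delta> \<kappa> tie V (ws @ [(x, y)])"
    if "insertion_sequence V \<Delta> (ws @ [(x, y)])" for ws x y
  proof -
    have "0 \<le> real (min (degree (edges_of ws) x) (degree (edges_of ws) y)) / \<kappa>" by simp
    then show ?thesis using total_recourse_snoc_ge[OF that \<Delta>(2), of tie] by linarith
  qed
  have "min (degree ?E2 b) (degree ?E2 c) = 1" using dist zero unfolding d2 d1 by auto
  then have "total_recourse \<Delta> \<kappa> tie V ((us @ [(a, b)]) @ [(c, d)]) + 1 / \<kappa> \<le>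
      total_recourse \<Delta> \<kappa> tie V (((us @ [(a, b)]) @ [(c, d)]) @ [(b, c)])"
    using total_recourse_snoc_ge[OF s3 \<Delta>(2), of tie] by (simp add: edges)
  then show "total_recourse \<Delta> \<kappa> tie V us + 1 / \<kappa> \<le> total_recourse \<Delta> \<kappa> tie V (us @ [(a, b), (c, d), (b, c)])"
    using nonneg[OF s1] nonneg[OF s2] by simp
qed

text \<open>Disjoint paths on four vertices with the middle edge inserted last, so that every third
  insertion joins two endpoints of degree 1.\<close>

definition blocks :: "nat \<Rightarrow> (nat \<times> nat) list" where
  "blocks k = concat (map (\<lambda>i. [(4 * i, 4 * i + 1), (4 * i + 2, 4 * i + 3), (4 * i + 1, 4 * i + 2)]) [0..<k])"

lemma blocks_Suc: "blocks (Suc k) =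
    blocks k @ [(4 * k, 4 * k + 1), (4 * k + 2, 4 * k + 3), (4 * k + 1, 4 * k + 2)]"
  by (simp add: blocks_def)

lemma length_blocks: "length (blocks k) = 3 * k"
  by (induction k) (simp_all add: blocks_Suc, simp add: blocks_def)

lemma edges_of_blocks: "\<Union>(edges_of (blocks k)) \<subseteq> {..<4 * k}"
  by (auto simp: edges_of_def blocks_def)

text \<open>The separate bound \<open>K\<close> keeps the vertex set unchanged during the induction
  on \<open>k\<close>.\<close>

lemma blocks_recourse:
  assumes "3 \<le> \<Delta>" "\<Delta> \<le> \<kappa>" "k \<le> K"
  shows "insertion_sequence {..<4 * K} \<Delta> (blocks k) \<and>
    k / \<kappa> \<le> total_recourse \<Delta> \<kappa> tie {..<4 * K} (blocks k)"
  using assms(3)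
proof (induction k)
  case 0
  show ?case by (simp add: blocks_def)
next
  case (Suc k)
  then have IH: "insertion_sequence {..<4 * K} \<Delta> (blocks k)"
    "k / \<kappa> \<le> total_recourse \<Delta> \<kappa> tie {..<4 * K} (blocks k)" by auto
  have fresh: "\<forall>e\<in>edges_of (blocks k). e \<inter> {4 * k, 4 * k + 1, 4 * k + 2, 4 * k + 3} = {}"
    using edges_of_blocks[of k] by fastforce
  have V: "{4 * k, 4 * k + 1, 4 * k + 2, 4 * k + 3} \<subseteq> {..<4 * K}" using Suc.prems by auto
  have step: "insertion_sequence {..<4 * K} \<Delta> (blocks (Suc k))"
    "total_recourse \<Delta> \<kappa> tie {..<4 * K} (blocks k) + 1 / \<kappa> \<le> total_recourse \<Delta> \<kappa> tie {..<4 * K} (blocks (Suc k))"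
    unfolding blocks_Suc
    using block_recourse(1)[OF IH(1) assms(1,2) V _ fresh]
      block_recourse(2)[OF IH(1) assms(1,2) V _ fresh, where tie = tie] by simp_all
  have "Suc k / \<kappa> = k / \<kappa> + 1 / \<kappa>" by (simp add: add_divide_distrib)
  then show ?case using step IH(2) by linarith
qed

lemma expected_amortized_recourse_ge:
  assumes "3 \<le> \<Delta>" "\<Delta> \<le> \<kappa>" "0 < K"
  shows "1 / (3 * real \<kappa>) \<le> expected_amortized_recourse \<Delta> \<kappa> tie {..<4 * K} (blocks K)"
proof -
  have "K / \<kappa> \<le> total_recourse \<Delta> \<kappa> tie {..<4 * K} (blocks K)"
    using blocks_recourse[OF assms(1,2) order_refl] by blast
  then have "K / \<kappa> / (3 * K) \<le> total_recourse \<Delta> \<kappa> tie {..<4 * K} (blocks K) / (3 * K)"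
    by (rule divide_right_mono) simp
  moreover have "K / \<kappa> / (3 * K) = 1 / (3 * real \<kappa>)" using assms(3) by simp
  ultimately show ?thesis
    by (simp add: expected_amortized_recourse_def total_recourse_def length_blocks)
qed

theorem theorem2p10:
  "\<exists>C\<^sub>1 C\<^sub>2 :: real. 0 < C\<^sub>1 \<and> 0 < C\<^sub>2 \<and>
     (\<forall>(\<Delta>::nat) (c::nat) (\<kappa>::nat) (tie::tie_rule).
        3 \<le> \<Delta> \<longrightarrow> c \<le> \<Delta> - 2 \<longrightarrow> \<kappa> = \<Delta> + c \<longrightarrow>
        (\<forall>(V::nat set) us. finite V \<longrightarrow> insertion_sequence V \<Delta> us \<longrightarrow>
           expected_amortized_recourse \<Delta> \<kappa> tie V us \<le> C\<^sub>2 / real \<Delta>) \<and>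
        (\<forall>N::nat. \<exists>(V::nat set) us. finite V \<and> insertion_sequence V \<Delta> us \<and> N \<le> length us \<and>
           C\<^sub>1 / real \<Delta> \<le> expected_amortized_recourse \<Delta> \<kappa> tie V us))"
proof (rule exI[of _ "1 / 6"], rule exI[of _ 38], intro conjI allI impI)
  fix \<Delta> c \<kappa> :: nat and tie :: tie_rule and V :: "nat set" and us
  assume "3 \<le> \<Delta>" "\<kappa> = \<Delta> + c" "finite V" "insertion_sequence V \<Delta> us"
  then show "expected_amortized_recourse \<Delta> \<kappa> tie V us \<le> 38 / real \<Delta>"
    by (intro expected_amortized_recourse_le) auto
next
  fix \<Delta> c \<kappa> :: nat and tie :: tie_rule and N :: nat
  assume \<Delta>: "3 \<le> \<Delta>" "c \<le> \<Delta> - 2" "\<kappa> = \<Delta> + c"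
  \<comment> \<open>The successor makes the sequence nonempty, and its 3 * ?K insertions exceed
    \<open>N\<close>.\<close>
  let ?K = "Suc N"
  \<comment> \<open>One insertion in three costs at least 1 / \<kappa>, and \<kappa> < 2 \<Delta> by
    the bound on \<open>c\<close>; hence 1 / 6.\<close>
  have "1 / 6 / real \<Delta> = 1 / (3 * (2 * real \<Delta>))" by simp
  also have "\<dots> \<le> 1 / (3 * real \<kappa>)" using \<Delta> by (intro divide_left_mono) auto
  also have "\<dots> \<le> expected_amortized_recourse \<Delta> \<kappa> tie {..<4 * ?K} (blocks ?K)"
    using \<Delta> by (intro expected_amortized_recourse_ge) auto
  finally have "1 / 6 / real \<Delta> \<le> expected_amortized_recourse \<Delta> \<kappa> tie {..<4 * ?K} (blocks ?K)" .
  moreover have "insertion_sequence {..<4 * ?K} \<Delta> (blocks ?K)"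
    using blocks_recourse[of \<Delta> \<kappa> ?K ?K] \<Delta> by simp
  ultimately show "\<exists>(V::nat set) us. finite V \<and> insertion_sequence V \<Delta> us \<and> N \<le> length us \<and>
      1 / 6 / real \<Delta> \<le> expected_amortized_recourse \<Delta> \<kappa> tie V us"
    by (intro exI[of _ "{..<4 * ?K}"] exI[of _ "blocks ?K"]) (simp add: length_blocks)
qed auto

end
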